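(* Let $I$ be an index set and let $(\gamma_i)_{i\in I}$ be parameters in $[-1,1]$. (Complex case) For each $N$, let $\{X_i^N\}_{i\in I}$ be a family of independent normalized $N\times N$ complex Gaussian elliptic matrices, $X_i^N$ having parameter $\gamma_i$. Then $\{X_i^N\}_{i\in I}$ is asymptotically second-order free. (Real case) For each $N$, let $\{X_i^N\}_{i\in I}$ be a family of independent normalized $N\times N$ real Gaussian elliptic matrices, $X_i^N$ having parameter $\gamma_i$. Then $\{X_i^N\}_{i\in I}$ is asymptotically real second-order free.
   Context: Elliptic matrices. A complex Gaussian elliptic matrix of parameter $\gamma\in[-1,1]$ is a random matrix $(X_{ij})_{i,j=1}^N$ such that $\{X_{ii}\}_i\cup\{(X_{ij},X_{ji})\}_{i<j}$ are independent; the pairs $(X_{ij},X_{ji})$, $i<j$, are i.i.d. centered (jointly complex) Gaussian with $\mathbb E X_{ij}^2=\mathbb E X_{ji}^2=\mathbb E X_{ij}\overline{X_{ji}}=0$, $\mathbb E|X_{ij}|^2=\mathbb E|X_{ji}|^2=1$, $\mathbb E X_{ij}X_{ji}=\gamma$; and the $X_{ii}$ are i.i.d. centered (complex) Gaussian with $\mathbb E|X_{ii}|^2=1$, $\mathbb E X_{ii}^2=\gamma$. A real Gaussian elliptic matrix of parameter $\gamma\in[-1,1]$ is a real random matrix with the same independence structure, where the pairs $(X_{ij},X_{ji})$, $i<j$, are i.i.d. centered real Gaussian vectors with $\mathbb E X_{ij}^2=\mathbb E X_{ji}^2=1$, $\mathbb E X_{ij}X_{ji}=\gamma$, and the $X_{ii}$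 are i.i.d. centered real Gaussian with $\mathbb E X_{ii}^2=1+\gamma$. Normalized means multiplied by $N^{-1/2}$. $\operatorname{Tr}$ is the trace, $\operatorname{tr}=\frac1N\operatorname{Tr}$; $X^*$ is the conjugate transpose (equal to $X^T$ for real $X$). $\kappa_r$ denotes the $r$-th (multilinear, joint) classical cumulant; $\kappa_2(\xi_1,\xi_2)=\mathbb E(\xi_1\xi_2)-\mathbb E(\xi_1)\mathbb E(\xi_2)$. Second-order non-commutative probability space: a triple $(\mathcal A,\varphi_1,\varphi_2)$ with $\mathcal A$ a unital complex algebra, $\varphi_1:\mathcal A\to\mathbb C$ linear with $\varphi_1(1)=1$, and $\varphi_2:\mathcal A\times\mathcal A\to\mathbb C$ bilinear, symmetric, tracial in each argument, with $\varphi_2(1,a)=\varphi_2(a,1)=0$ for all $a$. Second-order limit distribution: $\{X_i^N\}_{i\in I}$ has a second-order limit distribution if there is a second-order non-commutative probability space $(\mathcal A,\varphi_1,\varphi_2)$ with an involution $*$ and elements $\{a_i\}_{i\in I}$ such that for all non-commutative $*$-polynomials $P,Q,P_1,\dots,P_r\in\mathbb C\langle x_i,x_i^*\mid i\in I\rangle$: $\lim_N\mathbb E[\operatorname{tr}P(X^N)]=\varphi_1(P(a))$; $\lim_N\kappa_2(\operatorname{Tr}P(X^N),\operatorname{Tr}Q(X^N))=\varphi_2(P(a),Q(a))$; and $\lim_N\kappa_r(\operatorname{Tr}P_1(X^N),\dots,\operatorname{Tr}P_r(X^N))=0$ for every $r\ge 3$. Here $P(X^N)$, $P(a)$ are evaluations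 $x_i\mapsto X_i^N$, $x_i^*\mapsto (X_i^N)^*$, respectively $x_i\mapsto a_i$, $x_i^*\mapsto a_i^*$. Let $\mathcal A^{(c)}$, $c\in I$, be subalgebras of $\mathcal A$. A sequence $(a_1,\dots,a_n)$ with $a_r\in\mathcal A^{(c(r))}$ is alternating if $c(r)\ne c(r+1)$ for $1\le r\le n-1$, and cyclically alternating if in addition $c(n)\ne c(1)$. It is centered if $\varphi_1(a_r)=0$ for all $r$. The family $\{\mathcal A^{(c)}\}$ is free w.r.t. $\varphi_1$ if $\varphi_1(a_1\cdots a_n)=0$ for all $n\ge1$ and all centered alternating sequences. Second-order freeness: $\{\mathcal A^{(c)}\}$ is second-order free if it is free w.r.t. $\varphi_1$ and for all centered cyclically alternating sequences $(a_1,\dots,a_p)$, $(b_1,\dots,b_q)$, $$\varphi_2(a_1\cdots a_p,b_1\cdots b_q)=\delta_{p,q}\sum_{k=1}^p\prod_{i=1}^p\varphi_1(a_ib_{k-i}),$$ indices modulo $p$. Real second-order freeness: when $\mathcal A$ also carries a linear involution $a\mapsto a^t$ reversing products, $\{\mathcal A^{(c)}\}$ is real second-order free if it is free w.r.t. $\varphi_1$ and for all such sequences $$\varphi_2(a_1\cdots a_p,b_1\cdots b_q)=\delta_{p,q}\sum_{k=1}^p\Big(\prod_{i=1}^p\varphi_1(a_ib_{k-i})+\prod_{i=1}^p\varphi_1(a_ib_{k+i}^t)\Big),$$ indices modulo $p$. For real matrix families, $t$ is the limit counterpart of the transpose, i.e. the linear product-reversing map with $a_i^t=a_i^*$, $(a_i^*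 )^t=a_i$. The family $\{X_i^N\}_{i\in I}$ is asymptotically second-order free (resp. asymptotically real second-order free) if it has a second-order limit distribution and the unital subalgebras $\mathcal A^{(i)}$ generated by $a_i,a_i^*$ ($i\in I$) are second-order free (resp. real second-order free). Equivalently for the covariance condition: for any $p,q\ge2$ and cyclically alternating $(A_1,\dots,A_p)$, $(B_1,\dots,B_q)$ with $A_i\in\mathrm{alg}\langle X^N_{c(i)},(X^N_{c(i)})^*\rangle$, $B_j\in\mathrm{alg}\langle X^N_{d(j)},(X^N_{d(j)})^*\rangle$ and $\mathbb E\operatorname{tr}A_i=\mathbb E\operatorname{tr}B_j=0$, the limit of $\kappa_2(\operatorname{Tr}(A_1\cdots A_p),\operatorname{Tr}(B_1\cdots B_q))$ is $\delta_{p,q}\sum_{k=1}^p\prod_{i=1}^p\lim_N\mathbb E\operatorname{tr}(A_iB_{k-i})$ in the complex case, and $\delta_{p,q}\sum_{k=1}^p\big(\prod_{i=1}^p\lim_N\mathbb E\operatorname{tr}(A_iB_{k-i})+\prod_{i=1}^p\lim_N\mathbb E\operatorname{tr}(A_iB_{k+i}^T)\big)$ in the real case. *)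

theory Defs
  imports
    "HOL-Probability.Probability"
    "HOL-Library.Poly_Mapping"
    "HOL-Algebra.Module"
    "Jordan_Normal_Form.Matrix"
    "Jordan_Normal_Form.Schur_Decomposition"
    "Jordan_Normal_Form.VS_Connect"
begin

section \<open>Gaussian elliptic matrices\<close>

text \<open>A random vector is centered Gaussian if all its real one-dimensional marginals are centered
  normal; the degenerate law (a Dirac mass at 0) is included, as it occurs for parameters \<open>1\<close> and
  \<open>-1\<close>. Here \<open>complex\<close> and \<open>complex \<times> complex\<close> are real Euclidean spaces of dimension 2 and 4, so
  for them this is joint Gaussianity of the real and imaginary parts.\<close>

definition centered_gaussian :: "'w measure \<Rightarrow> ('w \<Rightarrow> 'e::euclidean_space) \<Rightarrow> bool" where
  "centered_gaussian M Y \<longleftrightarrow>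
     Y \<in> borel_measurable M \<and>
     (\<forall>u. \<exists>\<sigma>\<ge>0. distr M borel (\<lambda>w. inner u (Y w)) =
        (if \<sigma> = 0 then return borel 0 else density lborel (normal_density 0 \<sigma>)))"

text \<open>The independence structure shared by the complex and the real case: the blocks
  \<open>(X\<^sub>i\<^sub>j, X\<^sub>j\<^sub>i)\<close>, \<open>i \<le> j\<close>, are independent. For \<open>i = j\<close> the block \<open>(X\<^sub>i\<^sub>i, X\<^sub>i\<^sub>i)\<close> carries the same
  information as \<open>X\<^sub>i\<^sub>i\<close>.\<close>

definition elliptic_independence ::
    "'w measure \<Rightarrow> nat \<Rightarrow> ('w \<Rightarrow> 'a::topological_space mat) \<Rightarrow> bool" where
  "elliptic_independence M N X \<longleftrightarrow>
     (\<forall>w\<in>space M. X w \<in> carrier_mat N N) \<and>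
     prob_space.indep_vars M (\<lambda>_. borel) (\<lambda>(i, j) w. (X w $$ (i, j), X w $$ (j, i)))
       {(i, j). i \<le> j \<and> j < N}"

text \<open>The covariances below determine the law of each centered Gaussian block, so that
  blocks of the same kind are automatically identically distributed.\<close>

definition complex_elliptic :: "'w measure \<Rightarrow> nat \<Rightarrow> real \<Rightarrow> ('w \<Rightarrow> complex mat) \<Rightarrow> bool" where
  "complex_elliptic M N \<gamma> X \<longleftrightarrow>
     elliptic_independence M N X \<and>
     (\<forall>i j. i < j \<longrightarrow> j < N \<longrightarrow>
        centered_gaussian M (\<lambda>w. (X w $$ (i, j), X w $$ (j, i))) \<and>
        (\<integral>w. (X w $$ (i, j))\<^sup>2 \<partial>M) = 0 \<and>
        (\<integral>w. (X w $$ (j, i))\<^sup>2 \<partial>M) = 0 \<and>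
        (\<integral>w. X w $$ (i, j) * cnj (X w $$ (j, i)) \<partial>M) = 0 \<and>
        (\<integral>w. (cmod (X w $$ (i, j)))\<^sup>2 \<partial>M) = 1 \<and>
        (\<integral>w. (cmod (X w $$ (j, i)))\<^sup>2 \<partial>M) = 1 \<and>
        (\<integral>w. X w $$ (i, j) * X w $$ (j, i) \<partial>M) = complex_of_real \<gamma>) \<and>
     (\<forall>i<N.
        centered_gaussian M (\<lambda>w. X w $$ (i, i)) \<and>
        (\<integral>w. (cmod (X w $$ (i, i)))\<^sup>2 \<partial>M) = 1 \<and>
        (\<integral>w. (X w $$ (i, i))\<^sup>2 \<partial>M) = complex_of_real \<gamma>)"

definition real_elliptic :: "'w measure \<Rightarrow> nat \<Rightarrow> real \<Rightarrow> ('w \<Rightarrow> real mat) \<Rightarrow> bool" where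
  "real_elliptic M N \<gamma> X \<longleftrightarrow>
     elliptic_independence M N X \<and>
     (\<forall>i j. i < j \<longrightarrow> j < N \<longrightarrow>
        centered_gaussian M (\<lambda>w. (X w $$ (i, j), X w $$ (j, i))) \<and>
        (\<integral>w. (X w $$ (i, j))\<^sup>2 \<partial>M) = 1 \<and>
        (\<integral>w. (X w $$ (j, i))\<^sup>2 \<partial>M) = 1 \<and>
        (\<integral>w. X w $$ (i, j) * X w $$ (j, i) \<partial>M) = \<gamma>) \<and>
     (\<forall>i<N.
        centered_gaussian M (\<lambda>w. X w $$ (i, i)) \<and>
        (\<integral>w. (X w $$ (i, i))\<^sup>2 \<partial>M) = 1 + \<gamma>)"

definition independent_matrices ::
    "'w measure \<Rightarrow> nat \<Rightarrow> 'i set \<Rightarrow> ('i \<Rightarrow> 'w \<Rightarrow> 'a::topological_space mat) \<Rightarrow> bool" where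
  "independent_matrices M N I X \<longleftrightarrow>
     prob_space.indep_vars M (\<lambda>_. PiM ({..<N} \<times> {..<N}) (\<lambda>_. borel))
       (\<lambda>i w. \<lambda>p\<in>{..<N} \<times> {..<N}. X i w $$ p) I"

definition normalized :: "nat \<Rightarrow> 'a::real_algebra_1 mat \<Rightarrow> 'a mat" where
  "normalized N A = of_real (1 / sqrt (real N)) \<cdot>\<^sub>m A"


section \<open>Classical cumulants\<close>

text \<open>The joint cumulant, by Moebius inversion of the moment-cumulant formula over set partitions.\<close>

definition cumulant :: "'w measure \<Rightarrow> ('w \<Rightarrow> complex) list \<Rightarrow> complex" where
  "cumulant M \<xi>s =
     (\<Sum>\<pi> | partition_on {..<length \<xi>s} \<pi>.
        (-1) ^ (card \<pi> - 1) * fact (card \<pi> - 1) *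
        (\<Prod>B\<in>\<pi>. \<integral>w. (\<Prod>j\<in>B. (\<xi>s ! j) w) \<partial>M))"


section \<open>Second-order non-commutative probability spaces\<close>

definition complex_algebra :: "(complex, 'b, 'm) module_scheme \<Rightarrow> bool" where
  "complex_algebra A \<longleftrightarrow>
     ring A \<and> Module.module (class_ring :: complex ring) A \<and>
     (\<forall>c. \<forall>x\<in>carrier A. \<forall>y\<in>carrier A.
        (c \<odot>\<^bsub>A\<^esub> x) \<otimes>\<^bsub>A\<^esub> y = c \<odot>\<^bsub>A\<^esub> (x \<otimes>\<^bsub>A\<^esub> y) \<and>
        x \<otimes>\<^bsub>A\<^esub> (c \<odot>\<^bsub>A\<^esub> y) = c \<odot>\<^bsub>A\<^esub> (x \<otimes>\<^bsub>A\<^esub> y))"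

text \<open>A product-reversing involution, conjugate-linear for \<open>\<sigma> = cnj\<close> and linear for \<open>\<sigma> = id\<close>.\<close>

definition anti_involution ::
    "(complex, 'b, 'm) module_scheme \<Rightarrow> (complex \<Rightarrow> complex) \<Rightarrow> ('b \<Rightarrow> 'b) \<Rightarrow> bool" where
  "anti_involution A \<sigma> f \<longleftrightarrow>
     f \<in> carrier A \<rightarrow> carrier A \<and>
     (\<forall>x\<in>carrier A. f (f x) = x) \<and>
     (\<forall>x\<in>carrier A. \<forall>y\<in>carrier A. f (x \<oplus>\<^bsub>A\<^esub> y) = f x \<oplus>\<^bsub>A\<^esub> f y) \<and>
     (\<forall>c. \<forall>x\<in>carrier A. f (c \<odot>\<^bsub>A\<^esub> x) = \<sigma> c \<odot>\<^bsub>A\<^esub> f x) \<and>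
     (\<forall>x\<in>carrier A. \<forall>y\<in>carrier A. f (x \<otimes>\<^bsub>A\<^esub> y) = f y \<otimes>\<^bsub>A\<^esub> f x)"

definition linear_functional :: "(complex, 'b, 'm) module_scheme \<Rightarrow> ('b \<Rightarrow> complex) \<Rightarrow> bool" where
  "linear_functional A f \<longleftrightarrow>
     (\<forall>x\<in>carrier A. \<forall>y\<in>carrier A. f (x \<oplus>\<^bsub>A\<^esub> y) = f x + f y) \<and>
     (\<forall>c. \<forall>x\<in>carrier A. f (c \<odot>\<^bsub>A\<^esub> x) = c * f x)"

record 'b so_space = "(complex, 'b) module" +
  phi1 :: "'b \<Rightarrow> complex"
  phi2 :: "'b \<Rightarrow> 'b \<Rightarrow> complex"
  star :: "'b \<Rightarrow> 'b"

definition second_order_star_space :: "'b so_space \<Rightarrow> bool" where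
  "second_order_star_space A \<longleftrightarrow>
     complex_algebra A \<and>
     linear_functional A (phi1 A) \<and> phi1 A \<one>\<^bsub>A\<^esub> = 1 \<and>
     (\<forall>x\<in>carrier A. linear_functional A (phi2 A x)) \<and>
     (\<forall>y\<in>carrier A. linear_functional A (\<lambda>x. phi2 A x y)) \<and>
     (\<forall>x\<in>carrier A. \<forall>y\<in>carrier A. phi2 A x y = phi2 A y x) \<and>
     (\<forall>x\<in>carrier A. \<forall>y\<in>carrier A. \<forall>z\<in>carrier A.
        phi2 A (x \<otimes>\<^bsub>A\<^esub> y) z = phi2 A (y \<otimes>\<^bsub>A\<^esub> x) z \<and>
        phi2 A z (x \<otimes>\<^bsub>A\<^esub> y) = phi2 A z (y \<otimes>\<^bsub>A\<^esub> x)) \<and>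
     (\<forall>x\<in>carrier A. phi2 A \<one>\<^bsub>A\<^esub> x = 0 \<and> phi2 A x \<one>\<^bsub>A\<^esub> = 0) \<and>
     anti_involution A cnj (star A)"


section \<open>Freeness and (real) second-order freeness\<close>

inductive_set gen_subalgebra :: "(complex, 'b, 'm) module_scheme \<Rightarrow> 'b set \<Rightarrow> 'b set"
  for A and S where
  gen: "x \<in> S \<Longrightarrow> x \<in> gen_subalgebra A S"
| one: "\<one>\<^bsub>A\<^esub> \<in> gen_subalgebra A S"
| add: "x \<in> gen_subalgebra A S \<Longrightarrow> y \<in> gen_subalgebra A S \<Longrightarrow> x \<oplus>\<^bsub>A\<^esub> y \<in> gen_subalgebra A S"
| mult: "x \<in> gen_subalgebra A S \<Longrightarrow> y \<in> gen_subalgebra A S \<Longrightarrow> x \<otimes>\<^bsub>A\<^esub> y \<in> gen_subalgebra A S"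
| smult: "x \<in> gen_subalgebra A S \<Longrightarrow> c \<odot>\<^bsub>A\<^esub> x \<in> gen_subalgebra A S"

definition list_mult :: "('b, 'm) monoid_scheme \<Rightarrow> 'b list \<Rightarrow> 'b" where
  "list_mult A xs = foldr (mult A) xs \<one>\<^bsub>A\<^esub>"

text \<open>\<open>Sub\<close> is a family of subalgebras indexed by \<open>I\<close>, and \<open>cs\<close> lists the indices of the
  subalgebras from which the members of \<open>as\<close> are taken.\<close>

definition centered_alternating ::
    "'b so_space \<Rightarrow> 'i set \<Rightarrow> ('i \<Rightarrow> 'b set) \<Rightarrow> 'i list \<Rightarrow> 'b list \<Rightarrow> bool" where
  "centered_alternating A I Sub cs as \<longleftrightarrow>
     as \<noteq> [] \<and> length cs = length as \<and> set cs \<subseteq> I \<and> distinct_adj cs \<and>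
     (\<forall>r<length as. as ! r \<in> Sub (cs ! r) \<and> phi1 A (as ! r) = 0)"

definition centered_cyc_alternating ::
    "'b so_space \<Rightarrow> 'i set \<Rightarrow> ('i \<Rightarrow> 'b set) \<Rightarrow> 'i list \<Rightarrow> 'b list \<Rightarrow> bool" where
  "centered_cyc_alternating A I Sub cs as \<longleftrightarrow>
     centered_alternating A I Sub cs as \<and> last cs \<noteq> hd cs"

definition free_family :: "'b so_space \<Rightarrow> 'i set \<Rightarrow> ('i \<Rightarrow> 'b set) \<Rightarrow> bool" where
  "free_family A I Sub \<longleftrightarrow>
     (\<forall>cs as. centered_alternating A I Sub cs as \<longrightarrow> phi1 A (list_mult A as) = 0)"

text \<open>Entry number \<open>m\<close> of a list, counted from 1 and read modulo its length.\<close>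

definition cyc :: "'b list \<Rightarrow> int \<Rightarrow> 'b" where
  "cyc xs m = xs ! nat ((m - 1) mod int (length xs))"

definition second_order_free :: "'b so_space \<Rightarrow> 'i set \<Rightarrow> ('i \<Rightarrow> 'b set) \<Rightarrow> bool" where
  "second_order_free A I Sub \<longleftrightarrow>
     free_family A I Sub \<and>
     (\<forall>cs as ds bs.
        centered_cyc_alternating A I Sub cs as \<longrightarrow>
        centered_cyc_alternating A I Sub ds bs \<longrightarrow>
        phi2 A (list_mult A as) (list_mult A bs) =
          (if length as = length bs then
             (\<Sum>k=1..int (length as). \<Prod>i=1..int (length as).
                phi1 A (cyc as i \<otimes>\<^bsub>A\<^esub> cyc bs (k - i)))
           else 0))"

definition real_second_order_free ::
    "'b so_space \<Rightarrow> ('b \<Rightarrow> 'b) \<Rightarrow> 'i set \<Rightarrow> ('i \<Rightarrow> 'b set) \<Rightarrow> bool" where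
  "real_second_order_free A t I Sub \<longleftrightarrow>
     free_family A I Sub \<and>
     (\<forall>cs as ds bs.
        centered_cyc_alternating A I Sub cs as \<longrightarrow>
        centered_cyc_alternating A I Sub ds bs \<longrightarrow>
        phi2 A (list_mult A as) (list_mult A bs) =
          (if length as = length bs then
             (\<Sum>k=1..int (length as).
                (\<Prod>i=1..int (length as). phi1 A (cyc as i \<otimes>\<^bsub>A\<^esub> cyc bs (k - i))) +
                (\<Prod>i=1..int (length as). phi1 A (cyc as i \<otimes>\<^bsub>A\<^esub> t (cyc bs (k + i)))))
           else 0))"


section \<open>Non-commutative *-polynomials and second-order limit distributions\<close>

text \<open>\<open>Var i\<close> and \<open>VarStar i\<close> are the letters $x_i$ and $x_i^*$. A *-polynomial is a finitely
  supported function from words in these letters to coefficients.\<close>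

datatype 'i letter = Var (index: 'i) | VarStar (index: 'i)

type_synonym 'i star_poly = "'i letter list \<Rightarrow>\<^sub>0 complex"

definition star_polys :: "'i set \<Rightarrow> 'i star_poly set" where
  "star_polys I = {P. \<forall>u\<in>Poly_Mapping.keys P. index ` set u \<subseteq> I}"

definition star_eval ::
    "(complex, 'b, 'm) module_scheme \<Rightarrow> ('b \<Rightarrow> 'b) \<Rightarrow> ('i \<Rightarrow> 'b) \<Rightarrow> 'i star_poly \<Rightarrow> 'b" where
  "star_eval A s x P =
     (\<Oplus>\<^bsub>A\<^esub>u\<in>Poly_Mapping.keys P. Poly_Mapping.lookup P u \<odot>\<^bsub>A\<^esub>
        list_mult A (map (\<lambda>l. case l of Var i \<Rightarrow> x i | VarStar i \<Rightarrow> s (x i)) u))"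

definition mat_trace :: "complex mat \<Rightarrow> complex" where
  "mat_trace B = (\<Sum>i<dim_row B. B $$ (i, i))"

definition trace_poly ::
    "nat \<Rightarrow> ('i \<Rightarrow> 'w \<Rightarrow> complex mat) \<Rightarrow> 'i star_poly \<Rightarrow> 'w \<Rightarrow> complex" where
  "trace_poly N X P w =
     mat_trace (star_eval (module_mat TYPE(complex) N N) mat_adjoint (\<lambda>i. X i w) P)"

text \<open>That the mixed moments of traces exist is part of the notion; otherwise expectations would
  be Bochner integrals of non-integrable functions, which are 0 by convention.\<close>

definition second_order_limit ::
    "'i set \<Rightarrow> (nat \<Rightarrow> 'w measure) \<Rightarrow> (nat \<Rightarrow> 'i \<Rightarrow> 'w \<Rightarrow> complex mat) \<Rightarrow>
     'b so_space \<Rightarrow> ('i \<Rightarrow> 'b) \<Rightarrow> bool" where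
  "second_order_limit I M X A a \<longleftrightarrow>
     second_order_star_space A \<and> a \<in> I \<rightarrow> carrier A \<and>
     (\<forall>N>0. \<forall>Ps. set Ps \<subseteq> star_polys I \<longrightarrow>
        integrable (M N) (\<lambda>w. \<Prod>P\<leftarrow>Ps. trace_poly N (X N) P w)) \<and>
     (\<forall>P\<in>star_polys I.
        (\<lambda>N. \<integral>w. trace_poly N (X N) P w / of_nat N \<partial>M N)
          \<longlonglongrightarrow> phi1 A (star_eval A (star A) a P)) \<and>
     (\<forall>P\<in>star_polys I. \<forall>Q\<in>star_polys I.
        (\<lambda>N. cumulant (M N) [trace_poly N (X N) P, trace_poly N (X N) Q])
          \<longlonglongrightarrow> phi2 A (star_eval A (star A) a P) (star_eval A (star A) a Q)) \<and>
     (\<forall>Ps. set Ps \<subseteq> star_polys I \<longrightarrow> length Ps \<ge> 3 \<longrightarrow>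
        (\<lambda>N. cumulant (M N) (map (trace_poly N (X N)) Ps)) \<longlonglongrightarrow> 0)"

text \<open>One cannot quantify over the type of the elements of the limit space, so its carrier is
  taken to be an arbitrary subset of the type of *-polynomials. This loses no generality: a limit
  in any algebra can be pulled back along \<open>x\<^sub>i \<mapsto> a\<^sub>i\<close> to the free *-algebra, and this
  preserves the freeness conditions.\<close>

definition asymptotically_second_order_free ::
    "'i set \<Rightarrow> (nat \<Rightarrow> 'w measure) \<Rightarrow> (nat \<Rightarrow> 'i \<Rightarrow> 'w \<Rightarrow> complex mat) \<Rightarrow> bool" where
  "asymptotically_second_order_free I M X \<longleftrightarrow>
     (\<exists>(A :: 'i star_poly so_space) a.
        second_order_limit I M X A a \<and>
        second_order_free A I (\<lambda>i. gen_subalgebra A {a i, star A (a i)}))"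

definition asymptotically_real_second_order_free ::
    "'i set \<Rightarrow> (nat \<Rightarrow> 'w measure) \<Rightarrow> (nat \<Rightarrow> 'i \<Rightarrow> 'w \<Rightarrow> real mat) \<Rightarrow> bool" where
  "asymptotically_real_second_order_free I M X \<longleftrightarrow>
     (\<exists>(A :: 'i star_poly so_space) a t.
        second_order_limit I M (\<lambda>N i w. map_mat complex_of_real (X N i w)) A a \<and>
        anti_involution A id t \<and>
        (\<forall>i\<in>I. t (a i) = star A (a i) \<and> t (star A (a i)) = a i) \<and>
        real_second_order_free A t I (\<lambda>i. gen_subalgebra A {a i, star A (a i)}))"

end

theory Submission
  imports Defs
begin

text \<open>Gaussian integration by parts, applied to the first letter of the first word, gives loop
equations for the mixed moments of traces of words. Summing over the splittings of the list of the
remaining words turns them into equations for cumulants that are closed under induction on the total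
length. In the limit they become Schwinger-Dyson recursions for \<open>\<phi>\<^sub>1\<close> and \<open>\<phi>\<^sub>2\<close>, while all cumulants of
order at least 3 vanish. The complex case (\<open>\<theta> = 0\<close>) and the real case (\<open>\<theta> = 1\<close>) differ by the weight
\<open>\<theta>\<close> of the contractions that reverse the orientation of a word; these give the second sum in real
second-order freeness. Applying the recursions to the first letter of the first factor of a centered
alternating product yields the freeness relations.\<close>

section \<open>Splittings of lists and cumulants\<close>

text \<open>Moments of traces grow with N. In cumulants the sizes are known in advance: a first
  cumulant has order N, all others stay bounded. So after division by N one can read off what
  survives; of a product of two cumulants, only the case where one is a first cumulant. Integration
  by parts avoids densities, since blocks degenerate at parameters 1 and -1: all that is used of
  joint Gaussianity is that linear combinations are Gaussian, with moments determined by their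
  variance. Both matrix models enter through one covariance formula, E(x_ij y_kl) = (b(x,y)
  [i = l, j = k] + \<theta> b(x, tr y) [i = k, j = l]) / N, where b is the parameter on equal
  letters and 1 on a letter and its adjoint. The limit space is the free algebra itself.\<close>

fun splits :: "'a list \<Rightarrow> ('a list \<times> 'a list) list" where
  "splits [] = [([], [])]"
| "splits (x # xs) = map (\<lambda>(B, C). (x # B, C)) (splits xs) @ map (\<lambda>(B, C). (B, x # C)) (splits xs)"

text \<open>Cumulants are kept on lists rather than on sets because the same word may occur several
  times; a splitting distributes positions and keeps their order.\<close>

definition ssum :: "'a list \<Rightarrow> ('a list \<Rightarrow> 'a list \<Rightarrow> complex) \<Rightarrow> complex" where
  "ssum xs f = (\<Sum>(B, C)\<leftarrow>splits xs. f B C)"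

lemma ssum_Nil [simp]: "ssum [] f = f [] []"
  by (simp add: ssum_def)

lemma ssum_Cons: "ssum (x # xs) f = ssum xs (\<lambda>B C. f (x # B) C) + ssum xs (\<lambda>B C. f B (x # C))"
  by (simp add: ssum_def case_prod_unfold comp_def)

lemma ssum_add: "ssum xs (\<lambda>B C. f B C + g B C) = ssum xs f + ssum xs g"
  by (induction xs arbitrary: f g) (simp_all add: ssum_Cons)

lemma ssum_const_left: "ssum xs (\<lambda>B C. c * f B C) = c * ssum xs f"
  by (induction xs arbitrary: f) (simp_all add: ssum_Cons distrib_left)

lemma ssum_sum: "ssum xs (\<lambda>B C. \<Sum>a\<in>A. f a B C) = (\<Sum>a\<in>A. ssum xs (f a))"
  by (induction xs arbitrary: f) (simp_all add: ssum_Cons sum.distrib)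

text \<open>No splitting creates or loses an entry, so summands may be compared under the multiset
  identity; later proofs read off lengths and total word length from it.\<close>

lemma ssum_cong:
  "(\<And>B C. mset B + mset C = mset xs \<Longrightarrow> f B C = g B C) \<Longrightarrow>
    ssum xs f = ssum xs g"
proof (induction xs arbitrary: f g)
  case (Cons x xs)
  have "ssum xs (\<lambda>B C. f (x # B) C) = ssum xs (\<lambda>B C. g (x # B) C)"
    by (rule Cons.IH) (rule Cons.prems; auto)
  moreover have "ssum xs (\<lambda>B C. f B (x # C)) = ssum xs (\<lambda>B C. g B (x # C))"
    by (rule Cons.IH) (rule Cons.prems; auto)
  ultimately show ?case by (simp add: ssum_Cons)
qed simp

text \<open>Both sides run over the distributions of \<open>xs\<close> into three sublists; they
  differ only in which two parts are separated last.\<close>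

lemma ssum_assoc:
  "ssum xs (\<lambda>B C. ssum C (\<lambda>B' C'. f B B' C')) = ssum xs (\<lambda>E C'. ssum E (\<lambda>B B'. f B B' C'))"
proof (induction xs arbitrary: f)
  case (Cons x xs)
  show ?case
    by (simp add: ssum_Cons ssum_add Cons.IH)
qed simp

definition psum :: "'a list \<Rightarrow> ('a \<Rightarrow> 'a list \<Rightarrow> complex) \<Rightarrow> complex" where
  "psum xs f = (\<Sum>k<length xs. f (xs ! k) (take k xs @ drop (Suc k) xs))"

lemma psum_Nil [simp]: "psum [] f = 0"
  by (simp add: psum_def)

lemma psum_Cons: "psum (x # xs) f = f x xs + psum xs (\<lambda>y ys. f y (x # ys))"
  by (simp add: psum_def sum.lessThan_Suc_shift del: sum.lessThan_Suc)

lemma psum_add: "psum xs (\<lambda>y ys. f y ys + g y ys) = psum xs f + psum xs g"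
  by (simp add: psum_def sum.distrib)

lemma psum_const_left: "psum xs (\<lambda>y ys. c * f y ys) = c * psum xs f"
  by (simp add: psum_def sum_distrib_left)

text \<open>Choosing an entry and then distributing the rest is the same as distributing first and
  choosing from the left part. In the loop equation this moves a contracted word into the cumulant
  of the first word.\<close>

lemma psum_ssum:
  "psum xs (\<lambda>y ys. ssum ys (\<lambda>B C. f y B C)) = ssum xs (\<lambda>E C. psum E (\<lambda>y B. f y B C))"
proof (induction xs arbitrary: f)
  case (Cons x xs)
  show ?case
    by (simp add: psum_Cons ssum_Cons ssum_add psum_add Cons.IH algebra_simps)
qed simp

lemma ssum_subsets:
  assumes "distinct xs"
  shows "ssum xs (\<lambda>B C. f (set B) (set C)) = (\<Sum>A\<in>Pow (set xs). f A (set xs - A))"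
  using assms
proof (induction xs arbitrary: f)
  case (Cons x xs)
  have x: "x \<notin> set xs" using Cons.prems by simp
  have "(\<Sum>A\<in>Pow (set (x # xs)). f A (set (x # xs) - A)) =
    (\<Sum>A\<in>Pow (set xs). f A (set (x # xs) - A)) + (\<Sum>A\<in>insert x ` Pow (set xs). f A (set (x # xs) - A))"
    unfolding list.set Pow_insert using x by (intro sum.union_disjoint) auto
  also have "(\<Sum>A\<in>insert x ` Pow (set xs). f A (set (x # xs) - A)) =
    (\<Sum>A\<in>Pow (set xs). f (insert x A) (set (x # xs) - insert x A))"
    using x by (intro sum.reindex_cong[of "insert x"]) (auto intro!: inj_onI)
  also have "\<dots> = (\<Sum>A\<in>Pow (set xs). f (insert x A) (set xs - A))"
    using x by (intro sum.cong refl arg_cong2[of _ _ _ _ f]) auto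
  also have "(\<Sum>A\<in>Pow (set xs). f A (set (x # xs) - A)) = (\<Sum>A\<in>Pow (set xs). f A (insert x (set xs - A)))"
    using x by (intro sum.cong refl arg_cong2[of _ _ _ _ f]) auto
  finally show ?case
    using Cons.IH[of "\<lambda>A C. f (insert x A) C"] Cons.IH[of "\<lambda>A C. f A (insert x C)"] Cons.prems
    by (simp add: ssum_Cons add.commute)
qed simp

section \<open>Joint cumulants: Moebius inversion and the list recursion\<close>

definition mcum :: "('j set \<Rightarrow> complex) \<Rightarrow> 'j set \<Rightarrow> complex" where
  "mcum m S = (\<Sum>\<pi> | partition_on S \<pi>. (-1) ^ (card \<pi> - 1) * fact (card \<pi> - 1) * (\<Prod>B\<in>\<pi>. m B))"

text \<open>A partition of \<open>B\<close> together with the block \<open>S - B\<close> is a partition of \<open>S\<close> with a marked block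
  not containing \<open>s\<close>; every partition of \<open>S\<close> with \<open>n \<ge> 2\<close> blocks has \<open>n - 1\<close> such blocks, and its
  total weight cancels except for \<open>{S}\<close>.\<close>

lemma mcum_recursion:
  assumes fin: "finite S" and s: "s \<in> S" and m0: "m {} = 1"
  shows "m S = (\<Sum>A\<in>Pow (S - {s}). mcum m (insert s A) * m (S - insert s A))"
proof -
  let ?P = "\<lambda>S. {\<pi>. partition_on S \<pi>}"
  let ?wt = "\<lambda>\<pi>. (-1) ^ (card \<pi> - 1) * fact (card \<pi> - 1) * (\<Prod>B\<in>\<pi>. m B) :: complex"
  have finP: "finite (?P T)" if "T \<subseteq> S" for T
    using finitely_many_partition_on[of T] finite_subset[OF that fin] by simp
  have part_fin: "finite \<pi>" if "partition_on T \<pi>" "T \<subseteq> S" for \<pi> T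
    using that fin finite_elements finite_subset by metis
  define Q where "Q = (SIGMA \<sigma>:?P S. {B \<in> \<sigma>. s \<notin> B})"
  \<comment> \<open>The index \<open>A = S - {s}\<close> is set aside: there the complement is
    empty, hence no block, and the term is the cumulant of \<open>S\<close> itself.\<close>
  have "(\<Sum>A\<in>Pow (S - {s}) - {S - {s}}. mcum m (insert s A) * m (S - insert s A)) =
    (\<Sum>(A, \<pi>)\<in>(SIGMA A:Pow (S - {s}) - {S - {s}}. ?P (insert s A)). ?wt \<pi> * m (S - insert s A))"
    unfolding mcum_def sum_distrib_right
    using fin s by (subst sum.Sigma) (auto intro!: finP)
  also have "\<dots> = (\<Sum>(\<sigma>, B)\<in>Q. ?wt (\<sigma> - {B}) * m B)"
  proof (rule sum.reindex_bij_witness[of _ "\<lambda>(\<sigma>, B). (S - {s} - B, \<sigma> - {B})" "\<lambda>(A, \<pi>). (insert (S - insert s A) \<pi>, S - insert s A)"], goal_cases)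
    case (1 a)
    then obtain A \<pi> where a: "a = (A, \<pi>)" "A \<subseteq> S - {s}" "A \<noteq> S - {s}" "partition_on (insert s A) \<pi>" by auto
    then have "S - insert s A \<notin> \<pi>" unfolding partition_on_def by auto
    then show ?case using a by auto
  next
    case (2 a)
    then obtain A \<pi> where a: "a = (A, \<pi>)" "A \<subseteq> S - {s}" "A \<noteq> S - {s}" "partition_on (insert s A) \<pi>" by auto
    then have "partition_on S (insert (S - insert s A) \<pi>)"
      using s unfolding partition_on_def disjoint_def by auto
    then show ?case using a by (auto simp: Q_def)
  next
    case (3 b)
    then obtain \<sigma> B where b: "b = (\<sigma>, B)" "partition_on S \<sigma>" "B \<in> \<sigma>" "s \<notin> B" by (auto simp: Q_def)
    then have "S - insert s (S - {s} - B) = B" unfolding partition_on_def by auto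
    then show ?case using b by auto
  next
    case (4 b)
    then obtain \<sigma> B where b: "b = (\<sigma>, B)" "partition_on S \<sigma>" "B \<in> \<sigma>" "s \<notin> B" by (auto simp: Q_def)
    then have "B \<subseteq> S" "B \<noteq> {}" "insert s (S - {s} - B) = S - B" using s unfolding partition_on_def by auto
    moreover have "partition_on (S - B) (\<sigma> - {B})"
      using b(2,3) unfolding partition_on_def disjoint_def by auto
    ultimately show ?case using b by auto
  next
    case (5 a)
    then obtain A \<pi> where a: "a = (A, \<pi>)" "A \<subseteq> S - {s}" "A \<noteq> S - {s}" "partition_on (insert s A) \<pi>" by auto
    then have "S - insert s A \<notin> \<pi>" unfolding partition_on_def by auto
    then show ?case using a by simp
  qed
  also have "\<dots> = (\<Sum>\<sigma>\<in>?P S. \<Sum>B\<in>{B \<in> \<sigma>. s \<notin> B}. ?wt (\<sigma> - {B}) * m B)"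
    unfolding Q_def using finP[of S] part_fin[of S] by (subst sum.Sigma) auto
  also have "\<dots> = (\<Sum>\<sigma>\<in>?P S. if \<sigma> = {S} then 0 else - ?wt \<sigma>)"
  proof (rule sum.cong[OF refl])
    fix \<sigma> assume "\<sigma> \<in> ?P S"
    then have \<sigma>: "partition_on S \<sigma>" by simp
    have fin\<sigma>: "finite \<sigma>" using part_fin[OF \<sigma>] by simp
    obtain B0 where B0: "B0 \<in> \<sigma>" "s \<in> B0" using \<sigma> s unfolding partition_on_def by auto
    have eq: "{B \<in> \<sigma>. s \<notin> B} = \<sigma> - {B0}"
      using \<sigma> B0 unfolding partition_on_def disjoint_def by auto
    \<comment> \<open>Up to sign this misses the weight of \<open>\<sigma>\<close> by the factor
      \<open>card \<sigma> - 1\<close>, which is the number of admissible \<open>B\<close>.\<close>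
    have "?wt (\<sigma> - {B}) * m B = (-1) ^ (card \<sigma> - 2) * fact (card \<sigma> - 2) * (\<Prod>B\<in>\<sigma>. m B)" if "B \<in> \<sigma>" for B
      using that fin\<sigma> by (simp add: prod.remove[OF fin\<sigma> that] card_Diff_singleton numeral_2_eq_2)
    then have "(\<Sum>B\<in>{B \<in> \<sigma>. s \<notin> B}. ?wt (\<sigma> - {B}) * m B) =
       of_nat (card \<sigma> - 1) * ((-1) ^ (card \<sigma> - 2) * fact (card \<sigma> - 2) * (\<Prod>B\<in>\<sigma>. m B))"
      using B0 fin\<sigma> by (simp add: eq card_Diff_singleton)
    also have "\<dots> = (if \<sigma> = {S} then 0 else - ?wt \<sigma>)"
    proof (cases "\<sigma> = {S}")
      case False
      have "card \<sigma> \<noteq> 1"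
      proof
        assume "card \<sigma> = 1"
        then obtain X where "\<sigma> = {X}" by (auto simp: card_1_singleton_iff)
        then show False using \<sigma> False unfolding partition_on_def by auto
      qed
      moreover have "card \<sigma> \<noteq> 0" using B0 fin\<sigma> by auto
      ultimately obtain n where "card \<sigma> = Suc (Suc n)" by (metis One_nat_def not0_implies_Suc)
      then show ?thesis using False by simp
    qed simp
    finally show "(\<Sum>B\<in>{B \<in> \<sigma>. s \<notin> B}. ?wt (\<sigma> - {B}) * m B) = (if \<sigma> = {S} then 0 else - ?wt \<sigma>)" .
  qed
  also have "\<dots> = m S - mcum m S"
  proof -
    have pS: "{S} \<in> ?P S" using s unfolding partition_on_def disjoint_def by auto
    have "mcum m S = m S + (\<Sum>\<sigma>\<in>?P S - {{S}}. ?wt \<sigma>)"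
      unfolding mcum_def using sum.remove[OF finP[of S] pS, of ?wt] by simp
    moreover have "(\<Sum>\<sigma>\<in>?P S. if \<sigma> = {S} then 0 else - ?wt \<sigma>) = - (\<Sum>\<sigma>\<in>?P S - {{S}}. ?wt \<sigma>)"
      unfolding sum.remove[OF finP[of S] pS, of "\<lambda>\<sigma>. if \<sigma> = {S} then 0 else - ?wt \<sigma>", OF order_refl]
      by (simp add: sum_negf)
    ultimately show ?thesis by simp
  qed
  finally have "(\<Sum>A\<in>Pow (S - {s}) - {S - {s}}. mcum m (insert s A) * m (S - insert s A)) = m S - mcum m S" .
  moreover have "(\<Sum>A\<in>Pow (S - {s}). mcum m (insert s A) * m (S - insert s A)) =
    mcum m S + (\<Sum>A\<in>Pow (S - {s}) - {S - {s}}. mcum m (insert s A) * m (S - insert s A))"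
    using fin s m0 by (subst sum.remove[of _ "S - {s}"]) (auto simp: insert_absorb)
  ultimately show ?thesis by simp
qed

text \<open>Cumulants of lists, obtained by solving \<open>m (x # xs) = ssum xs (\<lambda>B C. c (x # B) * m C)\<close>.\<close>

function lcum :: "('a list \<Rightarrow> complex) \<Rightarrow> 'a list \<Rightarrow> complex" where
  "lcum m [] = 0"
| "lcum m (x # xs) = m (x # xs) -
     (\<Sum>(B, C)\<leftarrow>splits xs. if length B < length xs then lcum m (x # B) * m C else 0)"
  by pat_completeness auto
termination by (relation "Wellfounded.measure (\<lambda>(m, xs). length xs)") auto

text \<open>Exactly one splitting puts every entry to the left. This isolates the top term that the
  guard in \<open>lcum\<close> leaves out.\<close>

lemma ssum_full: "ssum xs (\<lambda>B C. if length B < length xs then 0 else f B C) = f xs []"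
proof (induction xs arbitrary: f)
  case (Cons x xs)
  have "ssum xs (\<lambda>B C. if length B < Suc (length xs) then 0 else f B (x # C)) = ssum xs (\<lambda>B C. 0 * 0)"
  proof (rule ssum_cong)
    fix B C assume "mset B + mset C = mset xs"
    from arg_cong[OF this, of size] show "(if length B < Suc (length xs) then 0 else f B (x # C)) = 0 * 0"
      by simp
  qed
  also have "\<dots> = 0" unfolding ssum_const_left by simp
  finally show ?case by (simp add: ssum_Cons Cons.IH)
qed simp

lemma lcum_eq:
  assumes "m [] = 1"
  shows "m (x # xs) = ssum xs (\<lambda>B C. lcum m (x # B) * m C)"
proof -
  have "ssum xs (\<lambda>B C. lcum m (x # B) * m C) =
    ssum xs (\<lambda>B C. if length B < length xs then lcum m (x # B) * m C else 0) +
    ssum xs (\<lambda>B C. if length B < length xs then 0 else lcum m (x # B) * m C)"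
    unfolding ssum_add[symmetric] by (rule ssum_cong) simp
  also have "ssum xs (\<lambda>B C. if length B < length xs then 0 else lcum m (x # B) * m C) = lcum m (x # xs)"
    unfolding ssum_full using assms by simp
  finally show ?thesis by (simp add: ssum_def)
qed

text \<open>The system is triangular: in the equation for \<open>ys\<close> the term
  \<open>B = ys\<close> is \<open>c ys * m []\<close>, all others involve shorter \<open>B\<close>.
  The identifications of cumulants below, including their loop equation, are instances in which the
  first entry of the list is kept fixed outside \<open>ys\<close>.\<close>

lemma lcum_unique:
  assumes "m [] = 1" and "\<And>ys. mset ys \<subseteq># mset xs \<Longrightarrow> f ys = ssum ys (\<lambda>B C. c B * m C)"
    and "\<And>ys. mset ys \<subseteq># mset xs \<Longrightarrow> f ys = ssum ys (\<lambda>B C. c' B * m C)"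
  shows "c xs = c' xs"
  using assms(2,3)
proof (induction "length xs" arbitrary: xs rule: less_induct)
  case less
  have full: "ssum xs (\<lambda>B C. c B * m C) =
    ssum xs (\<lambda>B C. if length B < length xs then c B * m C else 0) + c xs" for c
  proof -
    have "ssum xs (\<lambda>B C. c B * m C) = ssum xs (\<lambda>B C. (if length B < length xs then c B * m C else 0) +
       (if length B < length xs then 0 else c B * m C))"
      by (rule ssum_cong) simp
    then show ?thesis using ssum_full[of xs "\<lambda>B C. c B * m C"] assms(1) by (simp add: ssum_add)
  qed
  have "ssum xs (\<lambda>B C. if length B < length xs then c B * m C else 0) =
    ssum xs (\<lambda>B C. if length B < length xs then c' B * m C else 0)"
  proof (rule ssum_cong)
    fix B C assume BC: "mset B + mset C = mset xs"
    then have sub: "mset B \<subseteq># mset xs" by (metis mset_subset_eq_add_left)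
    have "c B = c' B" if "length B < length xs"
      by (rule less.hyps[OF that]) (auto intro!: less.prems subset_mset.order_trans[OF _ sub])
    then show "(if length B < length xs then c B * m C else 0) = (if length B < length xs then c' B * m C else 0)"
      by simp
  qed
  then show ?case using less.prems(1)[of xs] less.prems(2)[of xs] full[of c] full[of c'] by simp
qed

lemma ssum_map: "ssum (map T xs) f = ssum xs (\<lambda>B C. f (map T B) (map T C))"
  by (induction xs arbitrary: f) (simp_all add: ssum_Cons)

lemma distinct_submset:
  assumes "mset ys \<subseteq># mset ks" "distinct ks"
  shows "distinct ys"
proof -
  obtain Z where "mset ks = mset ys + Z" using assms(1) by (metis subset_mset.le_iff_add)
  moreover obtain zs where "mset zs = Z" using ex_mset by blast
  ultimately have "mset ks = mset (ys @ zs)" by simp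
  then show ?thesis using assms(2) mset_eq_imp_distinct_iff by fastforce
qed

text \<open>Both sides solve the recursion that splits off the block of the first entry:
  \<open>mcum_recursion\<close> on subsets, \<open>lcum_eq\<close> on splittings. The labels
  \<open>js\<close> are distinct, their images under \<open>T\<close> need not be.\<close>

lemma mcum_lcum:
  assumes "distinct js" "js \<noteq> []" and m0: "m [] = 1"
    and m: "\<And>ks. distinct ks \<Longrightarrow> set ks \<subseteq> set js \<Longrightarrow> m' (set ks) = m (map T ks)"
  shows "mcum m' (set js) = lcum m (map T js)"
proof -
  obtain s ks where js: "js = s # ks" using assms(2) by (cases js) auto
  have s: "s \<notin> set ks" "distinct ks" using assms(1) by (auto simp: js)
  have "mcum m' (set (s # ks)) = lcum m (map T (s # ks))"
  proof (rule lcum_unique[of "\<lambda>C. m (map T C)" ks "\<lambda>ys. m (map T (s # ys))" "\<lambda>B. mcum m' (set (s # B))" "\<lambda>B. lcum m (map T (s # B))"])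
    fix ys assume ys: "mset ys \<subseteq># mset ks"
    then have dys: "distinct ys" "set ys \<subseteq> set ks"
      using distinct_submset[OF ys s(2)] set_mset_mono[OF ys] by auto
    have m'0: "m' {} = 1" using m[of "[]"] m0 by simp
    have "m (map T (s # ys)) = m' (set (s # ys))"
      using dys s by (intro m[symmetric]) (auto simp: js)
    also have "\<dots> = (\<Sum>A\<in>Pow (set ys). mcum m' (insert s A) * m' (set ys - A))"
      using dys s mcum_recursion[of "set (s # ys)" s m', OF _ _ m'0]
      by (auto intro!: sum.cong arg_cong2[of _ _ _ _ "(*)"] arg_cong[of _ _ m'])
    also have "\<dots> = ssum ys (\<lambda>B C. mcum m' (set (s # B)) * m' (set C))"
      using ssum_subsets[OF dys(1), of "\<lambda>A C. mcum m' (insert s A) * m' C"] by simp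
    also have "\<dots> = ssum ys (\<lambda>B C. mcum m' (set (s # B)) * m (map T C))"
    proof (rule ssum_cong)
      fix B C assume BC: "mset B + mset C = mset ys"
      then have "mset C \<subseteq># mset ys" by (metis mset_subset_eq_add_right)
      then have "distinct C" "set C \<subseteq> set ys"
        using distinct_submset[OF _ dys(1), of C] set_mset_mono[of "mset C" "mset ys"] by auto
      then show "mcum m' (set (s # B)) * m' (set C) = mcum m' (set (s # B)) * m (map T C)"
        using dys(2) m[of C] by (auto simp: js)
    qed
    finally show "m (map T (s # ys)) = ssum ys (\<lambda>B C. mcum m' (set (s # B)) * m (map T C))" .
    show "m (map T (s # ys)) = ssum ys (\<lambda>B C. lcum m (map T (s # B)) * m (map T C))"
      using lcum_eq[of m "T s" "map T ys"] m0 by (simp add: ssum_map)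
  qed (simp add: m0)
  then show ?thesis by (simp add: js)
qed

section \<open>Gaussian spaces\<close>

text \<open>Stated by the characteristic function: the Dirac mass is the case \<open>v = 0\<close>,
  and sums of independent variables only multiply exponentials.\<close>

definition gauss_rv :: "'w measure \<Rightarrow> ('w \<Rightarrow> real) \<Rightarrow> real \<Rightarrow> bool" where
  "gauss_rv M L v \<longleftrightarrow> L \<in> borel_measurable M \<and> v \<ge> 0 \<and>
     (\<forall>t. char (distr M borel L) t = complex_of_real (exp (- (v * t\<^sup>2) / 2)))"

lemma char_scaled_std_normal:
  "char (distr std_normal_distribution borel (\<lambda>x. a * x)) t = complex_of_real (exp (- (a\<^sup>2 * t\<^sup>2) / 2))"
proof -
  have "char (distr std_normal_distribution borel (\<lambda>x. a * x)) t = char std_normal_distribution (t * a)"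
    unfolding char_def by (subst integral_distr) (simp_all add: mult.assoc)
  then show ?thesis
    by (simp add: char_std_normal_distribution power_mult_distrib mult.commute)
qed

lemma normal_density_distr:
  assumes "\<sigma> > 0"
  shows "density lborel (normal_density 0 \<sigma>) = distr std_normal_distribution borel (\<lambda>x. \<sigma> * x)"
proof -
  interpret S: prob_space std_normal_distribution by (rule prob_space_normal_density) simp
  have "distributed std_normal_distribution lborel (\<lambda>x. x) std_normal_density"
    unfolding distributed_def by (subst distr_id2) simp_all
  from S.normal_density_affine[OF this, of \<sigma> 0] assms
  have "distributed std_normal_distribution lborel (\<lambda>x. \<sigma> * x) (normal_density 0 \<sigma>)" by simp
  then have "distr std_normal_distribution lborel (\<lambda>x. \<sigma> * x) = density lborel (normal_density 0 \<sigma>)"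
    by (rule distributed_distr_eq_density)
  moreover have "distr std_normal_distribution lborel (\<lambda>x. \<sigma> * x) = distr std_normal_distribution borel (\<lambda>x. \<sigma> * x)"
    by (rule distr_cong) simp_all
  ultimately show ?thesis by simp
qed

lemma centered_gaussian_gauss_rv:
  assumes "centered_gaussian M Y"
  shows "\<exists>v. gauss_rv M (\<lambda>w. inner u (Y w)) v"
proof -
  from assms obtain \<sigma> where Y[measurable]: "Y \<in> borel_measurable M" and \<sigma>: "\<sigma> \<ge> 0"
    and d: "distr M borel (\<lambda>w. inner u (Y w)) = (if \<sigma> = 0 then return borel 0 else density lborel (normal_density 0 \<sigma>))"
    unfolding centered_gaussian_def by blast
  have "char (distr M borel (\<lambda>w. inner u (Y w))) t = complex_of_real (exp (- (\<sigma>\<^sup>2 * t\<^sup>2) / 2))" for t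
  proof (cases "\<sigma> = 0")
    case True
    have "char (return borel 0) t = 1"
      unfolding char_def by (subst integral_return) simp_all
    then show ?thesis by (simp add: d True)
  next
    case False
    then have "distr M borel (\<lambda>w. inner u (Y w)) = distr std_normal_distribution borel (\<lambda>x. \<sigma> * x)"
      using \<sigma> normal_density_distr[of \<sigma>] by (simp only: d if_False)
    then show ?thesis by (simp only: char_scaled_std_normal)
  qed
  then have "gauss_rv M (\<lambda>w. inner u (Y w)) (\<sigma>\<^sup>2)"
    unfolding gauss_rv_def by (intro conjI allI) simp_all
  then show ?thesis ..
qed

lemma (in prob_space) gauss_rv_sum:
  assumes "finite A" "indep_vars (\<lambda>_. borel) X A" "\<And>i. i \<in> A \<Longrightarrow> \<exists>v. gauss_rv M (X i) v"
  shows "\<exists>v. gauss_rv M (\<lambda>w. \<Sum>i\<in>A. X i w) v"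
proof -
  from assms(3) obtain v where v: "\<And>i. i \<in> A \<Longrightarrow> gauss_rv M (X i) (v i)" by metis
  have "gauss_rv M (\<lambda>w. \<Sum>i\<in>A. X i w) (\<Sum>i\<in>A. v i)"
    unfolding gauss_rv_def
  proof (intro conjI allI)
    show "(\<lambda>w. \<Sum>i\<in>A. X i w) \<in> borel_measurable M"
      using v by (intro borel_measurable_sum) (auto simp: gauss_rv_def)
    show "(\<Sum>i\<in>A. v i) \<ge> 0" using v by (intro sum_nonneg) (auto simp: gauss_rv_def)
    fix t
    have "char (distr M borel (\<lambda>w. \<Sum>i\<in>A. X i w)) t = (\<Prod>i\<in>A. char (distr M borel (X i)) t)"
      by (rule char_distr_sum[OF assms(2)])
    also have "\<dots> = (\<Prod>i\<in>A. complex_of_real (exp (- (v i * t\<^sup>2) / 2)))"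
      using v by (intro prod.cong) (auto simp: gauss_rv_def)
    also have "\<dots> = complex_of_real (exp (\<Sum>i\<in>A. - (v i * t\<^sup>2) / 2))"
      using assms(1) by (simp add: exp_sum)
    also have "(\<Sum>i\<in>A. - (v i * t\<^sup>2) / 2) = - ((\<Sum>i\<in>A. v i) * t\<^sup>2) / 2"
      by (simp add: sum_distrib_right sum_divide_distrib sum_negf)
    finally show "char (distr M borel (\<lambda>w. \<Sum>i\<in>A. X i w)) t = complex_of_real (exp (- ((\<Sum>i\<in>A. v i) * t\<^sup>2) / 2))" .
  qed
  then show ?thesis by blast
qed

text \<open>By Levy's uniqueness theorem the law is that of \<open>sqrt v\<close> times a standard
  normal variable, whose moments are known.\<close>

lemma (in prob_space) gauss_rv_moments:
  assumes "gauss_rv M L v"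
  shows "integrable M (\<lambda>w. L w ^ n)"
    and "expectation (\<lambda>w. L w ^ n) = sqrt v ^ n * (LINT x|std_normal_distribution. x ^ n)"
proof -
  have L[measurable]: "L \<in> borel_measurable M" and v: "v \<ge> 0" using assms by (auto simp: gauss_rv_def)
  interpret S: real_distribution std_normal_distribution by (rule real_dist_normal_dist)
  have eq: "distr M borel L = distr std_normal_distribution borel (\<lambda>x. sqrt v * x)"
  proof (rule Levy_uniqueness)
    show "real_distribution (distr M borel L)" by (rule real_distribution_distr) simp
    show "real_distribution (distr std_normal_distribution borel (\<lambda>x. sqrt v * x))"
      by (rule S.real_distribution_distr) simp
    show "char (distr M borel L) = char (distr std_normal_distribution borel (\<lambda>x. sqrt v * x))"
      using assms v by (auto simp: char_scaled_std_normal gauss_rv_def)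
  qed
  have "integrable (distr std_normal_distribution borel (\<lambda>x. sqrt v * x)) (\<lambda>x. x ^ n)"
    by (subst integrable_distr_eq) (auto simp: power_mult_distrib intro!: integrable_mult_right integrable_std_normal_distribution_moment)
  then show "integrable M (\<lambda>w. L w ^ n)"
    unfolding eq[symmetric] by (subst (asm) integrable_distr_eq) simp_all
  have "expectation (\<lambda>w. L w ^ n) = integral\<^sup>L (distr M borel L) (\<lambda>x. x ^ n)"
    by (subst integral_distr) simp_all
  also have "\<dots> = sqrt v ^ n * (LINT x|std_normal_distribution. x ^ n)"
    unfolding eq by (subst integral_distr) (simp_all add: power_mult_distrib)
  finally show "expectation (\<lambda>w. L w ^ n) = sqrt v ^ n * (LINT x|std_normal_distribution. x ^ n)" .
qed

text \<open>Joint Gaussianity is expressed by closure under linear combinations, which is what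
  differentiating along \<open>L + t \<eta>\<close> requires.\<close>

locale gauss_space = prob_space M for M :: "'w measure" +
  fixes H :: "('w \<Rightarrow> real) set"
  assumes H_add: "\<xi> \<in> H \<Longrightarrow> \<eta> \<in> H \<Longrightarrow> (\<lambda>w. \<xi> w + \<eta> w) \<in> H"
    and H_scale: "\<xi> \<in> H \<Longrightarrow> (\<lambda>w. c * \<xi> w) \<in> H"
    and H_gauss: "\<xi> \<in> H \<Longrightarrow> \<exists>v. gauss_rv M \<xi> v"
begin

lemma integrable_power: "\<xi> \<in> H \<Longrightarrow> integrable M (\<lambda>w. \<xi> w ^ n)"
  using H_gauss gauss_rv_moments(1) by blast

lemma measurable_H: "\<xi> \<in> H \<Longrightarrow> \<xi> \<in> borel_measurable M"
  using H_gauss by (auto simp: gauss_rv_def)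

lemma moment_odd:
  assumes "\<xi> \<in> H" "odd n" shows "expectation (\<lambda>w. \<xi> w ^ n) = 0"
proof -
  obtain v where "gauss_rv M \<xi> v" using H_gauss assms(1) by blast
  from gauss_rv_moments(2)[OF this, of n] show ?thesis
    by (simp add: integral_std_normal_distribution_moment_odd[OF assms(2)])
qed

lemma moment_even:
  assumes "\<xi> \<in> H"
  shows "expectation (\<lambda>w. \<xi> w ^ (2 * k)) = fact (2 * k) / (2 ^ k * fact k) * expectation (\<lambda>w. \<xi> w ^ 2) ^ k"
proof -
  obtain v where v: "gauss_rv M \<xi> v" using H_gauss assms(1) by blast
  then have "v \<ge> 0" by (simp add: gauss_rv_def)
  have *: "expectation (\<lambda>w. \<xi> w ^ (2 * k)) = v ^ k * (fact (2 * k) / (2 ^ k * fact k))" for k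
    using \<open>v \<ge> 0\<close>
    unfolding gauss_rv_moments(2)[OF v] std_normal_distribution_even_moments by (simp add: power_mult[of "sqrt v"])
  have "expectation (\<lambda>w. \<xi> w ^ 2) = v" using *[of 1] by simp
  then show ?thesis using *[of k] by simp
qed

section \<open>Integrability of monomials and Wick's formula\<close>

definition mprod :: "('w \<Rightarrow> real) list \<Rightarrow> 'w \<Rightarrow> real" where
  "mprod es w = (\<Prod>\<eta>\<leftarrow>es. \<eta> w)"

lemma mprod_simps [simp]:
  "mprod [] w = 1" "mprod (\<eta> # es) w = \<eta> w * mprod es w" "mprod (es @ es') w = mprod es w * mprod es' w"
  "mprod (replicate n \<eta>) w = \<eta> w ^ n"
  by (simp_all add: mprod_def)

lemma measurable_mprod: "set es \<subseteq> H \<Longrightarrow> mprod es \<in> borel_measurable M"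
proof (induction es)
  case (Cons \<eta> es)
  have "(\<lambda>w. \<eta> w * mprod es w) \<in> borel_measurable M"
    using Cons measurable_H[of \<eta>] by (intro borel_measurable_times) auto
  then show ?case by (simp add: mprod_def[abs_def])
qed (simp add: mprod_def[abs_def])

text \<open>All powers are treated at once because the bound |x y| \<le> x^2 + y^2, used to separate
  one factor, doubles the exponent of the rest.\<close>

lemma integrable_mprod_power:
  assumes "set es \<subseteq> H" shows "integrable M (\<lambda>w. mprod es w ^ n)"
  using assms
proof (induction es arbitrary: n)
  case (Cons \<eta> es)
  note [measurable] = measurable_H[of \<eta>] measurable_mprod[of es]
  have \<eta>: "\<eta> \<in> H" and es: "set es \<subseteq> H" using Cons.prems by auto
  have "integrable M (\<lambda>w. \<eta> w ^ (2 * n) + mprod es w ^ (2 * n))"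
    using Cons.IH[OF es] integrable_power[OF \<eta>] by (intro Bochner_Integration.integrable_add)
  then show ?case
  proof (rule Bochner_Integration.integrable_bound)
    show "(\<lambda>w. mprod (\<eta> # es) w ^ n) \<in> borel_measurable M"
      by (rule borel_measurable_power[OF measurable_mprod[OF Cons.prems]])
    show "AE w in M. norm (mprod (\<eta> # es) w ^ n) \<le> norm (\<eta> w ^ (2 * n) + mprod es w ^ (2 * n))"
    proof (rule AE_I2)
      fix w
      have "\<bar>\<eta> w ^ n * mprod es w ^ n\<bar> \<le> (\<eta> w ^ n)\<^sup>2 + (mprod es w ^ n)\<^sup>2"
      proof -
        have "2 * \<bar>\<eta> w ^ n\<bar> * \<bar>mprod es w ^ n\<bar> \<le> (\<eta> w ^ n)\<^sup>2 + (mprod es w ^ n)\<^sup>2"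
          using sum_squares_bound[of "\<bar>\<eta> w ^ n\<bar>" "\<bar>mprod es w ^ n\<bar>"] by (simp only: power2_abs)
        moreover have "0 \<le> \<bar>\<eta> w ^ n\<bar> * \<bar>mprod es w ^ n\<bar>" by simp
        ultimately show ?thesis unfolding abs_mult by linarith
      qed
      then show "norm (mprod (\<eta> # es) w ^ n) \<le> norm (\<eta> w ^ (2 * n) + mprod es w ^ (2 * n))"
        by (simp add: power_mult_distrib power_even_eq)
    qed
  qed
qed simp

lemma integrable_mprod: "set es \<subseteq> H \<Longrightarrow> integrable M (mprod es)"
  using integrable_mprod_power[of es 1] by simp

text \<open>The derivation with values \<open>c\<close> on the generators, applied to a monomial; in
  use, \<open>c \<eta>\<close> is a covariance with \<open>\<eta>\<close>.\<close>

primrec dmon :: "(('w \<Rightarrow> real) \<Rightarrow> complex) \<Rightarrow> ('w \<Rightarrow> real) list \<Rightarrow> 'w \<Rightarrow> complex" where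
  "dmon c [] w = 0"
| "dmon c (\<eta> # es) w = c \<eta> * of_real (mprod es w) + of_real (\<eta> w) * dmon c es w"

lemma dmon_append:
  "dmon c (es @ es') w = dmon c es w * of_real (mprod es' w) + of_real (mprod es w) * dmon c es' w"
  by (induction es) (simp_all add: algebra_simps)

lemma integrable_mprod_dmon:
  assumes "set es \<subseteq> H" "set es' \<subseteq> H"
  shows "integrable M (\<lambda>w. of_real (mprod es' w) * dmon c es w)"
  using assms
proof (induction es arbitrary: es')
  case (Cons \<eta> es)
  have "integrable M (\<lambda>w. c \<eta> * of_real (mprod (es' @ es) w) + of_real (mprod (es' @ [\<eta>]) w) * dmon c es w)"
    using Cons.prems
    by (intro Bochner_Integration.integrable_add integrable_mult_right Cons.IH integrable_of_real integrable_mprod) auto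
  then show ?case by (simp add: algebra_simps)
qed simp

text \<open>Wick's formula is obtained by differentiating the moments of \<open>L + t \<eta>\<close> at \<open>t = 0\<close>.\<close>

lemma deriv_power_expectation:
  fixes R :: "'w \<Rightarrow> complex"
  assumes int: "\<And>i j. integrable M (\<lambda>w. of_real (L w ^ i * \<eta> w ^ j) * R w)"
  shows "((\<lambda>t. expectation (\<lambda>w. of_real ((L w + t * \<eta> w) ^ Suc n) * R w)) has_vector_derivative
    of_nat (Suc n) * expectation (\<lambda>w. of_real (L w ^ n * \<eta> w) * R w)) (at 0)"
proof -
  let ?c = "\<lambda>j. of_nat (Suc n choose j) * expectation (\<lambda>w. of_real (L w ^ (Suc n - j) * \<eta> w ^ j) * R w)"
  have "expectation (\<lambda>w. of_real ((L w + t * \<eta> w) ^ Suc n) * R w) = (\<Sum>j\<le>Suc n. of_real (t ^ j) * ?c j)" for t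
  proof -
    have "of_real ((L w + t * \<eta> w) ^ Suc n) * R w =
      (\<Sum>j\<le>Suc n. (of_real (t ^ j) * of_nat (Suc n choose j)) * (of_real (L w ^ (Suc n - j) * \<eta> w ^ j) * R w))" for w
      unfolding add.commute[of "L w"] binomial_ring of_real_sum sum_distrib_right
      by (intro sum.cong refl) (simp add: power_mult_distrib mult_ac)
    then have "expectation (\<lambda>w. of_real ((L w + t * \<eta> w) ^ Suc n) * R w) =
      (\<Sum>j\<le>Suc n. expectation (\<lambda>w. (of_real (t ^ j) * of_nat (Suc n choose j)) * (of_real (L w ^ (Suc n - j) * \<eta> w ^ j) * R w)))"
      by (simp only:) (rule Bochner_Integration.integral_sum, intro integrable_mult_right int)
    then show ?thesis by (simp only: integral_mult_right_zero mult.assoc)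
  qed
  moreover have "((\<lambda>t. \<Sum>j\<le>Suc n. of_real (t ^ j) * ?c j) has_vector_derivative
      (\<Sum>j\<le>Suc n. of_real (of_nat j * 0 ^ (j - 1)) * ?c j)) (at 0)"
  proof (rule has_vector_derivative_sum)
    fix j
    have "((\<lambda>t. t ^ j) has_real_derivative of_nat j * 0 ^ (j - 1)) (at 0)"
      using DERIV_pow[of j 0] by simp
    from has_vector_derivative_mult_left[OF has_vector_derivative_of_real[OF this]]
    show "((\<lambda>t. of_real (t ^ j) * ?c j) has_vector_derivative of_real (of_nat j * 0 ^ (j - 1)) * ?c j) (at 0)" .
  qed
  \<comment> \<open>The coefficient \<open>j * 0 ^ (j - 1)\<close> vanishes unless
    \<open>j = 1\<close>.\<close>
  moreover have "(\<Sum>j\<le>Suc n. of_real (of_nat j * 0 ^ (j - 1)) * ?c j) = (\<Sum>j\<in>{1}. ?c j)"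
    by (rule sum.mono_neutral_cong_right) (auto simp: power_0_left)
  ultimately show ?thesis by simp
qed

lemma integrable_mprod_mult_dmon:
  assumes "set es \<subseteq> H" "L \<in> H" "\<eta> \<in> H"
  shows "integrable M (\<lambda>w. of_real (L w ^ i * \<eta> w ^ j) * dmon c es w)"
    and "set es' \<subseteq> H \<Longrightarrow> integrable M (\<lambda>w. of_real (L w ^ i * \<eta> w ^ j) * complex_of_real (mprod es' w))"
proof -
  have HH: "set (replicate i L @ replicate j \<eta>) \<subseteq> H" using assms by auto
  show "integrable M (\<lambda>w. of_real (L w ^ i * \<eta> w ^ j) * dmon c es w)"
    using integrable_mprod_dmon[OF assms(1) HH] by simp
  assume "set es' \<subseteq> H"
  then have "set (replicate i L @ replicate j \<eta> @ es') \<subseteq> H" using HH by auto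
  from integrable_of_real[OF integrable_mprod[OF this]]
  show "integrable M (\<lambda>w. of_real (L w ^ i * \<eta> w ^ j) * complex_of_real (mprod es' w))"
    by (simp add: mult.assoc mprod_def[abs_def] flip: of_real_mult)
qed

lemma E_mult_add:
  assumes "\<xi> \<in> H" "L \<in> H" "\<eta> \<in> H"
  shows "expectation (\<lambda>w. \<xi> w * (L w + t * \<eta> w)) = expectation (\<lambda>w. \<xi> w * L w) + t * expectation (\<lambda>w. \<xi> w * \<eta> w)"
proof -
  have i: "integrable M (\<lambda>w. \<xi> w * \<zeta> w)" if "\<zeta> \<in> H" for \<zeta>
    using integrable_mprod[of "[\<xi>, \<zeta>]"] assms that by (simp add: mprod_def[abs_def])
  have "expectation (\<lambda>w. \<xi> w * (L w + t * \<eta> w)) = expectation (\<lambda>w. \<xi> w * L w + t * (\<xi> w * \<eta> w))"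
    by (simp add: algebra_simps)
  then show ?thesis using i assms by simp
qed

text \<open>\<open>L + t \<xi>\<close> lies in \<open>H\<close> for all \<open>t\<close>, so its
  moment of order \<open>n + 1\<close> is known: zero if \<open>n\<close> is even, otherwise a
  constant times a power of its variance, whose derivative at 0 is twice the covariance of
  \<open>\<xi>\<close> and \<open>L\<close>. Comparing derivatives at 0 gives the claim.\<close>

lemma wick_power:
  assumes "\<xi> \<in> H" "L \<in> H"
  shows "expectation (\<lambda>w. L w ^ n * \<xi> w) =
    of_nat n * expectation (\<lambda>w. \<xi> w * L w) * expectation (\<lambda>w. L w ^ (n - 1))"
proof (cases "even n")
  case True
  have H: "set (\<xi> # L # []) \<subseteq> H" using assms by simp
  have "expectation (\<lambda>w. of_real (L w ^ n * \<xi> w) :: complex) = 0 \<and> (n > 0 \<longrightarrow> expectation (\<lambda>w. L w ^ (n - 1)) = 0)"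
  proof
    have "((\<lambda>t. expectation (\<lambda>w. of_real ((L w + t * \<xi> w) ^ Suc n) * (1 :: complex))) has_vector_derivative
      of_nat (Suc n) * expectation (\<lambda>w. of_real (L w ^ n * \<xi> w) * (1 :: complex))) (at 0)"
      using integrable_mprod_mult_dmon(2)[OF _ assms(2,1), of "[]" "[]"]
      by (intro deriv_power_expectation) simp
    moreover have "expectation (\<lambda>w. of_real ((L w + t * \<xi> w) ^ Suc n) * (1 :: complex)) = 0" for t
    proof -
      have "expectation (\<lambda>w. (L w + t * \<xi> w) ^ Suc n) = 0"
        using True assms by (intro moment_odd H_add H_scale) simp_all
      then show ?thesis by (simp only: mult_1_right integral_complex_of_real of_real_0)
    qed
    ultimately have "((\<lambda>t. 0) has_vector_derivative
      of_nat (Suc n) * expectation (\<lambda>w. of_real (L w ^ n * \<xi> w) * (1 :: complex))) (at (0 :: real))"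
      by (simp only:)
    from vector_derivative_unique_at[OF this has_vector_derivative_const]
    show "expectation (\<lambda>w. of_real (L w ^ n * \<xi> w) :: complex) = 0" by (simp del: of_nat_Suc)
    show "n > 0 \<longrightarrow> expectation (\<lambda>w. L w ^ (n - 1)) = 0"
      using moment_odd[OF assms(2), of "n - 1"] True by auto
  qed
  then have "expectation (\<lambda>w. L w ^ n * \<xi> w) = 0" "n > 0 \<longrightarrow> expectation (\<lambda>w. L w ^ (n - 1)) = 0"
    unfolding integral_complex_of_real of_real_eq_0_iff by blast+
  then show ?thesis by (cases "n = 0") simp_all
next
  case False
  then obtain k where n: "n = Suc (2 * k)" by (elim oddE) simp
  \<comment> \<open>The double factorial (2k - 1)!!, which is the moment of order 2k of a standard
    normal variable; multiplying it by n = 2k + 1 gives the next one.\<close>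
  let ?d = "\<lambda>k. fact (2 * k) / (2 ^ k * fact k) :: real"
  let ?V = "\<lambda>t. expectation (\<lambda>w. (L w + t * \<xi> w)\<^sup>2)"
  have i: "integrable M (\<lambda>w. \<zeta> w * \<eta> w)" if "\<zeta> \<in> H" "\<eta> \<in> H" for \<zeta> \<eta>
    using integrable_mprod[of "[\<zeta>, \<eta>]"] that by (simp add: mprod_def[abs_def])
  have V: "?V t = expectation (\<lambda>w. (L w)\<^sup>2) + t * (2 * expectation (\<lambda>w. \<xi> w * L w)) + t\<^sup>2 * expectation (\<lambda>w. (\<xi> w)\<^sup>2)" for t
  proof -
    have "?V t = expectation (\<lambda>w. L w * L w + t * (2 * (\<xi> w * L w)) + t\<^sup>2 * (\<xi> w * \<xi> w))"
      by (simp add: power2_eq_square algebra_simps)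
    then show ?thesis using i assms by (simp add: power2_eq_square)
  qed
  have "((\<lambda>t. expectation (\<lambda>w. of_real ((L w + t * \<xi> w) ^ Suc n) * (1 :: complex))) has_vector_derivative
    of_nat (Suc n) * expectation (\<lambda>w. of_real (L w ^ n * \<xi> w) * (1 :: complex))) (at 0)"
    using integrable_mprod_mult_dmon(2)[OF _ assms(2,1), of "[]" "[]"]
    by (intro deriv_power_expectation) simp
  moreover have "expectation (\<lambda>w. of_real ((L w + t * \<xi> w) ^ Suc n) * (1 :: complex)) = of_real (?d (Suc k) * ?V t ^ Suc k)" for t
  proof -
    have "expectation (\<lambda>w. (L w + t * \<xi> w) ^ (2 * Suc k)) = ?d (Suc k) * ?V t ^ Suc k"
      using assms by (intro moment_even H_add H_scale)
    then show ?thesis by (simp only: n mult_1_right integral_complex_of_real) simp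
  qed
  ultimately have D1: "((\<lambda>t. complex_of_real (?d (Suc k) * ?V t ^ Suc k)) has_vector_derivative
    of_nat (Suc n) * expectation (\<lambda>w. of_real (L w ^ n * \<xi> w) * (1 :: complex))) (at 0)"
    by (simp only:)
  have "((\<lambda>t. ?d (Suc k) * ?V t ^ Suc k) has_real_derivative
    ?d (Suc k) * (of_nat (Suc k) * ?V 0 ^ k * (2 * expectation (\<lambda>w. \<xi> w * L w)))) (at 0)"
  proof -
    have "(?V has_real_derivative 2 * expectation (\<lambda>w. \<xi> w * L w)) (at 0)"
      unfolding V by (auto intro!: derivative_eq_intros)
    from DERIV_cmult[OF DERIV_power[OF this, of "Suc k"], of "?d (Suc k)"]
    show ?thesis by (simp only: diff_Suc_Suc diff_zero mult_ac)
  qed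
  from vector_derivative_unique_at[OF D1 has_vector_derivative_of_real[OF this]]
  have "of_nat (Suc n) * complex_of_real (expectation (\<lambda>w. L w ^ n * \<xi> w)) =
    complex_of_real (?d (Suc k) * (of_nat (Suc k) * ?V 0 ^ k * (2 * expectation (\<lambda>w. \<xi> w * L w))))"
    by (simp only: mult_1_right integral_complex_of_real)
  then have "complex_of_real (of_nat (Suc n) * expectation (\<lambda>w. L w ^ n * \<xi> w)) =
    complex_of_real (?d (Suc k) * (of_nat (Suc k) * ?V 0 ^ k * (2 * expectation (\<lambda>w. \<xi> w * L w))))"
    by (simp only: of_real_mult of_real_of_nat_eq)
  then have "of_nat (Suc n) * expectation (\<lambda>w. L w ^ n * \<xi> w) =
    ?d (Suc k) * (of_nat (Suc k) * ?V 0 ^ k * (2 * expectation (\<lambda>w. \<xi> w * L w)))"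
    by (simp only: of_real_eq_iff)
  moreover have "?d (Suc k) = of_nat n * ?d k"
  proof -
    have "fact (2 * Suc k) = (2 * (1 + real k)) * (real n * fact (2 * k))"
      by (simp add: n algebra_simps)
    moreover have "2 ^ Suc k * fact (Suc k) = (2 * (1 + real k)) * (2 ^ k * fact k :: real)"
      by simp
    moreover have "2 * (1 + real k) \<noteq> 0" by simp
    ultimately show ?thesis
      by (simp only: mult_divide_mult_cancel_left times_divide_eq_left times_divide_eq_right not_False_eq_True)
  qed
  moreover have "real (Suc n) = 2 * real (Suc k)" by (simp add: n)
  moreover have "?V 0 = expectation (\<lambda>w. (L w)\<^sup>2)" by simp
  ultimately have "2 * real (Suc k) * expectation (\<lambda>w. L w ^ n * \<xi> w) =
    2 * real (Suc k) * (of_nat n * expectation (\<lambda>w. \<xi> w * L w) * (?d k * expectation (\<lambda>w. (L w)\<^sup>2) ^ k))"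
    by (simp only: mult_ac)
  then have "expectation (\<lambda>w. L w ^ n * \<xi> w) =
    of_nat n * expectation (\<lambda>w. \<xi> w * L w) * (?d k * expectation (\<lambda>w. (L w)\<^sup>2) ^ k)"
    by (simp only: mult_cancel_left) simp
  then show ?thesis
    unfolding moment_even[OF assms(2), of k, symmetric] by (simp add: n)
qed

text \<open>The factor \<open>L ^ n\<close> is there for the induction: putting
  \<open>L + t \<eta>\<close> for \<open>L\<close> in the identity with exponent
  \<open>n + 1\<close> and differentiating at \<open>t = 0\<close> releases one more factor
  \<open>\<eta>\<close>, so \<open>es\<close> grows while the exponent drops. Afterwards only
  \<open>n = 0\<close> is applied.\<close>

lemma wick_real:
  assumes "set es \<subseteq> H" "\<xi> \<in> H" "L \<in> H"
  defines "c \<equiv> \<lambda>\<eta>. complex_of_real (expectation (\<lambda>w. \<xi> w * \<eta> w))"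
  shows "expectation (\<lambda>w. complex_of_real (L w ^ n * \<xi> w * mprod es w)) =
    of_nat n * c L * expectation (\<lambda>w. complex_of_real (L w ^ (n - 1) * mprod es w)) +
    expectation (\<lambda>w. complex_of_real (L w ^ n) * dmon c es w)"
  using assms(1,3)
proof (induction es arbitrary: n L)
  case Nil
  then show ?case
    unfolding mprod_simps dmon.simps mult_1_right mult_zero_right integral_complex_of_real wick_power[OF assms(2) Nil(2)]
    by (simp add: c_def)
next
  case (Cons \<eta> es)
  have \<eta>: "\<eta> \<in> H" and es: "set es \<subseteq> H" and L: "L \<in> H" using Cons.prems by auto
  have Lt: "(\<lambda>w. L w + t * \<eta> w) \<in> H" for t using L \<eta> by (intro H_add H_scale)
  let ?D = "\<lambda>m R t. expectation (\<lambda>w. complex_of_real ((L w + t * \<eta> w) ^ m) * R w)"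
  have der: "(?D (Suc m) R has_vector_derivative of_nat (Suc m) * expectation (\<lambda>w. of_real (L w ^ m * \<eta> w) * R w)) (at 0)"
    if "\<And>i j. integrable M (\<lambda>w. of_real (L w ^ i * \<eta> w ^ j) * R w)" for m and R :: "'w \<Rightarrow> complex"
    by (rule deriv_power_expectation[OF that])
  have int: "integrable M (\<lambda>w. of_real (L w ^ i * \<eta> w ^ j) * complex_of_real (mprod (\<xi> # es) w))"
    "integrable M (\<lambda>w. of_real (L w ^ i * \<eta> w ^ j) * complex_of_real (mprod es w))"
    "integrable M (\<lambda>w. of_real (L w ^ i * \<eta> w ^ j) * dmon c es w)" for i j
    using assms(2) es by (intro integrable_mprod_mult_dmon[OF _ L \<eta>, of es]; simp)+
  have cL: "c (\<lambda>w. L w + t * \<eta> w) = c L + of_real t * c \<eta>" for t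
    using E_mult_add[OF assms(2) L \<eta>] by (simp add: c_def)
  have IH: "?D (Suc n) (\<lambda>w. of_real (mprod (\<xi> # es) w)) t =
    of_nat (Suc n) * (c L + of_real t * c \<eta>) * ?D n (\<lambda>w. of_real (mprod es w)) t + ?D (Suc n) (dmon c es) t" for t
    using Cons.IH[OF es Lt[of t], of "Suc n"] by (simp add: cL mult_ac)
  note d1 = der[OF int(1), of n]
  note d2 = has_vector_derivative_add[OF _ der[OF int(3), of n]]
  let ?E0 = "expectation (\<lambda>w. of_real (L w ^ n) * complex_of_real (mprod es w))"
  let ?E1 = "of_nat n * expectation (\<lambda>w. of_real (L w ^ (n - 1) * \<eta> w) * complex_of_real (mprod es w))"
  have dn: "(?D n (\<lambda>w. of_real (mprod es w)) has_vector_derivative ?E1) (at 0)"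
  proof (cases n)
    case 0 then show ?thesis by simp
  next
    case (Suc m) then show ?thesis using der[OF int(2), of m] by simp
  qed
  have "((\<lambda>t. of_nat (Suc n) * (c L + of_real t * c \<eta>)) has_vector_derivative of_nat (Suc n) * c \<eta>) (at 0)"
    by (auto intro!: derivative_eq_intros)
  from has_vector_derivative_mult[OF this dn]
  have "((\<lambda>t. of_nat (Suc n) * (c L + of_real t * c \<eta>) * ?D n (\<lambda>w. of_real (mprod es w)) t) has_vector_derivative
    of_nat (Suc n) * (c L * ?E1 + c \<eta> * ?E0)) (at 0)"
    by (simp add: algebra_simps)
  from d2[OF this] have "((\<lambda>t. ?D (Suc n) (\<lambda>w. of_real (mprod (\<xi> # es) w)) t) has_vector_derivative
    of_nat (Suc n) * (c L * ?E1 + c \<eta> * ?E0) + of_nat (Suc n) * expectation (\<lambda>w. of_real (L w ^ n * \<eta> w) * dmon c es w)) (at 0)"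
    unfolding IH .
  from vector_derivative_unique_at[OF d1 this]
  have "of_nat (Suc n) * expectation (\<lambda>w. of_real (L w ^ n * \<eta> w) * complex_of_real (mprod (\<xi> # es) w)) =
    of_nat (Suc n) * (c L * ?E1 + c \<eta> * ?E0 + expectation (\<lambda>w. of_real (L w ^ n * \<eta> w) * dmon c es w))"
    by (simp only: distrib_left)
  then have "expectation (\<lambda>w. of_real (L w ^ n * \<eta> w) * complex_of_real (mprod (\<xi> # es) w)) =
    c L * ?E1 + (c \<eta> * ?E0 + expectation (\<lambda>w. of_real (L w ^ n * \<eta> w) * dmon c es w))"
    by (simp only: mult_cancel_left of_nat_eq_0_iff add.assoc) simp
  also have "c \<eta> * ?E0 + expectation (\<lambda>w. of_real (L w ^ n * \<eta> w) * dmon c es w) =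
    expectation (\<lambda>w. c \<eta> * (of_real (L w ^ n) * complex_of_real (mprod es w)) + of_real (L w ^ n * \<eta> w) * dmon c es w)"
    using int(2)[of n 0] int(3)[of n 1] by (subst Bochner_Integration.integral_add) simp_all
  finally show ?case by (simp add: algebra_simps)
qed

section \<open>Integration by parts for complex polynomials in Gaussian variables\<close>

definition cgauss :: "('w \<Rightarrow> complex) \<Rightarrow> bool" where
  "cgauss Z \<longleftrightarrow> (\<lambda>w. Re (Z w)) \<in> H \<and> (\<lambda>w. Im (Z w)) \<in> H"

text \<open>\<open>stein Z F F'\<close>: \<open>F\<close> is a polynomial in elements of \<open>H\<close>, and \<open>F'\<close> its image under the derivation
  that maps \<open>\<eta> \<in> H\<close> to the covariance of \<open>Z\<close> and \<open>\<eta>\<close>.\<close>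

inductive stein :: "('w \<Rightarrow> complex) \<Rightarrow> ('w \<Rightarrow> complex) \<Rightarrow> ('w \<Rightarrow> complex) \<Rightarrow> bool" for Z where
  stein_zero: "stein Z (\<lambda>_. 0) (\<lambda>_. 0)"
| stein_step: "stein Z F F' \<Longrightarrow> set es \<subseteq> H \<Longrightarrow>
    stein Z (\<lambda>w. F w + a * of_real (mprod es w))
      (\<lambda>w. F' w + a * dmon (\<lambda>\<eta>. expectation (\<lambda>w. Z w * of_real (\<eta> w))) es w)"

lemma stein_integrable:
  assumes "stein Z F F'" shows "integrable M F" "integrable M F'"
  using assms
proof (induction)
  case (stein_step F F' es a)
  show "integrable M (\<lambda>w. F w + a * of_real (mprod es w))"
    using stein_step integrable_mprod
    by (intro Bochner_Integration.integrable_add integrable_mult_right integrable_of_real) auto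
  show "integrable M (\<lambda>w. F' w + a * dmon (\<lambda>\<eta>. expectation (\<lambda>w. Z w * of_real (\<eta> w))) es w)"
    using stein_step integrable_mprod_dmon[of es "[]"]
    by (intro Bochner_Integration.integrable_add integrable_mult_right) simp_all
qed simp_all

lemma dmon_linear: "dmon (\<lambda>\<eta>. c \<eta> + a * d \<eta>) es w = dmon c es w + a * dmon d es w"
  by (induction es) (simp_all add: algebra_simps)

lemma dmon_cong: "(\<And>\<eta>. \<eta> \<in> set es \<Longrightarrow> c \<eta> = d \<eta>) \<Longrightarrow> dmon c es w = dmon d es w"
  by (induction es) simp_all

text \<open>\<open>wick_real\<close> with \<open>n = 0\<close> is applied to the real and to the
  imaginary part of \<open>Z\<close>. The covariance is E(Z \<eta>) without conjugate;
  \<open>Z\<close> is not assumed circular, so E(Z^2) may be nonzero, as it is for elliptic diagonal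
  entries.\<close>

lemma wick_complex:
  assumes Z: "cgauss Z" and es: "set es \<subseteq> H"
  shows "integrable M (\<lambda>w. Z w * complex_of_real (mprod es w))"
    and "expectation (\<lambda>w. Z w * complex_of_real (mprod es w)) =
      expectation (dmon (\<lambda>\<eta>. expectation (\<lambda>w. Z w * of_real (\<eta> w))) es)"
proof -
  define A B where "A = (\<lambda>w. Re (Z w))" and "B = (\<lambda>w. Im (Z w))"
  have AB: "A \<in> H" "B \<in> H" using Z by (auto simp: cgauss_def A_def B_def)
  have ZAB: "Z w = of_real (A w) + \<i> * of_real (B w)" for w
    by (simp add: A_def B_def complex_eq)
  have int: "integrable M (\<lambda>w. complex_of_real (\<xi> w * mprod es w))" if "\<xi> \<in> H" "set es \<subseteq> H" for \<xi> es
    using integrable_of_real[OF integrable_mprod[of "\<xi> # es"]] that by (simp add: mprod_def[abs_def])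
  have split: "Z w * complex_of_real (mprod es w) = complex_of_real (A w * mprod es w) + \<i> * complex_of_real (B w * mprod es w)" for es w
    by (simp add: ZAB algebra_simps)
  show "integrable M (\<lambda>w. Z w * complex_of_real (mprod es w))"
    unfolding split by (intro Bochner_Integration.integrable_add integrable_mult_right int AB es)
  have E: "expectation (\<lambda>w. Z w * complex_of_real (mprod es w)) =
    expectation (\<lambda>w. complex_of_real (A w * mprod es w)) + \<i> * expectation (\<lambda>w. complex_of_real (B w * mprod es w))"
    if "set es \<subseteq> H" for es
    unfolding split using int[OF AB(1) that] int[OF AB(2) that] by simp
  let ?c = "\<lambda>\<xi> \<eta>. complex_of_real (expectation (\<lambda>w. \<xi> w * \<eta> w))"
  have R: "expectation (\<lambda>w. complex_of_real (\<xi> w * mprod es w)) = expectation (dmon (?c \<xi>) es)" if "\<xi> \<in> H" for \<xi>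
    using wick_real[OF es that that, of 0] by simp
  have c: "expectation (\<lambda>w. Z w * of_real (\<eta> w)) = ?c A \<eta> + \<i> * ?c B \<eta>" if "\<eta> \<in> H" for \<eta>
    using E[of "[\<eta>]"] that by (simp only: mprod_simps mult_1_right integral_complex_of_real) simp
  have D: "dmon (\<lambda>\<eta>. expectation (\<lambda>w. Z w * of_real (\<eta> w))) es w = dmon (?c A) es w + \<i> * dmon (?c B) es w" for w
  proof -
    have "dmon (\<lambda>\<eta>. expectation (\<lambda>w. Z w * of_real (\<eta> w))) es w = dmon (\<lambda>\<eta>. ?c A \<eta> + \<i> * ?c B \<eta>) es w"
      using es by (intro dmon_cong c) auto
    then show ?thesis by (simp only: dmon_linear)
  qed
  have "integrable M (dmon (?c \<xi>) es)" for \<xi>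
    using integrable_mprod_dmon[OF es, of "[]"] by simp
  then have "expectation (\<lambda>w. dmon (?c A) es w + \<i> * dmon (?c B) es w) =
    expectation (dmon (?c A) es) + \<i> * expectation (dmon (?c B) es)" by simp
  then show "expectation (\<lambda>w. Z w * complex_of_real (mprod es w)) =
    expectation (dmon (\<lambda>\<eta>. expectation (\<lambda>w. Z w * of_real (\<eta> w))) es)"
    unfolding E[OF es] R[OF AB(1)] R[OF AB(2)] D by (simp only:)
qed

lemma stein_ibp:
  assumes Z: "cgauss Z" and "stein Z F F'"
  shows "integrable M (\<lambda>w. Z w * F w) \<and> expectation (\<lambda>w. Z w * F w) = expectation F'"
  using assms(2)
proof (induction)
  case (stein_step F F' es a)
  let ?d = "dmon (\<lambda>\<eta>. expectation (\<lambda>w. Z w * of_real (\<eta> w))) es"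
  note W = wick_complex[OF Z stein_step(2)]
  have eq: "Z w * (F w + a * complex_of_real (mprod es w)) = Z w * F w + a * (Z w * complex_of_real (mprod es w))" for w
    by (simp add: algebra_simps)
  have i: "integrable M ?d" using integrable_mprod_dmon[OF stein_step(2), of "[]"] by simp
  show ?case
    unfolding eq using stein_step W i stein_integrable[OF stein_step(1)] by simp
qed simp

lemma stein_add:
  assumes "stein Z F F'" "stein Z G G'"
  shows "stein Z (\<lambda>w. F w + G w) (\<lambda>w. F' w + G' w)"
  using assms(2)
proof (induction)
  case stein_zero
  show ?case using assms(1) by simp
next
  case (stein_step G G' es a)
  then show ?case using stein.stein_step[OF stein_step(3,2), of a] by (simp add: add.assoc)
qed

lemma stein_mult_mono:
  assumes "stein Z F F'" "set es \<subseteq> H"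
  shows "stein Z (\<lambda>w. a * of_real (mprod es w) * F w)
    (\<lambda>w. a * (dmon (\<lambda>\<eta>. expectation (\<lambda>w. Z w * of_real (\<eta> w))) es w * F w + of_real (mprod es w) * F' w))"
  using assms(1)
proof (induction)
  case stein_zero
  then show ?case using stein.stein_zero by simp
next
  case (stein_step F F' es' b)
  have "set (es @ es') \<subseteq> H" using assms(2) stein_step(2) by simp
  from stein.stein_step[OF stein_step(3) this, of "a * b"]
  show ?case by (simp add: dmon_append algebra_simps)
qed

text \<open>The Leibniz rule. Together with sums and single Gaussian variables it lets the
  derivative of products of traces be assembled from that of matrix entries.\<close>

lemma stein_mult:
  assumes F: "stein Z F F'" and G: "stein Z G G'"
  shows "stein Z (\<lambda>w. F w * G w) (\<lambda>w. F' w * G w + F w * G' w)"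
  using F
proof (induction)
  case stein_zero
  then show ?case using stein.stein_zero by simp
next
  case (stein_step F F' es a)
  from stein_add[OF stein_step(3) stein_mult_mono[OF G stein_step(2), of a]]
  show ?case by (simp add: algebra_simps)
qed

lemma stein_const: "stein Z (\<lambda>_. a) (\<lambda>_. 0)"
  using stein_step[OF stein_zero, of "[]" Z a] by simp

lemma stein_sum: "(\<And>i. i \<in> A \<Longrightarrow> stein Z (F i) (F' i)) \<Longrightarrow> stein Z (\<lambda>w. \<Sum>i\<in>A. F i w) (\<lambda>w. \<Sum>i\<in>A. F' i w)"
  by (induction A rule: infinite_finite_induct) (auto intro: stein_zero stein_add)

lemma stein_gauss:
  assumes Z: "cgauss Z" and Y: "cgauss Y"
  shows "stein Z Y (\<lambda>_. expectation (\<lambda>w. Z w * Y w))"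
proof -
  define A B where "A = (\<lambda>w. Re (Y w))" and "B = (\<lambda>w. Im (Y w))"
  have AB: "set [A] \<subseteq> H" "set [B] \<subseteq> H" using Y by (auto simp: cgauss_def A_def B_def)
  have YAB: "Y w = of_real (A w) + \<i> * of_real (B w)" for w
    by (simp add: A_def B_def complex_eq)
  have "expectation (\<lambda>w. Z w * Y w) = expectation (\<lambda>w. Z w * of_real (A w) + \<i> * (Z w * of_real (B w)))"
    by (simp add: YAB algebra_simps)
  also have "\<dots> = expectation (\<lambda>w. Z w * of_real (A w)) + \<i> * expectation (\<lambda>w. Z w * of_real (B w))"
    using wick_complex(1)[OF Z AB(1)] wick_complex(1)[OF Z AB(2)] by simp
  finally show ?thesis
    using stein_step[OF stein_step[OF stein_zero AB(1), of Z 1] AB(2), of \<i>]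
    by (simp add: YAB[abs_def])
qed

end

section \<open>The free algebra\<close>

text \<open>With concatenation as addition of exponents, the convolution product on
  \<open>'x list \<Rightarrow>\<^sub>0 complex\<close> is the product of the free algebra on
  \<open>'x\<close>.\<close>

instantiation list :: (type) monoid_add
begin
definition "0 = ([] :: 'a list)"
definition "(u :: 'a list) + v = u @ v"
instance by standard (simp_all add: zero_list_def plus_list_def)
end

definition mon :: "'x list \<Rightarrow> 'x list \<Rightarrow>\<^sub>0 complex" where
  "mon u = Poly_Mapping.single u 1"

text \<open>Scalars are multiples of the empty word, so that scalar multiplication is an instance of
  ring multiplication.\<close>

definition scalar :: "complex \<Rightarrow> 'x list \<Rightarrow>\<^sub>0 complex" where
  "scalar c = Poly_Mapping.single [] c"

lemma mon_append: "mon (u @ v) = mon u * mon v"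
  by (simp add: mon_def mult_single plus_list_def)

lemma mon_Nil [simp]: "mon [] = 1"
  by (metis mon_def single_one zero_list_def)

lemma mon_Cons: "mon (x # w) = mon [x] * mon w"
  using mon_append[of "[x]" w] by simp

lemma scalar_add: "scalar (c + d) = scalar c + scalar d"
  by (simp add: scalar_def single_add)

lemma scalar_mult: "scalar (c * d) = scalar c * scalar d"
  by (simp add: scalar_def mult_single plus_list_def)

lemma scalar_1 [simp]: "scalar 1 = 1"
  by (metis mon_Nil mon_def scalar_def)

lemma scalar_0 [simp]: "scalar 0 = 0"
  by (simp add: scalar_def)

lemma scalar_map: "scalar c * P = Poly_Mapping.map ((*) c) P"
  by (simp add: scalar_def mult_map_scale_conv_mult zero_list_def)

lemma lookup_scalar_mult [simp]: "Poly_Mapping.lookup (scalar c * P) u = c * Poly_Mapping.lookup P u"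
  by (simp add: scalar_map map.rep_eq when_def)

lemma poly_expand:
  "P = (\<Sum>u\<in>Poly_Mapping.keys P. scalar (Poly_Mapping.lookup P u) * mon u)"
proof (rule poly_mapping_eqI)
  fix v
  have "(\<Sum>u\<in>Poly_Mapping.keys P. Poly_Mapping.lookup P u * Poly_Mapping.lookup (mon u) v) =
     (\<Sum>u\<in>Poly_Mapping.keys P. if u = v then Poly_Mapping.lookup P u else 0)"
    by (rule sum.cong) (auto simp: mon_def lookup_single when_def)
  also have "\<dots> = Poly_Mapping.lookup P v"
    by (simp add: in_keys_iff)
  finally show "Poly_Mapping.lookup P v =
    Poly_Mapping.lookup (\<Sum>u\<in>Poly_Mapping.keys P. scalar (Poly_Mapping.lookup P u) * mon u) v"
    by (simp add: lookup_sum)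
qed

lemma scalar_commute: "P * scalar c = scalar c * P"
proof -
  have *: "mon u * scalar c = scalar c * mon u" for u :: "'a list"
    by (simp add: mon_def scalar_def mult_single plus_list_def)
  have comm: "scalar d * (scalar c * Q) = scalar c * (scalar d * Q)" for d and Q :: "'a list \<Rightarrow>\<^sub>0 complex"
    by (simp only: mult.assoc[symmetric] scalar_mult[symmetric] mult.commute)
  have "P * scalar c = (\<Sum>u\<in>Poly_Mapping.keys P. scalar (Poly_Mapping.lookup P u) * mon u) * scalar c"
    by (rule arg_cong[OF poly_expand])
  also have "\<dots> = (\<Sum>u\<in>Poly_Mapping.keys P. scalar c * (scalar (Poly_Mapping.lookup P u) * mon u))"
    unfolding sum_distrib_right by (intro sum.cong refl) (simp only: mult.assoc * comm)
  also have "\<dots> = scalar c * (\<Sum>u\<in>Poly_Mapping.keys P. scalar (Poly_Mapping.lookup P u) * mon u)"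
    by (simp add: sum_distrib_left)
  also have "\<dots> = scalar c * P"
    by (rule arg_cong[OF poly_expand[symmetric]])
  finally show ?thesis .
qed

lemma scalar_left_commute: "P * (scalar c * Q) = scalar c * (P * Q)"
  by (simp only: mult.assoc[symmetric] scalar_commute[of P])

definition lin :: "(('x list \<Rightarrow>\<^sub>0 complex) \<Rightarrow> complex) \<Rightarrow> bool" where
  "lin f \<longleftrightarrow> (\<forall>P Q. f (P + Q) = f P + f Q) \<and> (\<forall>c P. f (scalar c * P) = c * f P)"

lemma lin_add: "lin f \<Longrightarrow> f (P + Q) = f P + f Q"
  and lin_scale: "lin f \<Longrightarrow> f (scalar c * P) = c * f P"
  by (auto simp: lin_def)

lemma lin_zero: "lin f \<Longrightarrow> f 0 = 0"
  using lin_scale[of f 0 0] by simp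

lemma lin_scalar: "lin f \<Longrightarrow> f (scalar c) = c * f 1"
  using lin_scale[of f c 1] by simp

lemma lin_diff: "lin f \<Longrightarrow> f (P - Q) = f P - f Q"
  using lin_add[of f "P - Q" Q] by simp

lemma lin_sum: "lin f \<Longrightarrow> f (sum P A) = (\<Sum>a\<in>A. f (P a))"
  by (induction A rule: infinite_finite_induct) (auto simp: lin_zero lin_add)

lemma lin_expand:
  assumes "lin f"
  shows "f P = (\<Sum>u\<in>Poly_Mapping.keys P. Poly_Mapping.lookup P u * f (mon u))"
proof -
  have "f P = f (\<Sum>u\<in>Poly_Mapping.keys P. scalar (Poly_Mapping.lookup P u) * mon u)"
    by (rule arg_cong[OF poly_expand])
  then show ?thesis by (simp add: assms lin_sum lin_scale)
qed

lemma lin_eqI: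
  assumes "lin f" "lin g" "\<And>u. u \<in> Poly_Mapping.keys P \<Longrightarrow> f (mon u) = g (mon u)"
  shows "f P = g P"
  unfolding lin_expand[OF assms(1), of P] lin_expand[OF assms(2), of P]
  by (rule sum.cong) (simp_all add: assms(3))

lemma lin_plusI: "lin f \<Longrightarrow> lin g \<Longrightarrow> lin (\<lambda>P. f P + g P)"
  by (simp add: lin_def algebra_simps)

lemma lin_const_left: "lin f \<Longrightarrow> lin (\<lambda>P. c * f P)"
  and lin_const_right: "lin f \<Longrightarrow> lin (\<lambda>P. f P * c)"
  by (simp_all add: lin_def algebra_simps)

lemma lin_sumI: "(\<And>a. a \<in> A \<Longrightarrow> lin (f a)) \<Longrightarrow> lin (\<lambda>P. \<Sum>a\<in>A. f a P)"
  by (simp add: lin_def sum.distrib sum_distrib_left)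

lemma lin_mult_left: "lin f \<Longrightarrow> lin (\<lambda>P. f (Q * P))"
  and lin_mult_right: "lin f \<Longrightarrow> lin (\<lambda>P. f (P * Q))"
  by (simp_all only: lin_def distrib_left distrib_right scalar_left_commute mult.assoc simp_thms)

definition linext :: "('x list \<Rightarrow> complex) \<Rightarrow> ('x list \<Rightarrow>\<^sub>0 complex) \<Rightarrow> complex" where
  "linext f P = (\<Sum>u\<in>Poly_Mapping.keys P. Poly_Mapping.lookup P u * f u)"

lemma linext_superset:
  assumes "finite A" "Poly_Mapping.keys P \<subseteq> A"
  shows "linext f P = (\<Sum>u\<in>A. Poly_Mapping.lookup P u * f u)"
  unfolding linext_def using assms by (intro sum.mono_neutral_left) (auto simp: in_keys_iff)

lemma lin_linext: "lin (linext f)"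
  unfolding lin_def
proof safe
  fix P Q :: "'a list \<Rightarrow>\<^sub>0 complex" and c
  let ?A = "Poly_Mapping.keys P \<union> Poly_Mapping.keys Q"
  show "linext f (P + Q) = linext f P + linext f Q"
    by (subst (1 2 3) linext_superset[of ?A])
      (auto simp: lookup_add algebra_simps sum.distrib dest: set_mp[OF keys_add])
  show "linext f (scalar c * P) = c * linext f P"
    by (subst (1 2) linext_superset[of "Poly_Mapping.keys P"])
      (auto simp: sum_distrib_left in_keys_iff algebra_simps)
qed

lemma linext_mono [simp]: "linext f (mon u) = f u"
  by (simp add: linext_def mon_def)

lemma linext_add: "linext (\<lambda>u. f u + g u) P = linext f P + linext g P"
  by (simp add: linext_def algebra_simps sum.distrib)

lemma linext_const_mult: "linext (\<lambda>u. c * f u) P = c * linext f P"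
  by (simp add: linext_def sum_distrib_left algebra_simps)

lemma linext_sum: "linext (\<lambda>u. \<Sum>a\<in>A. f a u) P = (\<Sum>a\<in>A. linext (f a) P)"
  unfolding linext_def by (simp add: sum_distrib_left) (rule sum.swap)

section \<open>Colours and double derivations\<close>

text \<open>Constants belong to every colour, since the empty word has no letters. In the
  application the colour is the index of the matrix.\<close>

definition colp :: "('x \<Rightarrow> 'i) \<Rightarrow> 'i \<Rightarrow> ('x list \<Rightarrow>\<^sub>0 complex) set" where
  "colp clr c = {P. \<forall>u\<in>Poly_Mapping.keys P. clr ` set u \<subseteq> {c}}"

lemma mon_colp: "clr ` set u \<subseteq> {c} \<Longrightarrow> mon u \<in> colp clr c"
  by (simp add: colp_def mon_def)

lemma scalar_colp: "scalar a \<in> colp clr c"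
  by (simp add: colp_def scalar_def)

lemma add_colp: "P \<in> colp clr c \<Longrightarrow> Q \<in> colp clr c \<Longrightarrow> P + Q \<in> colp clr c"
  using keys_add[of P Q] by (auto simp: colp_def)

lemma diff_colp:
  assumes "P \<in> colp clr c" "Q \<in> colp clr c" shows "P - Q \<in> colp clr c"
  unfolding colp_def
proof safe
  fix u x assume "u \<in> Poly_Mapping.keys (P - Q)" "x \<in> set u"
  moreover then have "u \<in> Poly_Mapping.keys P \<or> u \<in> Poly_Mapping.keys Q"
    by (auto simp: in_keys_iff lookup_minus)
  ultimately show "clr x = c" using assms by (auto simp: colp_def)
qed

lemma mult_colp:
  assumes "P \<in> colp clr c" "Q \<in> colp clr c" shows "P * Q \<in> colp clr c"
  using assms keys_mult[of P Q] by (fastforce simp: colp_def plus_list_def)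

lemma colp_eqI:
  assumes "P \<in> colp clr c" "lin f" "lin g"
    "\<And>w. clr ` set w \<subseteq> {c} \<Longrightarrow> f (mon w) = g (mon w)"
  shows "f P = g P"
  by (rule lin_eqI[OF assms(2,3)], rule assms(4)) (use assms(1) in \<open>auto simp: colp_def\<close>)

definition bilin ::
  "(('x list \<Rightarrow>\<^sub>0 complex) \<Rightarrow> ('x list \<Rightarrow>\<^sub>0 complex) \<Rightarrow> complex) \<Rightarrow> bool" where
  "bilin F \<longleftrightarrow> (\<forall>V. lin (\<lambda>U. F U V)) \<and> (\<forall>U. lin (F U))"

lemma bilinI: "(\<And>V. lin (\<lambda>U. F U V)) \<Longrightarrow> (\<And>U. lin (F U)) \<Longrightarrow> bilin F"
  by (simp add: bilin_def)

lemma bilin_right: "bilin F \<Longrightarrow> lin (F U)"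
  and bilin_left: "bilin F \<Longrightarrow> lin (\<lambda>U. F U V)"
  by (simp_all add: bilin_def)

lemma bilin_mult:
  assumes "bilin F" shows "bilin (\<lambda>U V. F (P * U) (V * Q))"
proof (rule bilinI)
  show "lin (\<lambda>U. F (P * U) (V * Q))" for V
    by (rule lin_mult_left[OF bilin_left[OF assms]])
  show "lin (\<lambda>V. F (P * U) (V * Q))" for U
    by (rule lin_mult_right[OF bilin_right[OF assms]])
qed

lemma bilin_prod: "lin f \<Longrightarrow> lin g \<Longrightarrow> bilin (\<lambda>U V. f U * g V)"
  using lin_const_left[of g] lin_const_right[of f] by (auto simp: bilin_def)

definition bilext ::
  "('x list \<Rightarrow> 'x list \<Rightarrow> complex) \<Rightarrow> ('x list \<Rightarrow>\<^sub>0 complex) \<Rightarrow> ('x list \<Rightarrow>\<^sub>0 complex) \<Rightarrow> complex" where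
  "bilext F P Q = linext (\<lambda>u. linext (F u) Q) P"

lemma bilext_mono [simp]: "bilext F (mon u) (mon v) = F u v"
  by (simp add: bilext_def)

lemma bilin_bilext: "bilin (bilext F)"
proof (rule bilinI)
  show "lin (\<lambda>U. bilext F U V)" for V
    unfolding bilext_def by (rule lin_linext)
  show "lin (bilext F U)" for U
    unfolding bilext_def[abs_def] linext_def[of "\<lambda>u. linext (F u) _"]
    by (intro lin_sumI lin_const_left lin_linext)
qed

lemma bilin_eqI:
  assumes "bilin F" "bilin F'"
    "\<And>u v. u \<in> Poly_Mapping.keys P \<Longrightarrow> v \<in> Poly_Mapping.keys Q \<Longrightarrow> F (mon u) (mon v) = F' (mon u) (mon v)"
  shows "F P Q = F' P Q"
proof (rule lin_eqI[OF bilin_left[OF assms(1)] bilin_left[OF assms(2)]])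
  fix u assume u: "u \<in> Poly_Mapping.keys P"
  show "F (mon u) Q = F' (mon u) Q"
    by (rule lin_eqI[OF bilin_right[OF assms(1)] bilin_right[OF assms(2)]]) (rule assms(3)[OF u])
qed

text \<open>The free difference quotient, with a removed letter y weighted by \<open>b x y\<close>;
  in place of the tensor of the two pieces beside it, the value of the bilinear form
  \<open>F\<close> is recorded.\<close>

definition dder ::
  "('x \<Rightarrow> 'x \<Rightarrow> complex) \<Rightarrow> 'x \<Rightarrow> (('x list \<Rightarrow>\<^sub>0 complex) \<Rightarrow> ('x list \<Rightarrow>\<^sub>0 complex) \<Rightarrow> complex) \<Rightarrow>
   ('x list \<Rightarrow>\<^sub>0 complex) \<Rightarrow> complex" where
  "dder b x F = linext (\<lambda>w. \<Sum>k<length w. b x (w ! k) * F (mon (take k w)) (mon (drop (Suc k) w)))"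

lemma dder_mono:
  "dder b x F (mon w) = (\<Sum>k<length w. b x (w ! k) * F (mon (take k w)) (mon (drop (Suc k) w)))"
  by (simp add: dder_def)

lemma lin_dder: "lin (dder b x F)"
  unfolding dder_def by (rule lin_linext)

lemma dder_1 [simp]: "dder b x F 1 = 0"
  using dder_mono[of b x F "[]"] by simp

lemma dder_add: "dder b x (\<lambda>U V. F U V + F' U V) Q = dder b x F Q + dder b x F' Q"
  by (simp add: dder_def distrib_left sum.distrib linext_add)

lemma dder_const_left: "dder b x (\<lambda>U V. a * F U V) Q = a * dder b x F Q"
proof -
  have "(\<lambda>w. \<Sum>k<length w. b x (w ! k) * (a * F (mon (take k w)) (mon (drop (Suc k) w)))) =
    (\<lambda>w. a * (\<Sum>k<length w. b x (w ! k) * F (mon (take k w)) (mon (drop (Suc k) w))))"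
    by (simp add: sum_distrib_left mult_ac)
  then show ?thesis by (simp add: dder_def linext_const_mult)
qed

lemma dder_sum: "dder b x (\<lambda>U V. \<Sum>a\<in>A. F a U V) Q = (\<Sum>a\<in>A. dder b x (F a) Q)"
proof -
  have "(\<lambda>w. \<Sum>k<length w. b x (w ! k) * (\<Sum>a\<in>A. F a (mon (take k w)) (mon (drop (Suc k) w)))) =
    (\<lambda>w. \<Sum>a\<in>A. \<Sum>k<length w. b x (w ! k) * F a (mon (take k w)) (mon (drop (Suc k) w)))"
    by (rule ext) (simp add: sum_distrib_left, rule sum.swap)
  then show ?thesis by (simp add: dder_def linext_sum)
qed

lemma lin_dder_param:
  assumes "\<And>U V. lin (\<lambda>R. F R U V)"
  shows "lin (\<lambda>R. dder b x (F R) Q)"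
  unfolding dder_def linext_def by (intro lin_sumI lin_const_left assms)

lemma dder_cong_mono:
  assumes "\<And>u v. length u < length w \<Longrightarrow> length v < length w \<Longrightarrow> set u \<subseteq> set w \<Longrightarrow> set v \<subseteq> set w \<Longrightarrow>
    F (mon u) (mon v) = F' (mon u) (mon v)"
  shows "dder b x F (mon w) = dder b x F' (mon w)"
  unfolding dder_mono
  by (intro sum.cong refl arg_cong2[of _ _ _ _ "(*)"] assms)
    (auto dest: in_set_takeD in_set_dropD)

lemma dder_cong:
  assumes "Q \<in> colp clr c"
    and "\<And>u v. clr ` set u \<subseteq> {c} \<Longrightarrow> clr ` set v \<subseteq> {c} \<Longrightarrow> F (mon u) (mon v) = F' (mon u) (mon v)"
  shows "dder b x F Q = dder b x F' Q"
proof (rule lin_eqI[OF lin_dder lin_dder], rule dder_cong_mono)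
  fix w u v assume "w \<in> Poly_Mapping.keys Q" "set u \<subseteq> set w" "set v \<subseteq> set w"
  moreover then have "clr ` set w \<subseteq> {c}" using assms(1) by (auto simp: colp_def)
  ultimately show "F (mon u) (mon v) = F' (mon u) (mon v)"
    by (intro assms(2)) blast+
qed

lemma sum_lessThan_add: "(\<Sum>k<m + n. f k) = (\<Sum>k<m. f k) + (\<Sum>k<n. f (m + k :: nat) :: 'a :: comm_monoid_add)"
  by (induction n) (simp_all add: add.assoc)

lemma dder_Leibniz_mono:
  assumes "bilin F"
  shows "dder b x F (mon u * mon v) =
    dder b x (\<lambda>U V. F U (V * mon v)) (mon u) + dder b x (\<lambda>U V. F (mon u * U) V) (mon v)"
proof -
  let ?f = "\<lambda>k. b x ((u @ v) ! k) * F (mon (take k (u @ v))) (mon (drop (Suc k) (u @ v)))"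
  have "dder b x F (mon u * mon v) = (\<Sum>k<length u + length v. ?f k)"
    unfolding mon_append[symmetric] dder_mono by simp
  also have "\<dots> = (\<Sum>k<length u. ?f k) + (\<Sum>k<length v. ?f (length u + k))"
    by (rule sum_lessThan_add)
  also have "(\<Sum>k<length u. ?f k) = dder b x (\<lambda>U V. F U (V * mon v)) (mon u)"
    unfolding dder_mono by (intro sum.cong refl) (auto simp: nth_append simp flip: mon_append)
  also have "(\<Sum>k<length v. ?f (length u + k)) = dder b x (\<lambda>U V. F (mon u * U) V) (mon v)"
    unfolding dder_mono by (intro sum.cong refl) (auto simp: simp flip: mon_append)
  finally show ?thesis .
qed

text \<open>The removed letter lies in \<open>P\<close> or in \<open>Q\<close>; the other factor
  stays on its side and is absorbed by \<open>V\<close> or by \<open>U\<close>.\<close>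

lemma dder_Leibniz:
  assumes F: "bilin F"
  shows "dder b x F (P * Q) =
    dder b x (\<lambda>U V. F U (V * Q)) P + dder b x (\<lambda>U V. F (P * U) V) Q"
proof (rule bilin_eqI[of "\<lambda>P Q. dder b x F (P * Q)"
      "\<lambda>P Q. dder b x (\<lambda>U V. F U (V * Q)) P + dder b x (\<lambda>U V. F (P * U) V) Q"])
  show "bilin (\<lambda>P Q. dder b x F (P * Q))"
    by (rule bilinI) (rule lin_mult_left[OF lin_dder] lin_mult_right[OF lin_dder])+
  have "lin (\<lambda>Q. F U (V * Q))" "lin (\<lambda>P. F (P * U) V)" for U V
    by (rule lin_mult_left[OF bilin_right[OF F]], rule lin_mult_right[OF bilin_left[OF F]])
  then show "bilin (\<lambda>P Q. dder b x (\<lambda>U V. F U (V * Q)) P + dder b x (\<lambda>U V. F (P * U) V) Q)"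
    by (intro bilinI lin_plusI[OF lin_dder lin_dder_param] lin_plusI[OF lin_dder_param lin_dder])
qed (rule dder_Leibniz_mono[OF F])

definition lprod :: "('i \<times> ('x list \<Rightarrow>\<^sub>0 complex)) list \<Rightarrow> ('x list \<Rightarrow>\<^sub>0 complex)" where
  "lprod L = prod_list (map snd L)"

lemma lprod_simps [simp]:
  "lprod [] = 1" "lprod (A # L) = snd A * lprod L" "lprod (L @ L') = lprod L * lprod L'"
  by (simp_all add: lprod_def)

lemma dder_lprod:
  assumes "bilin F"
  shows "dder b x F (lprod L) = (\<Sum>k<length L.
    dder b x (\<lambda>U V. F (lprod (take k L) * U) (V * lprod (drop (Suc k) L))) (snd (L ! k)))"
  using assms
proof (induction L arbitrary: F)
  case Nil
  show ?case by simp
next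
  case (Cons A L)
  have "bilin (\<lambda>U V. F (snd A * U) V)"
    using bilin_mult[OF Cons.prems, of "snd A" 1] by simp
  note IH = Cons.IH[OF this]
  have "dder b x F (lprod (A # L)) = dder b x (\<lambda>U V. F U (V * lprod L)) (snd A) +
    dder b x (\<lambda>U V. F (snd A * U) V) (lprod L)"
    by (simp add: dder_Leibniz[OF Cons.prems])
  then show ?case
    unfolding IH length_Cons sum.lessThan_Suc_shift by (simp add: mult.assoc)
qed

section \<open>The limit functionals\<close>

text \<open>The sum over non-crossing pairings of the letters, each pair weighted by
  \<open>b\<close>, arranged by the partner of the first letter; these are the moments of a
  semicircular-type family with covariance \<open>b\<close>.\<close>

fun phiw :: "('x \<Rightarrow> 'x \<Rightarrow> complex) \<Rightarrow> 'x list \<Rightarrow> complex" where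
  "phiw b [] = 1"
| "phiw b (x # w) = (\<Sum>k<length w. b x (w ! k) * (phiw b (take k w) * phiw b (drop (Suc k) w)))"

text \<open>The sum over non-crossing annular pairings of two circles with at least one connecting
  pair. If the first letter is paired within its own circle, one of the two arcs keeps the
  connection and the other closes up; if it is paired with a letter of \<open>v\<close>, cutting
  along this pair turns the annulus into a disc read as
  \<open>w @ drop (Suc k) v @ take k v\<close>.\<close>

fun gw :: "('x \<Rightarrow> 'x \<Rightarrow> complex) \<Rightarrow> 'x list \<Rightarrow> 'x list \<Rightarrow> complex" where
  "gw b [] v = 0"
| "gw b (x # w) v =
     (\<Sum>k<length w. b x (w ! k) * (phiw b (take k w) * gw b (drop (Suc k) w) v)) +
     (\<Sum>k<length w. b x (w ! k) * (gw b (take k w) v * phiw b (drop (Suc k) w))) +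
     (\<Sum>k<length v. b x (v ! k) * phiw b (w @ drop (Suc k) v @ take k v))"

text \<open>Expand the word at its first letter, and the piece behind the partner of that letter at
  its last letter: this gives a double sum over partners \<open>k < l\<close>, and summing over
  \<open>k\<close> first yields the expansion at the last letter. The pair formed by the two ends is
  the remaining term; there the symmetry of \<open>b\<close> enters.\<close>

lemma phiw_snoc:
  assumes b_sym: "\<And>x y. b x y = b y x"
  shows "phiw b (w @ [x]) = (\<Sum>k<length w. b x (w ! k) * (phiw b (take k w) * phiw b (drop (Suc k) w)))"
proof (induction w rule: length_induct)
  case (1 w)
  show ?case
  proof (cases w)
    case Nil then show ?thesis by simp
  next
    case (Cons y w')
    let ?n = "length w'"
    let ?p = "phiw b"
    let ?f = "\<lambda>k l. b y (w' ! k) * b x (w' ! l) * (?p (take k w') * ?p (take (l - Suc k) (drop (Suc k) w')) * ?p (drop (Suc l) w'))"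
    have IH: "?p (drop (Suc k) w' @ [x]) = (\<Sum>l\<in>{k<..<?n}. b x (w' ! l) *
       (?p (take (l - Suc k) (drop (Suc k) w')) * ?p (drop (Suc l) w')))" if "k < ?n" for k
    proof -
      have "?p (drop (Suc k) w' @ [x]) = (\<Sum>j<?n - Suc k. b x (w' ! (Suc k + j)) *
        (?p (take j (drop (Suc k) w')) * ?p (drop (Suc (Suc k + j)) w')))"
        using 1 Cons that by (simp add: add.commute)
      also have "\<dots> = (\<Sum>l\<in>{k<..<?n}. b x (w' ! l) *
        (?p (take (l - Suc k) (drop (Suc k) w')) * ?p (drop (Suc l) w')))"
        by (rule sum.reindex_bij_witness[of _ "\<lambda>l. l - Suc k" "\<lambda>j. Suc k + j"]) auto
      finally show ?thesis .
    qed
    have "?p (w @ [x]) = (\<Sum>k<?n. b y (w' ! k) * (?p (take k w') * ?p (drop (Suc k) w' @ [x]))) + b y x * ?p w'"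
      by (simp add: Cons nth_append)
    also have "(\<Sum>k<?n. b y (w' ! k) * (?p (take k w') * ?p (drop (Suc k) w' @ [x]))) =
       (\<Sum>k<?n. \<Sum>l\<in>{k<..<?n}. ?f k l)"
      by (intro sum.cong refl) (simp add: IH sum_distrib_left mult_ac)
    also have "\<dots> = (\<Sum>l<?n. \<Sum>k<l. ?f k l)"
      unfolding sum.Sigma[OF finite_lessThan ballI[OF finite_greaterThanLessThan]]
        sum.Sigma[OF finite_lessThan ballI[OF finite_lessThan]]
      by (rule sum.reindex_bij_witness[of _ prod.swap prod.swap]) auto
    also have "\<dots> = (\<Sum>l<?n. b x (w' ! l) * (?p (take (Suc l) w) * ?p (drop (Suc l) w')))"
    proof (rule sum.cong[OF refl])
      fix l assume "l \<in> {..<?n}"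
      then show "(\<Sum>k<l. ?f k l) = b x (w' ! l) * (?p (take (Suc l) w) * ?p (drop (Suc l) w'))"
        by (simp add: Cons sum_distrib_left sum_distrib_right min_def take_drop mult_ac)
    qed
    finally show ?thesis
      by (simp add: Cons sum.lessThan_Suc_shift b_sym[of y x] del: sum.lessThan_Suc)
  qed
qed

text \<open>Moving one letter from the front to the end changes nothing, because the expansion at
  the first letter and the expansion of the rotated word at its last letter have the same right-hand
  side.\<close>

lemma phiw_trace:
  assumes b_sym: "\<And>x y. b x y = b y x"
  shows "phiw b (u @ v) = phiw b (v @ u)"
proof (induction u arbitrary: v)
  case (Cons x u)
  have "phiw b ((x # u) @ v) = phiw b ((u @ v) @ [x])"
    by (simp only: phiw_snoc[OF b_sym] phiw.simps append_Cons)
  also have "\<dots> = phiw b (v @ x # u)"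
    using Cons.IH[of "v @ [x]"] by simp
  finally show ?case .
qed simp

text \<open>\<open>b_clr\<close> is what independence of different matrices becomes in the
  limit.\<close>

locale coloured_covariance =
  fixes b :: "'x \<Rightarrow> 'x \<Rightarrow> complex" and clr :: "'x \<Rightarrow> 'i"
  assumes b_sym: "b x y = b y x"
    and b_clr: "clr x \<noteq> clr y \<Longrightarrow> b x y = 0"
begin

abbreviation "\<phi> \<equiv> linext (phiw b)"
abbreviation "G \<equiv> bilext (gw b)"
abbreviation "D x F \<equiv> dder b x F"
abbreviation "mono_in c \<equiv> colp clr c"

lemma phi_1 [simp]: "\<phi> 1 = 1"
  using linext_mono[of "phiw b" "[]"] by simp

lemma lin_phi [simp]: "lin \<phi>"
  by (rule lin_linext)

lemma phi_trace: "\<phi> (P * Q) = \<phi> (Q * P)"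
proof (rule bilin_eqI[of "\<lambda>P Q. \<phi> (P * Q)" "\<lambda>P Q. \<phi> (Q * P)"])
  show "\<phi> (mon u * mon v) = \<phi> (mon v * mon u)" for u v
    unfolding mon_append[symmetric] linext_mono by (rule phiw_trace[OF b_sym])
  show "bilin (\<lambda>P Q. \<phi> (P * Q))" "bilin (\<lambda>P Q. \<phi> (Q * P))"
    by (rule bilinI; rule lin_mult_left[OF lin_phi] lin_mult_right[OF lin_phi])+
qed

lemma D_other:
  assumes "Q \<in> mono_in c" "clr x \<noteq> c"
  shows "D x F Q = 0"
proof -
  have "lin (\<lambda>_. 0)" by (simp add: lin_def)
  show ?thesis
  proof (rule colp_eqI[OF assms(1) lin_dder \<open>lin (\<lambda>_. 0)\<close>])
    fix w assume w: "clr ` set w \<subseteq> {c}"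
    have "b x (w ! k) = 0" if "k < length w" for k
      using w assms(2) nth_mem[OF that] by (intro b_clr) auto
    then show "D x F (mon w) = 0" by (simp add: dder_mono)
  qed
qed

lemma phi_SD: "\<phi> (mon [x] * Q) = D x (\<lambda>U V. \<phi> U * \<phi> V) Q"
proof (rule lin_eqI[OF lin_mult_left[OF lin_phi] lin_dder])
  show "\<phi> (mon [x] * mon u) = D x (\<lambda>U V. \<phi> U * \<phi> V) (mon u)" for u
    by (simp add: dder_mono flip: mon_append)
qed

text \<open>In the last term \<open>R\<close> is cut at the contracted letter into U and V and
  reread cyclically from that place, hence the order \<open>V * U\<close>.\<close>

lemma G_SD: "G (mon [x] * Q) R = D x (\<lambda>U V. \<phi> U * G V R) Q + D x (\<lambda>U V. G U R * \<phi> V) Q +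
    D x (\<lambda>U V. \<phi> (Q * V * U)) R"
proof (rule bilin_eqI[of "\<lambda>Q R. G (mon [x] * Q) R"
     "\<lambda>Q R. D x (\<lambda>U V. \<phi> U * G V R) Q + D x (\<lambda>U V. G U R * \<phi> V) Q + D x (\<lambda>U V. \<phi> (Q * V * U)) R"])
  have G: "lin (\<lambda>R. G Q R)" "lin (\<lambda>Q. G Q R)" for Q R
    using bilin_bilext[of "gw b"] by (auto simp: bilin_def)
  show "bilin (\<lambda>Q. G (mon [x] * Q))"
    by (simp add: bilin_def G lin_mult_left[OF G(2)])
  have "lin (\<lambda>R. \<phi> (R * V * U))" for U V
    unfolding mult.assoc by (rule lin_mult_right[OF lin_phi])
  then show "bilin (\<lambda>Q R. D x (\<lambda>U V. \<phi> U * G V R) Q + D x (\<lambda>U V. G U R * \<phi> V) Q + D x (\<lambda>U V. \<phi> (Q * V * U)) R)"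
    by (intro bilinI lin_plusI[OF lin_plusI[OF lin_dder lin_dder] lin_dder_param]
       lin_plusI[OF lin_plusI[OF lin_dder_param[OF lin_const_left[OF G(1)]] lin_dder_param[OF lin_const_right[OF G(1)]]] lin_dder])
  show "G (mon [x] * mon u) (mon v) = D x (\<lambda>U V. \<phi> U * G V (mon v)) (mon u) +
    D x (\<lambda>U V. G U (mon v) * \<phi> V) (mon u) + D x (\<lambda>U V. \<phi> (mon u * V * U)) (mon v)" for u v
    by (simp add: dder_mono mult.assoc flip: mon_append)
qed

section \<open>Freeness in first and second order from the Schwinger-Dyson equations\<close>

definition alt :: "('i \<times> ('x list \<Rightarrow>\<^sub>0 complex)) list \<Rightarrow> bool" where
  "alt L \<longleftrightarrow> distinct_adj (map fst L) \<and> (\<forall>A\<in>set L. snd A \<in> mono_in (fst A) \<and> \<phi> (snd A) = 0)"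

lemma alt_Nil [simp]: "alt []"
  by (simp add: alt_def)

lemma alt_Cons:
  "alt (A # L) \<longleftrightarrow> snd A \<in> mono_in (fst A) \<and> \<phi> (snd A) = 0 \<and> alt L \<and> (L \<noteq> [] \<longrightarrow> fst A \<noteq> fst (hd L))"
  by (cases L) (auto simp: alt_def)

lemma alt_append:
  "alt (L @ L') \<longleftrightarrow> alt L \<and> alt L' \<and> (L \<noteq> [] \<longrightarrow> L' \<noteq> [] \<longrightarrow> fst (last L) \<noteq> fst (hd L'))"
  by (auto simp: alt_def distinct_adj_append_iff last_map hd_map)

lemma alt_rev: "alt (rev L) \<longleftrightarrow> alt L"
  by (simp add: alt_def rev_map[symmetric])

lemma center_split:
  assumes "lin f"
  shows "f U = f (U - scalar (\<phi> U)) + \<phi> U * f 1"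
  using lin_diff[OF assms, of U "scalar (\<phi> U)"] by (simp add: lin_scalar[OF assms])

lemma phi_center: "\<phi> (U - scalar (\<phi> U)) = 0"
  by (simp add: lin_diff lin_scalar)

lemma center_colp: "U \<in> mono_in c \<Longrightarrow> U - scalar (\<phi> U) \<in> mono_in c"
  by (intro diff_colp scalar_colp)

text \<open>The Leibniz rule differentiates one factor at a time. A factor of another colour has
  derivative 0, and a factor of the colour of \<open>x\<close> leaves monomials of this colour on
  both sides of the removed letter.\<close>

lemma D_lprod_zero:
  assumes "bilin F" "alt L"
    and "\<And>X A Y u v. L = X @ A # Y \<Longrightarrow> fst A = clr x \<Longrightarrow> clr ` set u \<subseteq> {clr x} \<Longrightarrow>
      clr ` set v \<subseteq> {clr x} \<Longrightarrow> F (lprod X * mon u) (mon v * lprod Y) = 0"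
  shows "D x F (lprod L) = 0"
proof -
  have "D x (\<lambda>U V. F (lprod (take k L) * U) (V * lprod (drop (Suc k) L))) (snd (L ! k)) = 0"
    if k: "k < length L" for k
  proof -
    have A: "snd (L ! k) \<in> mono_in (fst (L ! k))"
      using assms(2) nth_mem[OF k] by (simp add: alt_def)
    show ?thesis
    proof (cases "fst (L ! k) = clr x")
      case False
      then show ?thesis by (intro D_other[OF A]) simp
    next
      case True
      have "D x (\<lambda>U V. F (lprod (take k L) * U) (V * lprod (drop (Suc k) L))) (snd (L ! k)) =
        D x (\<lambda>U V. 0 * 0) (snd (L ! k))"
        using assms(3)[OF id_take_nth_drop[OF k] True] True by (intro dder_cong[OF A]) simp
      also have "\<dots> = 0" using dder_const_left[of b x 0 "\<lambda>U V. 0" "snd (L ! k)"] by simp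
      finally show ?thesis .
    qed
  qed
  then show ?thesis by (simp add: dder_lprod[OF assms(1)])
qed

text \<open>The uncentered word in front is what makes an induction possible. Its first letter is
  contracted inside \<open>w\<close>, which leaves a shorter word before \<open>L\<close>, or with a
  factor of its colour in \<open>L\<close>, and then the part to the left of the partner is again of
  the form treated.\<close>

lemma phi_word_alt:
  assumes "alt L" "L \<noteq> []" "fst (hd L) \<noteq> c" "clr ` set w \<subseteq> {c}"
  shows "\<phi> (mon w * lprod L) = 0"
  using assms
proof (induction "(length L, length w)" arbitrary: L w c rule: wf_induct_rule[OF wf_lex_prod[OF wf_less_than wf_less_than]])
  case (1 L w c)
  note IH = 1(1) and L = 1(2) and ne = 1(3) and hd = 1(4) and w = 1(5)
  show ?case
  proof (cases w)
    \<comment> \<open>With no word left, the first factor of \<open>L\<close> is expanded into words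
      and takes over the role of \<open>w\<close>; if it stands alone, its centering gives the
      claim.\<close>
    case Nil
    obtain A L' where LA: "L = A # L'" using ne by (cases L) auto
    show ?thesis
    proof (cases "L' = []")
      case True with L show ?thesis by (simp add: LA Nil alt_Cons)
    next
      case False
      have "\<phi> (snd A * lprod L') = 0"
      proof (rule colp_eqI[of "snd A" clr "fst A" "\<lambda>P. \<phi> (P * lprod L')" "\<lambda>_. 0"])
        show "\<phi> (mon v * lprod L') = 0" if "clr ` set v \<subseteq> {fst A}" for v
          using False that L by (intro IH) (auto simp: LA alt_Cons)
        show "lin (\<lambda>P. \<phi> (P * lprod L'))" by (rule lin_mult_right[OF lin_phi])
      qed (use L in \<open>simp_all add: LA alt_Cons lin_def\<close>)
      then show ?thesis by (simp add: LA Nil)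
    qed
  next
    case (Cons x w')
    have x: "clr x = c" and w': "clr ` set w' \<subseteq> {c}" using w by (auto simp: Cons)
    have bl: "bilin (\<lambda>U V. \<phi> U * \<phi> V)" by (simp add: bilin_prod)
    have "\<phi> (mon w * lprod L) = D x (\<lambda>U V. \<phi> U * \<phi> V) (mon w' * lprod L)"
      unfolding Cons mon_Cons[of x w'] mult.assoc by (rule phi_SD)
    also have "\<dots> = D x (\<lambda>U V. \<phi> U * \<phi> (V * lprod L)) (mon w') +
        D x (\<lambda>U V. \<phi> (mon w' * U) * \<phi> V) (lprod L)"
      by (rule dder_Leibniz[OF bl])
    also have "D x (\<lambda>U V. \<phi> U * \<phi> (V * lprod L)) (mon w') = D x (\<lambda>U V. 0) (mon w')"
    proof (rule dder_cong_mono)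
      fix u v :: "'x list" assume "length v < length w'" "set v \<subseteq> set w'"
      then have "\<phi> (mon v * lprod L) = 0"
        using L ne hd w' by (intro IH) (auto simp: Cons)
      then show "\<phi> (mon u) * \<phi> (mon v * lprod L) = 0" by simp
    qed
    also have "D x (\<lambda>U V. 0) (mon w') = 0" by (simp add: dder_mono)
    also have "D x (\<lambda>U V. \<phi> (mon w' * U) * \<phi> V) (lprod L) = 0"
    proof (rule D_lprod_zero[OF _ L])
      show "bilin (\<lambda>U V. \<phi> (mon w' * U) * \<phi> V)"
        by (intro bilin_prod lin_mult_left lin_phi)
      fix X A Y and u v :: "'x list"
      assume LX: "L = X @ A # Y" and A: "fst A = clr x" and u: "clr ` set u \<subseteq> {clr x}"
      \<comment> \<open>\<open>X\<close> is not empty, because the factor hit has colour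
        \<open>c\<close> and the first factor of \<open>L\<close> has not.\<close>
      then have X: "alt X" "X \<noteq> []" "fst (hd X) \<noteq> c"
        using L hd x by (auto simp: LX alt_append hd_append split: if_splits)
      \<comment> \<open>Centering \<open>u\<close> makes \<open>X\<close> followed by it
        alternating. This list can be as long as \<open>L\<close>, but the word \<open>w'\<close> is
        shorter than \<open>w\<close>, hence the lexicographic order. The scalar part leaves
        \<open>X\<close> alone.\<close>
      let ?U = "mon u - scalar (\<phi> (mon u))"
      have U: "mon u \<in> mono_in c" using u x by (intro mon_colp) auto
      have "\<phi> (mon w' * lprod (X @ [(c, ?U)])) = 0"
      proof (rule IH)
        show "alt (X @ [(c, ?U)])"
          using L A x center_colp[OF U] phi_center[of "mon u"] by (auto simp: LX alt_append alt_Cons)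
      qed (use X w' in \<open>auto simp: LX Cons\<close>)
      moreover have "\<phi> (mon w' * lprod X) = 0"
        using X w' by (intro IH) (auto simp: LX)
      moreover have "lin (\<lambda>U. \<phi> (mon w' * (lprod X * U)))"
        unfolding mult.assoc[symmetric] by (rule lin_mult_left[OF lin_phi])
      ultimately have "\<phi> (mon w' * (lprod X * mon u)) = 0"
        using center_split[of "\<lambda>U. \<phi> (mon w' * (lprod X * U))" "mon u"] by simp
      then show "\<phi> (mon w' * (lprod X * mon u)) * \<phi> (mon v * lprod Y) = 0" by simp
    qed
    finally show ?thesis by simp
  qed
qed

lemma phi_left_alt:
  assumes "alt L" "L \<noteq> []" "fst (hd L) \<noteq> c" "Q \<in> mono_in c"
  shows "\<phi> (Q * lprod L) = 0"
proof (rule colp_eqI[OF assms(4), of "\<lambda>P. \<phi> (P * lprod L)" "\<lambda>_. 0"])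
  show "lin (\<lambda>P. \<phi> (P * lprod L))" by (rule lin_mult_right[OF lin_phi])
  show "\<phi> (mon w * lprod L) = 0" if "clr ` set w \<subseteq> {c}" for w
    by (rule phi_word_alt[OF assms(1-3) that])
qed (simp add: lin_def)

text \<open>Freeness for \<phi>: the first factor, taken as an arbitrary left factor of its colour,
  meets an alternating product that begins with another colour.\<close>

lemma phi_alt:
  assumes "alt L" "L \<noteq> []" shows "\<phi> (lprod L) = 0"
proof -
  obtain A L' where LA: "L = A # L'" using assms(2) by (cases L) auto
  show ?thesis
  proof (cases "L' = []")
    case True with assms show ?thesis by (simp add: LA alt_Cons)
  next
    case False
    have "fst (hd L') \<noteq> fst A" "alt L'" "snd A \<in> mono_in (fst A)"
      using assms(1) False by (auto simp: LA alt_Cons)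
    then show ?thesis using phi_left_alt[of L' "fst A" "snd A"] False by (simp add: LA)
  qed
qed

lemma lin_phi_mid: "lin (\<lambda>U. \<phi> (P * (U * Q)))"
  using lin_mult_left[OF lin_mult_right[OF lin_phi, of Q], of P] by (simp add: mult.assoc)

text \<open>The two factors meeting in the middle decide. If their colours differ, the whole product
  is alternating and vanishes, and so does \<phi> of the two. If they agree, the centered part of
  their product again gives an alternating product, and the scalar part is a factor in front of a
  shorter product of the same form.\<close>

lemma phi_matching:
  assumes "alt As" "alt Es"
  shows "\<phi> (lprod (rev As) * lprod Es) =
    (if length As = length Es then \<Prod>k<length As. \<phi> (snd (As ! k) * snd (Es ! k)) else 0)"
  using assms
proof (induction As arbitrary: Es)
  case Nil
  then show ?case using phi_alt[of Es] by auto
next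
  case (Cons A As)
  show ?case
  proof (cases Es)
    case Nil
    then show ?thesis using phi_alt[of "rev (A # As)"] Cons.prems(1) alt_rev[of "A # As"] by simp
  next
    case (Cons E Es')
    note hyps = Cons.prems[unfolded Cons alt_Cons]
    show ?thesis
    proof (cases "fst A = fst E")
      case False
      have "alt ((rev (A # As)) @ Es)"
        using Cons.prems False alt_rev[of "A # As"] unfolding alt_append by (simp add: Cons last_rev)
      then have "\<phi> (lprod (rev (A # As)) * lprod Es) = 0"
        using phi_alt[of "rev (A # As) @ Es"] by (simp add: mult.assoc)
      moreover have "\<phi> (snd A * snd E) = 0"
        using phi_alt[of "[A, E]"] hyps False by (simp add: alt_Cons)
      ultimately show ?thesis
        by (auto simp: Cons prod.lessThan_Suc_shift simp del: prod.lessThan_Suc)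
    next
      case True
      define U where "U = snd A * snd E"
      let ?U = "U - scalar (\<phi> U)"
      have U: "U \<in> mono_in (fst A)" unfolding U_def using hyps True by (auto intro: mult_colp)
      have "\<phi> (lprod (rev (A # As)) * lprod Es) = \<phi> (lprod (rev As) * (U * lprod Es'))"
        by (simp add: Cons U_def mult.assoc)
      also have "\<dots> = \<phi> (lprod (rev As) * (?U * lprod Es')) + \<phi> U * \<phi> (lprod (rev As) * lprod Es')"
        using center_split[OF lin_phi_mid, of "lprod (rev As)" U "lprod Es'"] by simp
      also have "\<phi> (lprod (rev As) * (?U * lprod Es')) = 0"
      proof -
        have "alt (rev As @ (fst A, ?U) # Es')"
          using hyps True U alt_rev[of As] by (auto simp: alt_append alt_Cons last_rev center_colp phi_center)
        from phi_alt[OF this] show ?thesis by simp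
      qed
      finally show ?thesis
        using Cons.IH[of Es'] hyps
        by (simp add: Cons U_def prod.lessThan_Suc_shift del: prod.lessThan_Suc)
    qed
  qed
qed

text \<open>The centered part of \<open>Q\<close> contributes nothing: put in front of
  \<open>As\<close> it gives an alternating product, and \<open>phi_matching\<close> could pair it
  only with the last factor of \<open>Es\<close>, which has another colour.\<close>

lemma phi_factor_left:
  assumes "alt As" "alt Es" "As \<noteq> []" "Es \<noteq> []" "fst (hd As) \<noteq> c" "fst (last Es) \<noteq> c" "Q \<in> mono_in c"
  shows "\<phi> (Q * (lprod As * lprod Es)) = \<phi> Q * \<phi> (lprod As * lprod Es)"
proof -
  let ?Q = "Q - scalar (\<phi> Q)"
  let ?X = "rev ((c, ?Q) # As)"
  have Q: "alt [(c, ?Q)]" using assms by (simp add: alt_Cons center_colp phi_center)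
  have X: "alt ?X" using assms Q unfolding alt_rev by (simp add: alt_Cons)
  have "\<phi> (?Q * (lprod As * lprod Es)) = \<phi> (lprod (rev ?X) * lprod Es)"
    by (simp add: mult.assoc)
  also have "\<dots> = 0"
  proof (cases "length ?X = length Es")
    case True
    then have "length As = length Es - 1" by simp
    then have "Es ! length As = last Es" using last_conv_nth[OF assms(4)] by metis
    moreover have "\<phi> (?Q * snd (last Es)) = 0"
    proof -
      have "alt [last Es]" using assms(2,4) by (metis alt_append append_butlast_last_id)
      then show ?thesis using phi_alt[of "[(c, ?Q), last Es]"] Q assms(6) by (simp add: alt_Cons)
    qed
    moreover have "?X ! length As = (c, ?Q)" by (simp add: nth_append)
    ultimately have "\<phi> (snd (?X ! length As) * snd (Es ! length As)) = 0" by simp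
    then show ?thesis
      unfolding phi_matching[OF X assms(2)] by (auto intro!: bexI[of _ "length As"])
  next
    case False
    then show ?thesis unfolding phi_matching[OF X assms(2)] by simp
  qed
  finally show ?thesis
    using center_split[OF lin_mult_right[OF lin_phi], of Q "lprod As * lprod Es"] by simp
qed

text \<open>For an uncentered word the mean contributes the term with \<open>\<phi> (mon w)\<close>;
  in the sum, \<open>Bs ! l\<close> is the factor that meets \<open>w\<close>, and the rest of the
  second circle, opened there, faces \<open>As\<close>. Induction on \<open>w\<close> with
  \<open>G_SD\<close>: contractions inside \<open>w\<close> are covered by the hypothesis, those
  with \<open>As\<close> vanish by freeness, and those with \<open>Bs\<close> supply what is missing
  to rebuild \<phi> of \<open>w\<close> times \<open>Bs ! l\<close> from its own Schwinger-Dyson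
  equation.\<close>

lemma G_word:
  assumes As: "alt As" "As \<noteq> []" "fst (hd As) \<noteq> c" "fst (last As) \<noteq> c"
    and Bs: "alt Bs" "fst (last Bs) \<noteq> fst (hd Bs)"
    and w: "clr ` set w \<subseteq> {c}"
  shows "G (mon w * lprod As) (lprod Bs) = \<phi> (mon w) * G (lprod As) (lprod Bs) +
    (\<Sum>l<length Bs. \<phi> (mon w * snd (Bs ! l)) * \<phi> (lprod As * lprod (drop (Suc l) Bs @ take l Bs)))"
  using w
proof (induction w rule: length_induct)
  case (1 w)
  let ?B = "lprod Bs" and ?q = "length Bs"
  let ?E = "\<lambda>l. drop (Suc l) Bs @ take l Bs"
  let ?e = "\<lambda>l. \<phi> (lprod As * lprod (?E l))"
  have linG: "lin (\<lambda>Q. G Q R)" "lin (\<lambda>R. G Q R)" for Q R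
    using bilin_bilext[of "gw b"] by (auto simp: bilin_def)
  \<comment> \<open>Differing end colours force two factors, so that removing one leaves a nonempty
    rest.\<close>
  have two: "2 \<le> ?q" if "l < ?q" for l
    using that Bs(2) by (cases Bs; cases "tl Bs") auto
  have E: "alt (?E l)" "?E l \<noteq> []" "fst (hd (?E l)) \<noteq> fst (Bs ! l)" "fst (last (?E l)) \<noteq> fst (Bs ! l)"
    "snd (Bs ! l) \<in> mono_in (fst (Bs ! l))" "\<phi> (snd (Bs ! l)) = 0" if l: "l < ?q" for l
  proof -
    define X A Y where "X = take l Bs" and "A = Bs ! l" and "Y = drop (Suc l) Bs"
    have LX: "Bs = X @ A # Y"
      unfolding X_def A_def Y_def by (rule id_take_nth_drop[OF l])
    have ne: "X \<noteq> [] \<or> Y \<noteq> []" using two[OF l] by (auto simp: LX)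
    have "alt (Y @ X) \<and> Y @ X \<noteq> [] \<and> fst (hd (Y @ X)) \<noteq> fst A \<and> fst (last (Y @ X)) \<noteq> fst A \<and>
      snd A \<in> mono_in (fst A) \<and> \<phi> (snd A) = 0"
      using Bs ne by (cases X; cases Y) (auto simp: LX alt_append alt_Cons split: if_splits)
    then show "alt (?E l)" "?E l \<noteq> []" "fst (hd (?E l)) \<noteq> fst (Bs ! l)" "fst (last (?E l)) \<noteq> fst (Bs ! l)"
      "snd (Bs ! l) \<in> mono_in (fst (Bs ! l))" "\<phi> (snd (Bs ! l)) = 0"
      unfolding X_def A_def Y_def by blast+
  qed
  show ?case
  proof (cases w)
    case Nil
    then show ?thesis using E(6) by simp
  next
    case (Cons x w')
    let ?w = "mon w'"
    have x: "clr x = c" and w': "clr ` set w' \<subseteq> {c}" using 1(2) by (auto simp: Cons)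
    have phi_w: "\<phi> (mon w * Q) = D x (\<lambda>U V. \<phi> U * \<phi> V) (?w * Q)" for Q
      unfolding Cons mon_Cons[of x w'] mult.assoc by (rule phi_SD)
    have bl: "bilin (\<lambda>U V. \<phi> U * \<phi> V)" "bilin (\<lambda>U V. \<phi> U * G V ?B)" "bilin (\<lambda>U V. G U ?B * \<phi> V)"
      by (intro bilin_prod lin_phi linG)+
    \<comment> \<open>Here the right piece stays connected with \<open>Bs\<close>. A contraction
      with a letter of \<open>As\<close> contributes nothing: rotated cyclically, the left piece is
      a word of colour \<open>c\<close> in front of an alternating product.\<close>
    have T1: "D x (\<lambda>U V. \<phi> U * G V ?B) (?w * lprod As) =
      \<phi> (mon w) * G (lprod As) ?B + (\<Sum>l<?q. ?e l * D x (\<lambda>U V. \<phi> U * \<phi> (V * snd (Bs ! l))) ?w)"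
    proof -
      have "D x (\<lambda>U V. \<phi> U * G (V * lprod As) ?B) ?w =
         D x (\<lambda>U V. G (lprod As) ?B * (\<phi> U * \<phi> V) + (\<Sum>l<?q. ?e l * (\<phi> U * \<phi> (V * snd (Bs ! l))))) ?w"
      proof (rule dder_cong_mono)
        fix u v :: "'x list" assume "length v < length w'" "set v \<subseteq> set w'"
        then have "G (mon v * lprod As) ?B = \<phi> (mon v) * G (lprod As) ?B +
            (\<Sum>l<?q. \<phi> (mon v * snd (Bs ! l)) * ?e l)"
          using w' by (intro 1(1)[rule_format]) (auto simp: Cons)
        then show "\<phi> (mon u) * G (mon v * lprod As) ?B = G (lprod As) ?B * (\<phi> (mon u) * \<phi> (mon v)) +
          (\<Sum>l<?q. ?e l * (\<phi> (mon u) * \<phi> (mon v * snd (Bs ! l))))"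
          by (simp only: distrib_left sum_distrib_left mult_ac)
      qed
      also have "\<dots> = G (lprod As) ?B * \<phi> (mon w) + (\<Sum>l<?q. ?e l * D x (\<lambda>U V. \<phi> U * \<phi> (V * snd (Bs ! l))) ?w)"
        using phi_w[of 1] by (simp only: dder_add dder_sum dder_const_left mult_1_right)
      finally have T: "D x (\<lambda>U V. \<phi> U * G (V * lprod As) ?B) ?w =
        G (lprod As) ?B * \<phi> (mon w) + (\<Sum>l<?q. ?e l * D x (\<lambda>U V. \<phi> U * \<phi> (V * snd (Bs ! l))) ?w)" .
      have "D x (\<lambda>U V. \<phi> (?w * U) * G V ?B) (lprod As) = 0"
      proof (rule D_lprod_zero[OF _ As(1)])
        show "bilin (\<lambda>U V. \<phi> (?w * U) * G V ?B)"
          by (intro bilin_prod lin_mult_left lin_phi linG)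
        fix X A Y and u v :: "'x list"
        assume LX: "As = X @ A # Y" and A: "fst A = clr x" and u: "clr ` set u \<subseteq> {clr x}"
        then have X: "alt X" "X \<noteq> []" "fst (hd X) \<noteq> c" "fst (last X) \<noteq> c"
          using As x by (auto simp: LX alt_append alt_Cons hd_append split: if_splits)
        have "\<phi> (mon (u @ w') * lprod X) = 0"
          using u w' x by (intro phi_word_alt[OF X(1-3)]) auto
        then have "\<phi> (?w * (lprod X * mon u)) = 0"
          using phi_trace[of "?w * lprod X" "mon u"] by (simp add: mon_append mult.assoc)
        then show "\<phi> (?w * (lprod X * mon u)) * G (mon v * lprod Y) ?B = 0" by simp
      qed
      then show ?thesis
        unfolding dder_Leibniz[OF bl(2)] T by (simp only: add_0_right mult.commute)
    qed
    \<comment> \<open>Here the right piece closes up. Whether the partner lies in \<open>w'\<close>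
      or in \<open>As\<close>, this piece is a word of colour \<open>c\<close> in front of a
      nonempty alternating product.\<close>
    have T2: "D x (\<lambda>U V. G U ?B * \<phi> V) (?w * lprod As) = 0"
    proof -
      have "D x (\<lambda>U V. G U ?B * \<phi> (V * lprod As)) ?w = D x (\<lambda>U V. 0 * 0) ?w"
        using phi_word_alt[OF As(1-3)] w' by (intro dder_cong[where c = c] mon_colp) auto
      also have "\<dots> = 0" by (simp add: dder_mono)
      finally have "D x (\<lambda>U V. G U ?B * \<phi> (V * lprod As)) ?w = 0" .
      moreover have "D x (\<lambda>U V. G (?w * U) ?B * \<phi> V) (lprod As) = 0"
      proof (rule D_lprod_zero[OF _ As(1)])
        show "bilin (\<lambda>U V. G (?w * U) ?B * \<phi> V)"
          by (intro bilin_prod lin_mult_left[OF linG(1)] lin_phi)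
        fix X A Y and u v :: "'x list"
        assume LX: "As = X @ A # Y" and A: "fst A = clr x" and v: "clr ` set v \<subseteq> {clr x}"
        then have "Y \<noteq> []" "fst (hd Y) \<noteq> c" "alt Y"
          using As x by (auto simp: LX alt_append alt_Cons split: if_splits)
        then have "\<phi> (mon v * lprod Y) = 0"
          using v x by (intro phi_word_alt) auto
        then show "G (?w * (lprod X * mon u)) ?B * \<phi> (mon v * lprod Y) = 0" by simp
      qed
      ultimately show ?thesis
        unfolding dder_Leibniz[OF bl(3)] by simp
    qed
    \<comment> \<open>The partner lies in \<open>Bs ! l\<close> and opens the second circle there.
      The piece \<open>v\<close> behind the partner is split into its centered part, which yields an
      alternating product, and a scalar, after which \<open>phi_factor_left\<close> takes out \<phi>
      of \<open>u\<close> times \<open>w'\<close>.\<close>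
    have T3: "D x (\<lambda>U V. \<phi> (?w * lprod As * V * U)) ?B =
      (\<Sum>l<?q. ?e l * D x (\<lambda>U V. \<phi> (?w * U) * \<phi> V) (snd (Bs ! l)))"
    proof -
      have "lin (\<lambda>U. \<phi> (?w * lprod As * V * U))" "lin (\<lambda>V. \<phi> (?w * lprod As * V * U))" for U V
        using lin_mult_left[OF lin_phi, of "?w * lprod As * V"] lin_phi_mid[of "?w * lprod As" U]
        by (simp_all only: mult.assoc)
      then have bl': "bilin (\<lambda>U V. \<phi> (?w * lprod As * V * U))" by (intro bilinI)
      have "D x (\<lambda>U V. \<phi> (?w * lprod As * (V * lprod (drop (Suc l) Bs)) * (lprod (take l Bs) * U))) (snd (Bs ! l)) =
         ?e l * D x (\<lambda>U V. \<phi> (?w * U) * \<phi> V) (snd (Bs ! l))" if l: "l < ?q" for l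
      proof (cases "fst (Bs ! l) = c")
        case False
        then show ?thesis using D_other[OF E(5)[OF l]] x by simp
      next
        case True
        have "D x (\<lambda>U V. \<phi> (?w * lprod As * (V * lprod (drop (Suc l) Bs)) * (lprod (take l Bs) * U))) (snd (Bs ! l)) =
          D x (\<lambda>U V. ?e l * (\<phi> (?w * U) * \<phi> V)) (snd (Bs ! l))"
        proof (rule dder_cong[OF E(5)[OF l]])
          fix u v assume uv: "clr ` set u \<subseteq> {fst (Bs ! l)}" "clr ` set v \<subseteq> {fst (Bs ! l)}"
          let ?U = "mon u" and ?V = "mon v"
          let ?Vc = "?V - scalar (\<phi> ?V)"
          have in_c: "?U * ?w \<in> mono_in c" "?V \<in> mono_in c"
            using uv w' True by (auto intro!: mult_colp mon_colp)
          have "\<phi> (?w * lprod As * (?V * lprod (drop (Suc l) Bs)) * (lprod (take l Bs) * ?U)) =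
            \<phi> ((?U * ?w * lprod As) * (?V * lprod (?E l)))"
            using phi_trace[of "?w * lprod As * (?V * lprod (drop (Suc l) Bs)) * lprod (take l Bs)" ?U]
            by (simp add: mult.assoc)
          also have "\<dots> = \<phi> ((?U * ?w * lprod As) * (?Vc * lprod (?E l))) +
              \<phi> ?V * \<phi> ((?U * ?w * lprod As) * lprod (?E l))"
            using center_split[OF lin_phi_mid, of "?U * ?w * lprod As" ?V "lprod (?E l)"] by simp
          also have "\<phi> ((?U * ?w * lprod As) * (?Vc * lprod (?E l))) = 0"
          proof -
            have "alt (As @ (c, ?Vc) # ?E l)"
              using As E(1)[OF l] E(3)[OF l] center_colp[OF in_c(2)] phi_center[of ?V] True
              unfolding alt_append[of As] alt_Cons by auto
            then have "\<phi> ((?U * ?w) * lprod (As @ (c, ?Vc) # ?E l)) = 0"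
              using As in_c by (intro phi_left_alt) auto
            then show ?thesis by (simp add: mult.assoc)
          qed
          also have "\<phi> ((?U * ?w * lprod As) * lprod (?E l)) = \<phi> (?U * ?w) * ?e l"
            using phi_factor_left[OF As(1) E(1)[OF l] As(2) E(2)[OF l] As(3) E(4)[OF l, unfolded True] in_c(1)]
            by (simp only: mult.assoc)
          finally show "\<phi> (?w * lprod As * (?V * lprod (drop (Suc l) Bs)) * (lprod (take l Bs) * ?U)) =
            ?e l * (\<phi> (?w * ?U) * \<phi> ?V)"
            unfolding phi_trace[of ?w] by (simp only: add_0_left mult_ac)
        qed
        then show ?thesis by (simp only: dder_const_left)
      qed
      then show ?thesis unfolding dder_lprod[OF bl'] by (intro sum.cong refl) simp
    qed
    have "G (mon w * lprod As) ?B = D x (\<lambda>U V. \<phi> U * G V ?B) (?w * lprod As) +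
        D x (\<lambda>U V. G U ?B * \<phi> V) (?w * lprod As) + D x (\<lambda>U V. \<phi> (?w * lprod As * V * U)) ?B"
      unfolding Cons mon_Cons[of x w'] mult.assoc[of "mon [x]"] by (rule G_SD)
    also have "\<dots> = \<phi> (mon w) * G (lprod As) ?B + (\<Sum>l<?q. ?e l *
      (D x (\<lambda>U V. \<phi> U * \<phi> (V * snd (Bs ! l))) ?w + D x (\<lambda>U V. \<phi> (?w * U) * \<phi> V) (snd (Bs ! l))))"
      unfolding T1 T2 T3 by (simp only: add_0_right add.assoc sum.distrib[symmetric] distrib_left)
    \<comment> \<open>The two derivatives for each \<open>l\<close> are the two Leibniz terms of
      contracting \<open>x\<close> in the product of \<open>w'\<close> and
      \<open>Bs ! l\<close>.\<close>
    also have "\<dots> = \<phi> (mon w) * G (lprod As) ?B + (\<Sum>l<?q. \<phi> (mon w * snd (Bs ! l)) * ?e l)"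
      unfolding phi_w dder_Leibniz[OF bl(1)] by (simp only: mult.commute)
    finally show ?thesis .
  qed
qed

text \<open>\<open>A\<close> is centered, so the mean term of \<open>G_word\<close> drops out;
  linearity passes from words to \<open>snd A\<close>.\<close>

lemma G_alt:
  assumes As: "alt (A # As)" "As \<noteq> []" "fst (last As) \<noteq> fst A"
    and Bs: "alt Bs" "fst (last Bs) \<noteq> fst (hd Bs)"
  shows "G (lprod (A # As)) (lprod Bs) =
    (\<Sum>l<length Bs. \<phi> (snd A * snd (Bs ! l)) * \<phi> (lprod As * lprod (drop (Suc l) Bs @ take l Bs)))"
proof -
  have linG: "lin (\<lambda>Q. G Q R)" for R using bilin_bilext[of "gw b"] by (simp add: bilin_def)
  have "G (snd A * lprod As) (lprod Bs) = \<phi> (snd A) * G (lprod As) (lprod Bs) +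
    (\<Sum>l<length Bs. \<phi> (snd A * snd (Bs ! l)) * \<phi> (lprod As * lprod (drop (Suc l) Bs @ take l Bs)))"
  proof (rule colp_eqI[of "snd A" clr "fst A" "\<lambda>P. G (P * lprod As) (lprod Bs)" "\<lambda>P. \<phi> P * G (lprod As) (lprod Bs) +
    (\<Sum>l<length Bs. \<phi> (P * snd (Bs ! l)) * \<phi> (lprod As * lprod (drop (Suc l) Bs @ take l Bs)))"])
    show "lin (\<lambda>P. G (P * lprod As) (lprod Bs))" by (rule lin_mult_right[OF linG])
    show "lin (\<lambda>P. \<phi> P * G (lprod As) (lprod Bs) +
      (\<Sum>l<length Bs. \<phi> (P * snd (Bs ! l)) * \<phi> (lprod As * lprod (drop (Suc l) Bs @ take l Bs))))"
      by (intro lin_plusI lin_sumI lin_const_right lin_phi lin_mult_right[OF lin_phi])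
    have "alt As" "fst (hd As) \<noteq> fst A" using As by (auto simp: alt_Cons)
    from G_word[OF this(1) As(2) this(2) As(3) Bs]
    show "G (mon w * lprod As) (lprod Bs) = \<phi> (mon w) * G (lprod As) (lprod Bs) +
      (\<Sum>l<length Bs. \<phi> (mon w * snd (Bs ! l)) * \<phi> (lprod As * lprod (drop (Suc l) Bs @ take l Bs)))"
      if "clr ` set w \<subseteq> {fst A}" for w using that .
  qed (use As in \<open>simp add: alt_Cons\<close>)
  then show ?thesis using As by (simp add: alt_Cons)
qed

end

declare lcum.simps [simp del]

section \<open>Loop equations\<close>

text \<open>The word of the transposed product, when \<open>tr\<close> stands for transposition of
  letters.\<close>

definition wrev :: "('x \<Rightarrow> 'x) \<Rightarrow> 'x list \<Rightarrow> 'x list" where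
  "wrev tr u = rev (map tr u)"

lemma wrev_append: "wrev tr (u @ v) = wrev tr v @ wrev tr u"
  by (simp add: wrev_def)

text \<open>\<open>m\<close> models the expected product of the unnormalised traces of a list of
  words. Contracting the first letter inside its word splits the trace in two, contracting it with
  another word merges two traces; in the \<theta>-terms the pieces are joined after reversing one of
  them. The factor \<open>N\<close> comes from covariances of size 1/N.\<close>

definition loop_moments ::
  "nat \<Rightarrow> ('x \<Rightarrow> 'x \<Rightarrow> complex) \<Rightarrow> ('x \<Rightarrow> 'x) \<Rightarrow> complex \<Rightarrow> ('x list list \<Rightarrow> complex) \<Rightarrow> bool" where
  "loop_moments N b tr \<theta> m \<longleftrightarrow>
     m [] = 1 \<and> (\<forall>R. m ([] # R) = of_nat N * m R) \<and>
     (\<forall>x w R. of_nat N * m ((x # w) # R) =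
        (\<Sum>k<length w. b x (w ! k) * m (take k w # drop (Suc k) w # R) +
           \<theta> * b x (tr (w ! k)) * m ((take k w @ wrev tr (drop (Suc k) w)) # R)) +
        psum R (\<lambda>r R'. \<Sum>k<length r. b x (r ! k) * m ((w @ drop (Suc k) r @ take k r) # R') +
           \<theta> * b x (tr (r ! k)) * m ((w @ wrev tr (drop (Suc k) r @ take k r)) # R')))"

lemma psum_mult_right: "psum R f * a = psum R (\<lambda>r R'. f r R' * a)"
  by (simp add: psum_def sum_distrib_right)

lemma ssum_linear:
  "ssum R (\<lambda>E C. (\<Sum>k<n. a k * P k E + a' k * Q k E) * m C) =
    (\<Sum>k<n. a k * ssum R (\<lambda>E C. P k E * m C) + a' k * ssum R (\<lambda>E C. Q k E * m C))"
  by (simp only: sum_distrib_right distrib_right mult.assoc ssum_sum ssum_add ssum_const_left)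

lemma psum_cong:
  "(\<And>r R'. r \<in> set R \<Longrightarrow> length R = Suc (length R') \<Longrightarrow> f r R' = g r R') \<Longrightarrow> psum R f = psum R g"
  unfolding psum_def by (intro sum.cong refl) auto

lemma ssum_empty_left: "ssum R (\<lambda>B C. (if B = [] then a else 0) * f C) = a * f R"
proof (induction R arbitrary: f)
  case (Cons r R)
  have "ssum R (\<lambda>B C. (if r # B = [] then a else 0) * f C) = 0"
    using ssum_const_left[of R 0 "\<lambda>B C. f C"] by simp
  then show ?case using Cons.IH[of "\<lambda>C. f (r # C)"] by (simp add: ssum_Cons)
qed simp

lemma ssum_mult_right: "ssum R f * a = ssum R (\<lambda>B C. f B C * a)"
  using ssum_const_left[of R a f] by (simp add: mult.commute)

text \<open>The trace of the empty word is the constant N, and a constant has no cumulants beyond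
  the first.\<close>

lemma lcum_Nil_Cons:
  assumes "loop_moments N b tr \<theta> m"
  shows "lcum m ([] # R) = (if R = [] then of_nat N else 0)"
proof (rule lcum_unique[of m R "\<lambda>R. m ([] # R)" "\<lambda>R. lcum m ([] # R)" "\<lambda>R. if R = [] then of_nat N else 0"])
  show "m [] = 1" using assms by (simp add: loop_moments_def)
  show "m ([] # ys) = ssum ys (\<lambda>B C. lcum m ([] # B) * m C)" for ys
    using lcum_eq[of m "[]" ys] \<open>m [] = 1\<close> by simp
  show "m ([] # ys) = ssum ys (\<lambda>B C. (if B = [] then of_nat N else 0) * m C)" for ys
    using assms by (simp add: ssum_empty_left loop_moments_def)
qed

text \<open>Both sides, summed against \<open>m\<close> over the splittings of \<open>R\<close>,
  give the moment equation, so \<open>lcum_unique\<close> applies. Splitting the first trace is the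
  source of the nonlinear term: the two new traces lie in one cumulant, or in two between which the
  other words are distributed.\<close>

lemma lcum_loop:
  assumes loop: "loop_moments N b tr \<theta> m" and N: "N > 0"
  defines "c \<equiv> lcum m"
  shows "of_nat N * c ((x # w) # R) =
    (\<Sum>k<length w. b x (w ! k) * (c (take k w # drop (Suc k) w # R) +
        ssum R (\<lambda>B C. c (take k w # B) * c (drop (Suc k) w # C))) +
      \<theta> * b x (tr (w ! k)) * c ((take k w @ wrev tr (drop (Suc k) w)) # R)) +
    psum R (\<lambda>r R'. \<Sum>k<length r. b x (r ! k) * c ((w @ drop (Suc k) r @ take k r) # R') +
      \<theta> * b x (tr (r ! k)) * c ((w @ wrev tr (drop (Suc k) r @ take k r)) # R'))"
    (is "_ = ?F R")
proof (rule lcum_unique[of m R "\<lambda>R. of_nat N * m ((x # w) # R)" "\<lambda>R. of_nat N * c ((x # w) # R)" ?F])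
  show m0: "m [] = 1" using loop by (simp add: loop_moments_def)
  have m1: "m (w # R) = ssum R (\<lambda>B C. c (w # B) * m C)" for w R
    using lcum_eq[of m w R] m0 by (simp add: c_def)
  show "of_nat N * m ((x # w) # R) = ssum R (\<lambda>B C. of_nat N * c ((x # w) # B) * m C)" for R
    unfolding m1 by (simp add: ssum_const_left mult.assoc)
  \<comment> \<open>The second word shares the block of the first or starts the next block to be
    split off; \<open>ssum_assoc\<close> collects the words of both blocks in
    \<open>E\<close>.\<close>
  have m2: "m (u # v # R) = ssum R (\<lambda>E C. (c (u # v # E) + ssum E (\<lambda>B B'. c (u # B) * c (v # B'))) * m C)" for u v R
  proof -
    have "m (u # v # R) = ssum R (\<lambda>B C. c (u # v # B) * m C) + ssum R (\<lambda>B C. c (u # B) * m (v # C))"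
      unfolding m1[of u "v # R"] by (simp add: ssum_Cons)
    also have "ssum R (\<lambda>B C. c (u # B) * m (v # C)) = ssum R (\<lambda>B C. ssum C (\<lambda>B' C'. c (u # B) * c (v # B') * m C'))"
      unfolding m1[of v] by (simp add: ssum_const_left mult.assoc)
    also have "\<dots> = ssum R (\<lambda>E C. ssum E (\<lambda>B B'. c (u # B) * c (v # B')) * m C)"
      by (simp add: ssum_assoc[of R "\<lambda>B B' C'. c (u # B) * c (v # B') * m C'"] ssum_mult_right)
    finally show ?thesis by (simp add: ssum_add distrib_right)
  qed
  show "of_nat N * m ((x # w) # R) = ssum R (\<lambda>B C. ?F B * m C)" for R
  proof -
    have "psum R (\<lambda>r R'. \<Sum>k<length r. b x (r ! k) * m ((w @ drop (Suc k) r @ take k r) # R') +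
      \<theta> * b x (tr (r ! k)) * m ((w @ wrev tr (drop (Suc k) r @ take k r)) # R')) =
      psum R (\<lambda>r R'. ssum R' (\<lambda>B C. (\<Sum>k<length r. b x (r ! k) * c ((w @ drop (Suc k) r @ take k r) # B) +
      \<theta> * b x (tr (r ! k)) * c ((w @ wrev tr (drop (Suc k) r @ take k r)) # B)) * m C))"
      unfolding ssum_linear m1 ..
    also have "\<dots> = ssum R (\<lambda>E C. psum E (\<lambda>r B. (\<Sum>k<length r. b x (r ! k) * c ((w @ drop (Suc k) r @ take k r) # B) +
      \<theta> * b x (tr (r ! k)) * c ((w @ wrev tr (drop (Suc k) r @ take k r)) # B)) * m C))"
      by (rule psum_ssum)
    also have "\<dots> = ssum R (\<lambda>E C. psum E (\<lambda>r B. (\<Sum>k<length r. b x (r ! k) * c ((w @ drop (Suc k) r @ take k r) # B) +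
      \<theta> * b x (tr (r ! k)) * c ((w @ wrev tr (drop (Suc k) r @ take k r)) # B))) * m C)"
      by (simp only: psum_mult_right)
    finally have P: "psum R (\<lambda>r R'. \<Sum>k<length r. b x (r ! k) * m ((w @ drop (Suc k) r @ take k r) # R') +
      \<theta> * b x (tr (r ! k)) * m ((w @ wrev tr (drop (Suc k) r @ take k r)) # R')) = \<dots>" .
    have S: "(\<Sum>k<length w. b x (w ! k) * m (take k w # drop (Suc k) w # R) +
           \<theta> * b x (tr (w ! k)) * m ((take k w @ wrev tr (drop (Suc k) w)) # R)) =
      ssum R (\<lambda>E C. (\<Sum>k<length w. b x (w ! k) * (c (take k w # drop (Suc k) w # E) +
        ssum E (\<lambda>B C. c (take k w # B) * c (drop (Suc k) w # C))) +
      \<theta> * b x (tr (w ! k)) * c ((take k w @ wrev tr (drop (Suc k) w)) # E)) * m C)"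
      unfolding ssum_linear m2 unfolding m1 ..
    show ?thesis
      using loop unfolding loop_moments_def
      by (simp only: P S ssum_add distrib_right)
  qed
qed

text \<open>The \<theta>-part counts the annular pairings in which the second circle is traversed in
  the opposite direction.\<close>

definition lim2 :: "('x \<Rightarrow> 'x \<Rightarrow> complex) \<Rightarrow> ('x \<Rightarrow> 'x) \<Rightarrow> complex \<Rightarrow> 'x list \<Rightarrow> 'x list \<Rightarrow> complex" where
  "lim2 b tr \<theta> u v = gw b u v + \<theta> * gw b u (wrev tr v)"

text \<open>For a single word this is the limit of the cumulant divided by N.\<close>

definition cum_limit :: "('x \<Rightarrow> 'x \<Rightarrow> complex) \<Rightarrow> ('x \<Rightarrow> 'x) \<Rightarrow> complex \<Rightarrow> 'x list list \<Rightarrow> complex" where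
  "cum_limit b tr \<theta> Ws = (case Ws of [w] \<Rightarrow> phiw b w | [u, v] \<Rightarrow> lim2 b tr \<theta> u v | _ \<Rightarrow> 0)"

lemma lim2_Cons:
  "lim2 b tr \<theta> (x # w) v =
     (\<Sum>k<length w. b x (w ! k) * (phiw b (take k w) * lim2 b tr \<theta> (drop (Suc k) w) v +
        lim2 b tr \<theta> (take k w) v * phiw b (drop (Suc k) w))) +
     (\<Sum>k<length v. b x (v ! k) * phiw b (w @ drop (Suc k) v @ take k v) +
        \<theta> * b x (tr (v ! k)) * phiw b (w @ wrev tr (drop (Suc k) v @ take k v)))"
proof -
  let ?n = "length v" and ?v = "wrev tr v"
  have len: "length ?v = ?n" by (simp add: wrev_def)
  have "(\<Sum>k<?n. b x (?v ! k) * phiw b (w @ drop (Suc k) ?v @ take k ?v)) =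
    (\<Sum>k<?n. b x (tr (v ! k)) * phiw b (w @ wrev tr (drop (Suc k) v @ take k v)))"
  \<comment> \<open>Position \<open>k\<close> of the transposed word is position
    \<open>?n - Suc k\<close> of \<open>v\<close>, and the cyclic remainder is transposed as a
    whole.\<close>
  proof (rule sum.reindex_bij_witness[of _ "\<lambda>k. ?n - Suc k" "\<lambda>k. ?n - Suc k"])
    fix k assume "k \<in> {..<?n}"
    then have k: "k < ?n" by simp
    have "?v ! k = tr (v ! (?n - Suc k))" using k by (simp add: wrev_def rev_nth)
    moreover have "drop (Suc k) ?v = wrev tr (take (?n - Suc k) v)" "take k ?v = wrev tr (drop (Suc (?n - Suc k)) v)"
      using k by (simp_all add: wrev_def drop_rev take_rev take_map drop_map Suc_diff_Suc)
    ultimately show "b x (tr (v ! (?n - Suc k))) * phiw b (w @ wrev tr (drop (Suc (?n - Suc k)) v @ take (?n - Suc k) v)) =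
      b x (?v ! k) * phiw b (w @ drop (Suc k) ?v @ take k ?v)"
      by (simp add: wrev_append)
  qed auto
  then show ?thesis
    by (simp add: lim2_def len sum_distrib_left sum.distrib algebra_simps)
qed

lemma tendsto_ssum:
  assumes "\<And>B C. length B + length C = length R \<Longrightarrow> mset B + mset C = mset R \<Longrightarrow> ((\<lambda>n. f n B C) \<longlongrightarrow> g B C) F"
  shows "((\<lambda>n. ssum R (f n)) \<longlongrightarrow> ssum R g) F"
  using assms
  by (induction R arbitrary: f g) (auto simp: ssum_Cons intro!: tendsto_add)

definition wlen :: "'x list list \<Rightarrow> nat" where
  "wlen Ws = sum_list (map length Ws)"

lemma wlen_simps [simp]: "wlen [] = 0" "wlen (w # Ws) = length w + wlen Ws"
  by (simp_all add: wlen_def)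

lemma wlen_mset: "mset B + mset C = mset R \<Longrightarrow> wlen R = wlen B + wlen C"
  by (metis mset_append mset_map sum_mset_sum_list wlen_def sum_list_append map_append)

lemma length_wrev [simp]: "length (wrev tr u) = length u"
  by (simp add: wrev_def)

text \<open>Divide \<open>lcum_loop\<close> by N, and once more if \<open>R\<close> is empty. By
  induction first cumulants have order N and higher ones are bounded. So the joint cumulant of the
  two split traces and the reversal inside the first word vanish in the limit, the product term
  survives only if one factor is a first cumulant, and merging survives only if no other word is
  left over.\<close>

lemma cumulant_limits:
  assumes loop: "\<And>N. N > 0 \<Longrightarrow> loop_moments N b tr \<theta> (m N)"
    and "Ws \<noteq> []"
  shows "(\<lambda>N. lcum (m N) Ws / (if length Ws = 1 then of_nat N else 1)) \<longlonglongrightarrow> cum_limit b tr \<theta> Ws"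
  using \<open>Ws \<noteq> []\<close>
proof (induction "wlen Ws" arbitrary: Ws rule: less_induct)
  case less
  let ?L = "cum_limit b tr \<theta>"
  let ?s = "\<lambda>N Ws. if length Ws = 1 then of_nat N else 1 :: complex"
  let ?d = "\<lambda>N Ws. lcum (m N) Ws / ?s N Ws"
  have inv: "(\<lambda>N. 1 / of_nat N :: complex) \<longlonglongrightarrow> 0" by (rule lim_1_over_n)
  have pos: "eventually (\<lambda>N. N > 0) sequentially" by (rule eventually_gt_at_top)
  obtain W R where Ws: "Ws = W # R" using less.prems by (cases Ws) auto
  show ?case
  proof (cases W)
    case Nil
    have "eventually (\<lambda>N. ?L Ws = ?d N Ws) sequentially"
      using pos
    proof eventually_elim
      case (elim N)
      show ?case
        using lcum_Nil_Cons[OF loop[OF elim], of R] elim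
        by (auto simp: Ws Nil cum_limit_def lim2_def split: list.split)
    qed
    then show ?thesis by (rule tendsto_eventually[OF eventually_mono]) simp
  next
    case (Cons x w)
    let ?bt = "\<lambda>y. \<theta> * b x (tr y)"
    let ?U = "\<lambda>k. take k w" and ?V = "\<lambda>k. drop (Suc k) w"
    let ?X = "\<lambda>r k. w @ drop (Suc k) r @ take k r"
    let ?Y = "\<lambda>r k. w @ wrev tr (drop (Suc k) r @ take k r)"
    \<comment> \<open>A product of two cumulants of order at least 2 is bounded and is lost after
      division by N.\<close>
    let ?g = "\<lambda>u v B C. if B = [] \<or> C = [] then ?L (u # B) * ?L (v # C) else 0"
    let ?f = "\<lambda>N. (\<Sum>k<length w. b x (w ! k) * (lcum (m N) (?U k # ?V k # R) / (of_nat N * ?s N Ws) +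
        ssum R (\<lambda>B C. lcum (m N) (?U k # B) * lcum (m N) (?V k # C) / (of_nat N * ?s N Ws))) +
      ?bt (w ! k) * (lcum (m N) ((?U k @ wrev tr (?V k)) # R) / (of_nat N * ?s N Ws))) +
      psum R (\<lambda>r R'. \<Sum>k<length r. b x (r ! k) * (lcum (m N) (?X r k # R') / (of_nat N * ?s N Ws)) +
        ?bt (r ! k) * (lcum (m N) (?Y r k # R') / (of_nat N * ?s N Ws)))"
    let ?l = "(\<Sum>k<length w. b x (w ! k) * (0 + ssum R (?g (?U k) (?V k))) + ?bt (w ! k) * 0) +
      psum R (\<lambda>r R'. \<Sum>k<length r. b x (r ! k) * (if R' = [] then ?L [?X r k] else 0) +
        ?bt (r ! k) * (if R' = [] then ?L [?Y r k] else 0))"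
    have IH: "(\<lambda>N. ?d N Ws') \<longlonglongrightarrow> ?L Ws'" if "wlen Ws' < wlen Ws" "Ws' \<noteq> []" for Ws'
      using less.hyps that by blast
    have IH0: "(\<lambda>N. lcum (m N) Ws' / of_nat N) \<longlonglongrightarrow> (if length Ws' = 1 then ?L Ws' else 0)"
      if "wlen Ws' < wlen Ws" "Ws' \<noteq> []" for Ws'
      using IH[OF that] tendsto_mult[OF IH[OF that] inv] by (cases "length Ws' = 1") simp_all
    \<comment> \<open>If \<open>R\<close> is empty, the divisor is N^2 against a cumulant of order
      at most N; otherwise \<open>Ws'\<close> has at least two words and its bounded cumulant is
      divided by N.\<close>
    have IH1: "(\<lambda>N. lcum (m N) Ws' / (of_nat N * ?s N Ws)) \<longlonglongrightarrow> 0"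
      if "wlen Ws' < wlen Ws" "length Ws' \<ge> length Ws" "R = [] \<Longrightarrow> length Ws' = 1 \<or> length Ws' = 2" for Ws'
    proof (cases "R = []")
      case True
      have "Ws' \<noteq> []" using that(3)[OF True] by auto
      then show ?thesis
        using that(3)[OF True] tendsto_mult[OF IH0[OF that(1)] inv] by (auto simp: Ws True)
    next
      case False
      then have "length Ws' \<noteq> 1" "length Ws \<noteq> 1" "Ws' \<noteq> []" using that(2) by (auto simp: Ws Suc_le_eq)
      then show ?thesis using IH0[OF that(1)] by simp
    qed
    have "eventually (\<lambda>N. ?f N = ?d N Ws) sequentially"
      using pos
    proof eventually_elim
      case (elim N)
      have "lcum (m N) Ws = (of_nat N * lcum (m N) ((x # w) # R)) / of_nat N"
        using elim by (simp add: Ws Cons)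
      then have "?d N Ws = (1 / (of_nat N * ?s N Ws)) * (of_nat N * lcum (m N) ((x # w) # R))"
        by simp
      also have "\<dots> = ?f N"
        unfolding lcum_loop[OF loop[OF elim] elim] distrib_left sum_distrib_left
          psum_const_left[symmetric] ssum_const_left[symmetric]
        by (simp add: mult_ac)
      finally show ?case ..
    qed
    moreover have "?f \<longlonglongrightarrow> ?l"
    proof (intro tendsto_add tendsto_sum tendsto_mult tendsto_const)
      fix k assume "k \<in> {..<length w}"
      then have k: "k < length w" by simp
      show "(\<lambda>N. lcum (m N) (?U k # ?V k # R) / (of_nat N * ?s N Ws)) \<longlonglongrightarrow> 0"
        using k by (intro IH1) (auto simp: Ws Cons)
      show "(\<lambda>N. lcum (m N) ((?U k @ wrev tr (?V k)) # R) / (of_nat N * ?s N Ws)) \<longlonglongrightarrow> 0"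
        using k by (intro IH1) (auto simp: Ws Cons)
      show "(\<lambda>N. ssum R (\<lambda>B C. lcum (m N) (?U k # B) * lcum (m N) (?V k # C) / (of_nat N * ?s N Ws)))
        \<longlonglongrightarrow> ssum R (?g (?U k) (?V k))"
      proof (rule tendsto_ssum)
        fix B C assume l: "length B + length C = length R" and BC: "mset B + mset C = mset R"
        have IHB: "(\<lambda>N. ?d N (?U k # B)) \<longlonglongrightarrow> ?L (?U k # B)" and IHC: "(\<lambda>N. ?d N (?V k # C)) \<longlonglongrightarrow> ?L (?V k # C)"
          using k wlen_mset[OF BC] IH[of "?U k # B"] IH[of "?V k # C"] by (auto simp: Ws Cons)
        have R: "R = [] \<longleftrightarrow> B = [] \<and> C = []" using l by auto
        \<comment> \<open>If \<open>R\<close> is empty, both factors have order N and match the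
          divisor N^2; otherwise at most one factor has order N and the divisor is N.\<close>
        show "(\<lambda>N. lcum (m N) (?U k # B) * lcum (m N) (?V k # C) / (of_nat N * ?s N Ws)) \<longlonglongrightarrow> ?g (?U k) (?V k) B C"
          using l tendsto_mult[OF IHB IHC] tendsto_mult[OF tendsto_mult[OF IHB IHC] inv]
          by (cases "B = []"; cases "C = []") (simp_all add: Ws R mult_ac)
      qed
    next
      show "(\<lambda>N. psum R (\<lambda>r R'. \<Sum>k<length r. b x (r ! k) * (lcum (m N) (?X r k # R') / (of_nat N * ?s N Ws)) +
        ?bt (r ! k) * (lcum (m N) (?Y r k # R') / (of_nat N * ?s N Ws)))) \<longlonglongrightarrow>
        psum R (\<lambda>r R'. \<Sum>k<length r. b x (r ! k) * (if R' = [] then ?L [?X r k] else 0) +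
        ?bt (r ! k) * (if R' = [] then ?L [?Y r k] else 0))"
        unfolding psum_def
      proof (intro tendsto_add tendsto_sum tendsto_mult tendsto_const)
        fix j k assume "j \<in> {..<length R}" and "k \<in> {..<length (R ! j)}"
        then have j: "j < length R" and k: "k < length (R ! j)" by auto
        let ?R = "take j R @ drop (Suc j) R"
        have "wlen R = length (R ! j) + wlen ?R"
          by (subst (1) id_take_nth_drop[OF j]) (simp add: wlen_def)
        then have len: "wlen (?X (R ! j) k # ?R) < wlen Ws" "wlen (?Y (R ! j) k # ?R) < wlen Ws"
          using k by (auto simp: Ws Cons)
        have Rne: "R \<noteq> []" using j by auto
        define Q where "Q = ?R"
        show "(\<lambda>N. lcum (m N) (?X (R ! j) k # ?R) / (of_nat N * ?s N Ws)) \<longlonglongrightarrow> (if ?R = [] then ?L [?X (R ! j) k] else 0)"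
          using IH0[OF len(1)] Rne unfolding Q_def[symmetric] by (cases "Q = []") (simp_all add: Ws)
        show "(\<lambda>N. lcum (m N) (?Y (R ! j) k # ?R) / (of_nat N * ?s N Ws)) \<longlonglongrightarrow> (if ?R = [] then ?L [?Y (R ! j) k] else 0)"
          using IH0[OF len(2)] Rne unfolding Q_def[symmetric] by (cases "Q = []") (simp_all add: Ws)
      qed
    qed
    moreover have "?l = ?L Ws"
    proof -
      consider "R = []" | v where "R = [v]" | v v' R' where "R = v # v' # R'"
        by (metis list.exhaust)
      then show ?thesis
      proof cases
        case 1
        then show ?thesis by (simp add: Ws Cons cum_limit_def)
      next
        case (2 v)
        then show ?thesis
          by (simp add: Ws Cons cum_limit_def lim2_Cons ssum_Cons psum_Cons add.commute)
      next
        case (3 v v' R')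
        have "ssum R (?g u v) = ssum R (\<lambda>B C. 0 * 0)" for u v
        proof (rule ssum_cong)
          fix B C assume "mset B + mset C = mset R"
          from arg_cong[OF this, of size] show "?g u v B C = 0 * 0"
            by (auto simp: 3 cum_limit_def split: list.split)
        qed
        then have "ssum R (?g u v) = 0" for u v
          using ssum_const_left[of R 0 "\<lambda>_ _. 0"] by simp
        moreover have "psum R (\<lambda>r R'. \<Sum>k<length r. b x (r ! k) * (if R' = [] then ?L [?X r k] else 0) +
          ?bt (r ! k) * (if R' = [] then ?L [?Y r k] else 0)) = psum R (\<lambda>_ _. 0 * 0)"
        proof (rule psum_cong)
          fix r Q assume "length R = Suc (length Q)"
          then have "Q \<noteq> []" by (auto simp: 3)
          then show "(\<Sum>k<length r. b x (r ! k) * (if Q = [] then ?L [?X r k] else 0) +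
            ?bt (r ! k) * (if Q = [] then ?L [?Y r k] else 0)) = 0 * 0" by simp
        qed
        ultimately show ?thesis by (simp add: Ws 3 cum_limit_def) (simp add: psum_def)
      qed
    qed
    ultimately have "?f \<longlonglongrightarrow> ?L Ws" and "eventually (\<lambda>N. ?f N = ?d N Ws) sequentially"
      by (simp_all only:)
    then show ?thesis by (rule Lim_transform_eventually)
  qed
qed

section \<open>Loop equations of Gaussian matrices\<close>

lemma sum_of_bool_left: "finite A \<Longrightarrow> j \<in> A \<Longrightarrow> (\<Sum>i\<in>A. of_bool (j = i) * f i) = (f j :: complex)"
  and sum_of_bool_right: "finite A \<Longrightarrow> j \<in> A \<Longrightarrow> (\<Sum>i\<in>A. f i * of_bool (i = j)) = (f j :: complex)"
  by (simp_all add: of_bool_def if_distrib[of "\<lambda>x. _ * x"] if_distrib[of "\<lambda>x. x * _"] cong: if_cong)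

fun ent :: "('x \<Rightarrow> nat \<Rightarrow> nat \<Rightarrow> complex) \<Rightarrow> nat \<Rightarrow> 'x list \<Rightarrow> nat \<Rightarrow> nat \<Rightarrow> complex" where
  "ent e N [] i j = of_bool (i = j)"
| "ent e N (x # u) i j = (\<Sum>k<N. e x i k * ent e N u k j)"

definition word_trace :: "('x \<Rightarrow> nat \<Rightarrow> nat \<Rightarrow> complex) \<Rightarrow> nat \<Rightarrow> 'x list \<Rightarrow> complex" where
  "word_trace e N u = (\<Sum>i<N. ent e N u i i)"

lemma ent_append:
  "i < N \<Longrightarrow> ent e N (u @ v) i j = (\<Sum>k<N. ent e N u i k * ent e N v k j)"
proof (induction u arbitrary: i)
  case Nil
  then show ?case by (simp add: sum_of_bool_left)
next
  case (Cons x u)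
  have "ent e N ((x # u) @ v) i j = (\<Sum>k<N. \<Sum>l<N. e x i k * (ent e N u k l * ent e N v l j))"
    using Cons.IH by (simp add: sum_distrib_left)
  also have "\<dots> = (\<Sum>l<N. \<Sum>k<N. e x i k * (ent e N u k l * ent e N v l j))"
    by (rule sum.swap)
  finally show ?case by (simp add: sum_distrib_right mult.assoc)
qed

lemma word_trace_append: "word_trace e N (u @ v) = (\<Sum>i<N. \<Sum>j<N. ent e N u i j * ent e N v j i)"
  unfolding word_trace_def by (intro sum.cong refl ent_append) simp

lemma word_trace_commute: "word_trace e N (u @ v) = word_trace e N (v @ u)"
  unfolding word_trace_append by (subst sum.swap) (simp add: mult.commute)

lemma ent_wrev:
  assumes "\<And>x i j. i < N \<Longrightarrow> j < N \<Longrightarrow> e (tr x) i j = e x j i"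
  shows "i < N \<Longrightarrow> j < N \<Longrightarrow> ent e N (wrev tr u) i j = ent e N u j i"
proof (induction u arbitrary: i j)
  case (Cons x u)
  have "ent e N (wrev tr (x # u)) i j = (\<Sum>k<N. ent e N (wrev tr u) i k * ent e N [tr x] k j)"
    using ent_append[OF Cons.prems(1), of e "wrev tr u" "[tr x]" j] by (simp add: wrev_def)
  also have "\<dots> = (\<Sum>k<N. ent e N u k i * e x j k)"
    using Cons assms by (intro sum.cong refl) (simp add: sum_of_bool_right)
  finally show ?case by (simp add: mult.commute)
qed (auto simp: wrev_def)

text \<open>Entries are already scaled. The first term of \<open>e_cov\<close> is the contraction
  that respects orientation, the second, weighted by \<open>\<theta>\<close>, the one that reverses
  it; when reversal occurs, \<open>e_tr\<close> makes \<open>tr\<close> the transposition of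
  matrices.\<close>

locale gauss_matrix = gauss_space M H for M :: "'w measure" and H +
  fixes N :: nat and e :: "'x \<Rightarrow> nat \<Rightarrow> nat \<Rightarrow> 'w \<Rightarrow> complex"
    and b :: "'x \<Rightarrow> 'x \<Rightarrow> complex" and tr :: "'x \<Rightarrow> 'x" and \<theta> :: complex
  assumes N: "N > 0"
    and e_gauss: "i < N \<Longrightarrow> j < N \<Longrightarrow> cgauss (e x i j)"
    and e_cov: "i < N \<Longrightarrow> j < N \<Longrightarrow> k < N \<Longrightarrow> l < N \<Longrightarrow>
      expectation (\<lambda>w. e x i j w * e y k l w) =
      (b x y * of_bool (i = l \<and> j = k) + \<theta> * b x (tr y) * of_bool (i = k \<and> j = l)) / of_nat N"
    and e_tr: "\<theta> \<noteq> 0 \<Longrightarrow> i < N \<Longrightarrow> j < N \<Longrightarrow> e (tr x) i j w = e x j i w"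
begin

abbreviation "E w \<equiv> (\<lambda>x i j. e x i j w)"
abbreviation "en u i j w \<equiv> ent (E w) N u i j"
abbreviation "tra u w \<equiv> word_trace (E w) N u"

text \<open>Each letter in turn is replaced by its covariance with \<open>e x p q\<close>: by
  \<open>e_cov\<close> this is, up to weight, the matrix unit with row q and column p, and for the
  \<theta>-term the one with row p and column q.\<close>

lemma stein_ent:
  assumes pq: "p < N" "q < N" and ij: "i < N" "j < N"
  shows "stein (e x p q) (en u i j) (\<lambda>w. (\<Sum>k<length u.
      b x (u ! k) * (en (take k u) i q w * en (drop (Suc k) u) p j w) +
      \<theta> * b x (tr (u ! k)) * (en (take k u) i p w * en (drop (Suc k) u) q j w)) / of_nat N)"
  using ij(1)
proof (induction u arbitrary: i)
  case Nil
  then show ?case using stein_const by simp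
next
  case (Cons y u)
  let ?C = "\<lambda>l. (b x y * of_bool (p = l \<and> q = i) + \<theta> * b x (tr y) * of_bool (p = i \<and> q = l)) / of_nat N"
  let ?d = "\<lambda>l w. (\<Sum>k<length u.
      b x (u ! k) * (en (take k u) l q w * en (drop (Suc k) u) p j w) +
      \<theta> * b x (tr (u ! k)) * (en (take k u) l p w * en (drop (Suc k) u) q j w)) / of_nat N"
  have "stein (e x p q) (\<lambda>w. \<Sum>l<N. e y i l w * en u l j w) (\<lambda>w. \<Sum>l<N. ?C l * en u l j w + e y i l w * ?d l w)"
  proof (intro stein_sum stein_mult)
    fix l assume "l \<in> {..<N}"
    then have l: "l < N" by simp
    show "stein (e x p q) (e y i l) (\<lambda>_. ?C l)"
      using stein_gauss[OF e_gauss[OF pq, of x] e_gauss[OF Cons.prems l, of y]] e_cov[OF pq Cons.prems l, of x y] by simp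
    show "stein (e x p q) (en u l j) (?d l)"
      by (rule Cons.IH[OF l])
  qed
  moreover have "(\<Sum>l<N. ?C l * en u l j w + e y i l w * ?d l w) = (\<Sum>k<length (y # u).
      b x ((y # u) ! k) * (en (take k (y # u)) i q w * en (drop (Suc k) (y # u)) p j w) +
      \<theta> * b x (tr ((y # u) ! k)) * (en (take k (y # u)) i p w * en (drop (Suc k) (y # u)) q j w)) / of_nat N" for w
  proof -
    have "(\<Sum>l<N. ?C l * en u l j w) = (b x y * (\<Sum>l<N. of_bool (p = l \<and> q = i) * en u l j w) +
      \<theta> * b x (tr y) * (\<Sum>l<N. of_bool (p = i \<and> q = l) * en u l j w)) / of_nat N"
      unfolding sum_distrib_left add_divide_distrib sum_divide_distrib sum.distrib[symmetric]
      by (intro sum.cong refl) (simp add: field_simps)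
    also have "(\<Sum>l<N. of_bool (p = l \<and> q = i) * en u l j w) = of_bool (i = q) * en u p j w"
    proof -
      have "(\<Sum>l<N. of_bool (p = l \<and> q = i) * en u l j w) = (\<Sum>l<N. of_bool (p = l) * (of_bool (i = q) * en u l j w))"
        by (intro sum.cong refl) auto
      also have "\<dots> = of_bool (i = q) * en u p j w"
        using pq by (intro sum_of_bool_left) auto
      finally show ?thesis .
    qed
    also have "(\<Sum>l<N. of_bool (p = i \<and> q = l) * en u l j w) = of_bool (i = p) * en u q j w"
    proof -
      have "(\<Sum>l<N. of_bool (p = i \<and> q = l) * en u l j w) = (\<Sum>l<N. of_bool (q = l) * (of_bool (i = p) * en u l j w))"
        by (intro sum.cong refl) auto
      also have "\<dots> = of_bool (i = p) * en u q j w"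
        using pq by (intro sum_of_bool_left) auto
      finally show ?thesis .
    qed
    finally have 1: "(\<Sum>l<N. ?C l * en u l j w) =
      (b x y * (of_bool (i = q) * en u p j w) + \<theta> * b x (tr y) * (of_bool (i = p) * en u q j w)) / of_nat N" .
    have "(\<Sum>l<N. e y i l w * ?d l w) = (\<Sum>k<length u.
      b x (u ! k) * ((\<Sum>l<N. e y i l w * en (take k u) l q w) * en (drop (Suc k) u) p j w) +
      \<theta> * b x (tr (u ! k)) * ((\<Sum>l<N. e y i l w * en (take k u) l p w) * en (drop (Suc k) u) q j w)) / of_nat N"
    proof -
      have "(\<Sum>l<N. e y i l w * ?d l w) = (\<Sum>l<N. \<Sum>k<length u. (e y i l w * (
        b x (u ! k) * (en (take k u) l q w * en (drop (Suc k) u) p j w) +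
        \<theta> * b x (tr (u ! k)) * (en (take k u) l p w * en (drop (Suc k) u) q j w)))) / of_nat N"
        by (simp only: times_divide_eq_right sum_distrib_left sum_divide_distrib)
      also have "\<dots> = (\<Sum>k<length u. \<Sum>l<N. (e y i l w * (
        b x (u ! k) * (en (take k u) l q w * en (drop (Suc k) u) p j w) +
        \<theta> * b x (tr (u ! k)) * (en (take k u) l p w * en (drop (Suc k) u) q j w)))) / of_nat N"
        by (subst sum.swap) (rule refl)
      also have "\<dots> = (\<Sum>k<length u.
        b x (u ! k) * ((\<Sum>l<N. e y i l w * en (take k u) l q w) * en (drop (Suc k) u) p j w) +
        \<theta> * b x (tr (u ! k)) * ((\<Sum>l<N. e y i l w * en (take k u) l p w) * en (drop (Suc k) u) q j w)) / of_nat N"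
        unfolding sum_distrib_left sum_distrib_right sum.distrib[symmetric]
        by (intro arg_cong2[of _ _ _ _ "(/)"] sum.cong refl) (simp add: algebra_simps)
      finally show ?thesis .
    qed
    then show ?thesis
      unfolding sum.distrib 1 length_Cons sum.lessThan_Suc_shift by (simp add: add_divide_distrib)
  qed
  ultimately show ?case by (simp only: ent.simps)
qed

text \<open>The derivative of a trace: summing over the diagonal index joins the two pieces beside
  the removed letter in cyclic order.\<close>

definition dtr :: "'x \<Rightarrow> nat \<Rightarrow> nat \<Rightarrow> 'x list \<Rightarrow> 'w \<Rightarrow> complex" where
  "dtr x p q u w = (\<Sum>k<length u. b x (u ! k) * en (drop (Suc k) u @ take k u) p q w +
     \<theta> * b x (tr (u ! k)) * en (drop (Suc k) u @ take k u) q p w) / of_nat N"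

lemma stein_trace:
  assumes pq: "p < N" "q < N"
  shows "stein (e x p q) (tra u) (dtr x p q u)"
proof -
  have "stein (e x p q) (tra u) (\<lambda>w. \<Sum>i<N. (\<Sum>k<length u.
      b x (u ! k) * (en (take k u) i q w * en (drop (Suc k) u) p i w) +
      \<theta> * b x (tr (u ! k)) * (en (take k u) i p w * en (drop (Suc k) u) q i w)) / of_nat N)"
    unfolding word_trace_def[abs_def] by (intro stein_sum stein_ent pq) auto
  moreover have "(\<Sum>i<N. (\<Sum>k<length u.
      b x (u ! k) * (en (take k u) i q w * en (drop (Suc k) u) p i w) +
      \<theta> * b x (tr (u ! k)) * (en (take k u) i p w * en (drop (Suc k) u) q i w)) / of_nat N) = dtr x p q u w" for w
  proof -
    have "(\<Sum>i<N. \<Sum>k<length u.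
      b x (u ! k) * (en (take k u) i q w * en (drop (Suc k) u) p i w) +
      \<theta> * b x (tr (u ! k)) * (en (take k u) i p w * en (drop (Suc k) u) q i w)) =
      (\<Sum>k<length u. b x (u ! k) * (\<Sum>i<N. en (drop (Suc k) u) p i w * en (take k u) i q w) +
      \<theta> * b x (tr (u ! k)) * (\<Sum>i<N. en (drop (Suc k) u) q i w * en (take k u) i p w))"
      by (subst sum.swap) (simp add: sum.distrib sum_distrib_left mult_ac)
    then show ?thesis
      using pq by (simp add: dtr_def ent_append flip: sum_divide_distrib)
  qed
  ultimately show ?thesis by (simp only:)
qed

definition tprod :: "'x list list \<Rightarrow> 'w \<Rightarrow> complex" where
  "tprod R w = (\<Prod>r\<leftarrow>R. tra r w)"

lemma tprod_Nil: "tprod [] = (\<lambda>_. 1)"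
  and tprod_Cons: "tprod (r # R) = (\<lambda>w. tra r w * tprod R w)"
  by (simp_all add: tprod_def fun_eq_iff)

lemma stein_tprod:
  assumes pq: "p < N" "q < N"
  shows "stein (e x p q) (tprod R) (\<lambda>w. psum R (\<lambda>r R'. dtr x p q r w * tprod R' w))"
proof (induction R)
  case Nil
  then show ?case using stein_const by (simp add: tprod_def[abs_def])
next
  case (Cons r R)
  from stein_mult[OF stein_trace[OF pq, of x r] Cons]
  show ?case
    by (simp add: tprod_def[abs_def] psum_Cons mult.left_commute flip: psum_const_left)
qed

lemma integrable_tprod: "integrable M (tprod R)"
  using stein_integrable(1)[OF stein_tprod[OF N N]] .

lemma expectation_sum_sum:
  fixes f :: "nat \<Rightarrow> nat \<Rightarrow> 'w \<Rightarrow> complex"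
  assumes "\<And>p q. p < N \<Longrightarrow> q < N \<Longrightarrow> integrable M (f p q)"
  shows "expectation (\<lambda>w. \<Sum>p<N. \<Sum>q<N. f p q w) = (\<Sum>p<N. \<Sum>q<N. expectation (f p q))"
proof -
  have "expectation (\<lambda>w. \<Sum>p<N. \<Sum>q<N. f p q w) = (\<Sum>p<N. expectation (\<lambda>w. \<Sum>q<N. f p q w))"
    using assms by (intro Bochner_Integration.integral_sum Bochner_Integration.integrable_sum) auto
  also have "\<dots> = (\<Sum>p<N. \<Sum>q<N. expectation (f p q))"
    using assms by (intro sum.cong refl Bochner_Integration.integral_sum) auto
  finally show ?thesis .
qed

lemma psum_divide: "psum R f / a = psum R (\<lambda>r R'. f r R' / a)"
  by (simp add: psum_def sum_divide_distrib)

definition mom :: "'x list list \<Rightarrow> complex" where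
  "mom R = expectation (tprod R)"

lemma trace_transposed:
  assumes "\<theta> \<noteq> 0"
  shows "(\<Sum>p<N. \<Sum>q<N. en u q p w * en v q p w) = tra (u @ wrev tr v) w"
  unfolding word_trace_append
  by (subst sum.swap) (auto intro!: sum.cong simp: ent_wrev[where e = "E w" and tr = tr] e_tr[OF assms])

text \<open>Write the first trace as the sum of \<open>e x p q\<close> times the entry (q, p) of
  \<open>w\<close>, integrate by parts in every \<open>e x p q\<close>, and sum over p and q: the
  index sums turn products of entries back into traces.\<close>

lemma loop_moments: "loop_moments N b tr \<theta> mom"
  unfolding loop_moments_def
proof (intro conjI allI)
  show "mom [] = 1" by (simp add: mom_def tprod_Nil prob_space)
  show "mom ([] # R) = of_nat N * mom R" for R
    by (simp add: mom_def tprod_Cons word_trace_def)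
  fix x w R
  let ?bt = "\<lambda>y. \<theta> * b x (tr y)"
  let ?d = "\<lambda>p q \<omega>. (\<Sum>k<length w.
      b x (w ! k) * (en (take k w) q q \<omega> * en (drop (Suc k) w) p p \<omega>) +
      ?bt (w ! k) * (en (take k w) q p \<omega> * en (drop (Suc k) w) q p \<omega>)) / of_nat N"
  let ?F = "\<lambda>p q \<omega>. en w q p \<omega> * tprod R \<omega>"
  let ?F' = "\<lambda>p q \<omega>. ?d p q \<omega> * tprod R \<omega> + en w q p \<omega> * psum R (\<lambda>r R'. dtr x p q r \<omega> * tprod R' \<omega>)"
  have st: "stein (e x p q) (?F p q) (?F' p q)" if "p < N" "q < N" for p q
    using that by (intro stein_mult stein_ent stein_tprod)
  have ibp: "integrable M (\<lambda>\<omega>. e x p q \<omega> * ?F p q \<omega>)"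
    "expectation (\<lambda>\<omega>. e x p q \<omega> * ?F p q \<omega>) = expectation (?F' p q)" "integrable M (?F' p q)"
    if "p < N" "q < N" for p q
    using stein_ibp[OF e_gauss[OF that] st[OF that]] stein_integrable(2)[OF st[OF that]] by blast+
  have "tprod ((x # w) # R) \<omega> = (\<Sum>p<N. \<Sum>q<N. e x p q \<omega> * ?F p q \<omega>)" for \<omega>
    by (simp add: tprod_def word_trace_def sum_distrib_right mult.assoc)
  then have "mom ((x # w) # R) = expectation (\<lambda>\<omega>. \<Sum>p<N. \<Sum>q<N. e x p q \<omega> * ?F p q \<omega>)"
    unfolding mom_def by (intro arg_cong[of _ _ "integral\<^sup>L M"] ext)
  also have "\<dots> = (\<Sum>p<N. \<Sum>q<N. expectation (\<lambda>\<omega>. e x p q \<omega> * ?F p q \<omega>))"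
    by (intro expectation_sum_sum ibp)
  also have "\<dots> = (\<Sum>p<N. \<Sum>q<N. expectation (?F' p q))"
    by (intro sum.cong refl ibp) simp_all
  also have "\<dots> = expectation (\<lambda>\<omega>. \<Sum>p<N. \<Sum>q<N. ?F' p q \<omega>)"
    by (intro expectation_sum_sum[symmetric] ibp)
  also have "\<dots> = expectation (\<lambda>\<omega>. ((\<Sum>k<length w. b x (w ! k) * tprod (take k w # drop (Suc k) w # R) \<omega> +
      ?bt (w ! k) * tprod ((take k w @ wrev tr (drop (Suc k) w)) # R) \<omega>) +
      psum R (\<lambda>r R'. \<Sum>k<length r. b x (r ! k) * tprod ((w @ drop (Suc k) r @ take k r) # R') \<omega> +
        ?bt (r ! k) * tprod ((w @ wrev tr (drop (Suc k) r @ take k r)) # R') \<omega>)) / of_nat N)"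
  proof (intro arg_cong[of _ _ "integral\<^sup>L M"] ext)
    fix \<omega>
    have 1: "(\<Sum>p<N. \<Sum>q<N. ?d p q \<omega>) = (\<Sum>k<length w. b x (w ! k) * (tra (take k w) \<omega> * tra (drop (Suc k) w) \<omega>) +
      ?bt (w ! k) * tra (take k w @ wrev tr (drop (Suc k) w)) \<omega>) / of_nat N"
    proof -
      have "(\<Sum>p<N. \<Sum>q<N. ?d p q \<omega>) = (\<Sum>k<length w.
        b x (w ! k) * (\<Sum>p<N. \<Sum>q<N. en (take k w) q q \<omega> * en (drop (Suc k) w) p p \<omega>) +
        ?bt (w ! k) * (\<Sum>p<N. \<Sum>q<N. en (take k w) q p \<omega> * en (drop (Suc k) w) q p \<omega>)) / of_nat N"
        unfolding sum_divide_distrib[symmetric] sum_distrib_left sum.distrib[symmetric]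
        by (subst sum.swap[of _ "{..<length w}"], subst sum.swap[of _ "{..<length w}"]) (rule refl)
      moreover have "(\<Sum>p<N. \<Sum>q<N. en u q q \<omega> * en v p p \<omega>) = tra u \<omega> * tra v \<omega>" for u v
        by (simp add: word_trace_def sum_product) (rule sum.swap)
      \<comment> \<open>The transposed trace is available only for nonzero \<open>\<theta>\<close>;
        otherwise the coefficient is zero.\<close>
      moreover have "?bt y * (\<Sum>p<N. \<Sum>q<N. en u q p \<omega> * en v q p \<omega>) = ?bt y * tra (u @ wrev tr v) \<omega>" for u v y
        using trace_transposed[of \<omega> u v] by (cases "\<theta> = 0") simp_all
      ultimately show ?thesis by (simp only:)
    qed
    have 2: "(\<Sum>p<N. \<Sum>q<N. en w q p \<omega> * dtr x p q r \<omega>) =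
      (\<Sum>k<length r. b x (r ! k) * tra (w @ drop (Suc k) r @ take k r) \<omega> +
        ?bt (r ! k) * tra (w @ wrev tr (drop (Suc k) r @ take k r)) \<omega>) / of_nat N" for r
    proof -
      let ?X = "\<lambda>k. drop (Suc k) r @ take k r"
      have "(\<Sum>p<N. \<Sum>q<N. en w q p \<omega> * dtr x p q r \<omega>) = (\<Sum>p<N. \<Sum>q<N. \<Sum>k<length r.
          b x (r ! k) * (en w q p \<omega> * en (?X k) p q \<omega>) + ?bt (r ! k) * (en w q p \<omega> * en (?X k) q p \<omega>)) / of_nat N"
        unfolding dtr_def times_divide_eq_right sum_distrib_left sum_divide_distrib
        by (intro sum.cong refl) (simp add: algebra_simps)
      also have "\<dots> = (\<Sum>k<length r. b x (r ! k) * (\<Sum>p<N. \<Sum>q<N. en w q p \<omega> * en (?X k) p q \<omega>) +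
          ?bt (r ! k) * (\<Sum>p<N. \<Sum>q<N. en w q p \<omega> * en (?X k) q p \<omega>)) / of_nat N"
        unfolding sum_distrib_left sum.distrib[symmetric]
        by (subst sum.swap[of _ "{..<length r}"], subst sum.swap[of _ "{..<length r}"]) (rule refl)
      also have "(\<lambda>k. \<Sum>p<N. \<Sum>q<N. en w q p \<omega> * en (?X k) p q \<omega>) = (\<lambda>k. tra (w @ ?X k) \<omega>)"
        unfolding word_trace_append[of _ _ w] by (rule ext, rule sum.swap)
      also have "(\<lambda>k. ?bt (r ! k) * (\<Sum>p<N. \<Sum>q<N. en w q p \<omega> * en (?X k) q p \<omega>)) = (\<lambda>k. ?bt (r ! k) * tra (w @ wrev tr (?X k)) \<omega>)"
        using trace_transposed[of \<omega> w] by (cases "\<theta> = 0") simp_all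
      finally show ?thesis .
    qed
    have 3: "(\<Sum>p<N. \<Sum>q<N. en w q p \<omega> * psum R (\<lambda>r R'. dtr x p q r \<omega> * tprod R' \<omega>)) =
      psum R (\<lambda>r R'. (\<Sum>p<N. \<Sum>q<N. en w q p \<omega> * dtr x p q r \<omega>) * tprod R' \<omega>)"
      unfolding psum_def sum_distrib_left sum_distrib_right
      by (subst sum.swap[of _ "{..<length R}"], subst sum.swap[of _ "{..<length R}"]) (simp add: mult.assoc)
    have "(\<Sum>p<N. \<Sum>q<N. ?F' p q \<omega>) = (\<Sum>p<N. \<Sum>q<N. ?d p q \<omega>) * tprod R \<omega> +
      (\<Sum>p<N. \<Sum>q<N. en w q p \<omega> * psum R (\<lambda>r R'. dtr x p q r \<omega> * tprod R' \<omega>))"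
      by (simp only: sum.distrib sum_distrib_right)
    then show "(\<Sum>p<N. \<Sum>q<N. ?F' p q \<omega>) =
      ((\<Sum>k<length w. b x (w ! k) * tprod (take k w # drop (Suc k) w # R) \<omega> +
      ?bt (w ! k) * tprod ((take k w @ wrev tr (drop (Suc k) w)) # R) \<omega>) +
      psum R (\<lambda>r R'. \<Sum>k<length r. b x (r ! k) * tprod ((w @ drop (Suc k) r @ take k r) # R') \<omega> +
        ?bt (r ! k) * tprod ((w @ wrev tr (drop (Suc k) r @ take k r)) # R') \<omega>)) / of_nat N"
      unfolding 1 2 3 add_divide_distrib[of _ "psum R _"] psum_divide
      by (simp only: tprod_Cons times_divide_eq_left sum_distrib_right distrib_right mult.assoc)
  qed
  also have "\<dots> = ((\<Sum>k<length w. b x (w ! k) * mom (take k w # drop (Suc k) w # R) +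
      ?bt (w ! k) * mom ((take k w @ wrev tr (drop (Suc k) w)) # R)) +
      psum R (\<lambda>r R'. \<Sum>k<length r. b x (r ! k) * mom ((w @ drop (Suc k) r @ take k r) # R') +
        ?bt (r ! k) * mom ((w @ wrev tr (drop (Suc k) r @ take k r)) # R'))) / of_nat N"
    unfolding mom_def psum_def
    by (simp add: integrable_tprod Bochner_Integration.integral_sum del: of_nat_Suc)
  finally show "of_nat N * mom ((x # w) # R) =
    (\<Sum>k<length w. b x (w ! k) * mom (take k w # drop (Suc k) w # R) +
      ?bt (w ! k) * mom ((take k w @ wrev tr (drop (Suc k) w)) # R)) +
      psum R (\<lambda>r R'. \<Sum>k<length r. b x (r ! k) * mom ((w @ drop (Suc k) r @ take k r) # R') +
        ?bt (r ! k) * mom ((w @ wrev tr (drop (Suc k) r @ take k r)) # R'))"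
    using N by simp
qed

end

section \<open>Elliptic matrices as Gaussian matrices\<close>

fun flip :: "'i letter \<Rightarrow> 'i letter" where
  "flip (Var i) = VarStar i"
| "flip (VarStar i) = Var i"

lemma flip_flip [simp]: "flip (flip x) = x"
  by (cases x) simp_all

lemma index_flip [simp]: "index (flip x) = index x"
  by (cases x) simp_all

text \<open>Off the diagonal, X_ij against X_ji gives the parameter, and X_ij against the (j, i)
  entry of the adjoint gives E|X_ij|^2 = 1. Evaluated at a flipped letter, the same function gives
  the orientation-reversing contraction of the real case.\<close>

definition ell_cov :: "'i set \<Rightarrow> ('i \<Rightarrow> real) \<Rightarrow> 'i letter \<Rightarrow> 'i letter \<Rightarrow> complex" where
  "ell_cov I \<gamma> x y =
     (if index x = index y \<and> index x \<in> I then if x = y then complex_of_real (\<gamma> (index x)) else 1 else 0)"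

interpretation ell: coloured_covariance "ell_cov I \<gamma>" index for I \<gamma>
  by unfold_locales (auto simp: ell_cov_def)

definition blk :: "'a mat \<Rightarrow> nat \<times> nat \<Rightarrow> 'a \<times> 'a" where
  "blk A p = (A $$ p, A $$ (snd p, fst p))"

definition blocks :: "nat \<Rightarrow> (nat \<times> nat) set" where
  "blocks N = {(i, j). i \<le> j \<and> j < N}"

lemma finite_blocks: "finite (blocks N)"
  by (rule finite_subset[of _ "{..<N} \<times> {..<N}"]) (auto simp: blocks_def)

lemma (in prob_space) expectation_mult_indep:
  fixes f :: "'c \<Rightarrow> complex" and g :: "'d \<Rightarrow> complex"
  assumes ind: "indep_vars M' Y A" and ij: "i \<in> A" "j \<in> A" "i \<noteq> j"
    and F: "F \<in> measurable (M' i) borel" "G \<in> measurable (M' j) borel"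
    and int: "integrable M (\<lambda>w. F (Y i w) :: complex)" "integrable M (\<lambda>w. G (Y j w) :: complex)"
  shows "expectation (\<lambda>w. F (Y i w) * G (Y j w)) = expectation (\<lambda>w. F (Y i w)) * expectation (\<lambda>w. G (Y j w))"
proof -
  let ?Z = "\<lambda>k w. (if k = i then F else G) (Y k w)"
  have "indep_vars M' Y {i, j}" using ind by (rule indep_vars_subset) (use ij in auto)
  then have "indep_vars (\<lambda>_. borel) ?Z {i, j}"
    by (rule indep_vars_compose2) (use F ij in auto)
  then have "expectation (\<lambda>w. \<Prod>k\<in>{i, j}. ?Z k w) = (\<Prod>k\<in>{i, j}. expectation (?Z k))"
    by (intro indep_vars_lebesgue_integral) (use int ij in auto)
  then show ?thesis using ij by simp
qed

text \<open>\<open>'a\<close> stands for \<open>complex\<close> or \<open>real\<close>; up to the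
  covariances one argument treats both cases.\<close>

locale elliptic_family = prob_space M for M :: "'w measure" +
  fixes N :: nat and I :: "'i set" and X :: "'i \<Rightarrow> 'w \<Rightarrow> 'a::euclidean_space mat"
  assumes indep: "independent_matrices M N I X"
    and ell_indep: "i \<in> I \<Longrightarrow> elliptic_independence M N (X i)"
    and gauss_blocks: "i \<in> I \<Longrightarrow> p \<in> blocks N \<Longrightarrow> centered_gaussian M (\<lambda>w. blk (X i w) p)"
begin

text \<open>The sums are finite because \<open>I\<close> may be infinite, and they run over blocks
  because the two components of a block are dependent, so that a functional has to act on a block as
  a whole.\<close>

definition HX :: "('w \<Rightarrow> real) set" where
  "HX = {L. \<exists>J u. finite J \<and> J \<subseteq> I \<and> L = (\<lambda>w. \<Sum>i\<in>J. \<Sum>p\<in>blocks N. inner (u i p) (blk (X i w) p))}"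

lemma HX_I: "finite J \<Longrightarrow> J \<subseteq> I \<Longrightarrow> (\<lambda>w. \<Sum>i\<in>J. \<Sum>p\<in>blocks N. inner (u i p) (blk (X i w) p)) \<in> HX"
  unfolding HX_def by (intro CollectI exI[of _ J] exI[of _ u] conjI refl)

lemma HX_rep:
  assumes "L \<in> HX" "finite K" "K \<subseteq> I"
  obtains J u where "finite J" "K \<subseteq> J" "J \<subseteq> I" "L = (\<lambda>w. \<Sum>i\<in>J. \<Sum>p\<in>blocks N. inner (u i p) (blk (X i w) p))"
proof -
  obtain J u where J: "finite J" "J \<subseteq> I" and L: "L = (\<lambda>w. \<Sum>i\<in>J. \<Sum>p\<in>blocks N. inner (u i p) (blk (X i w) p))"
    using assms(1) by (auto simp: HX_def)
  let ?u = "\<lambda>i p. if i \<in> J then u i p else 0"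
  have "L = (\<lambda>w. \<Sum>i\<in>J \<union> K. \<Sum>p\<in>blocks N. inner (?u i p) (blk (X i w) p))"
    unfolding L by (rule ext, rule sum.mono_neutral_cong_left) (use J assms(2) in auto)
  then show ?thesis using that[of "J \<union> K" ?u] J assms by auto
qed

lemma indep_block_functionals:
  assumes "i \<in> I"
  shows "indep_vars (\<lambda>_. borel) (\<lambda>p w. inner (u p) (blk (X i w) p)) (blocks N)"
proof -
  have "indep_vars (\<lambda>_. borel) (\<lambda>p w. blk (X i w) p) (blocks N)"
    using ell_indep[OF assms] unfolding elliptic_independence_def blocks_def blk_def
    by (simp add: case_prod_unfold)
  then show ?thesis by (rule indep_vars_compose2) simp
qed

text \<open>There are two layers of independence, the blocks within one matrix and the matrices
  among each other; each contributes a finite sum of independent Gaussian variables.\<close>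

lemma HX_gauss:
  assumes "L \<in> HX" shows "\<exists>v. gauss_rv M L v"
proof -
  obtain J u where J: "finite J" "J \<subseteq> I" and L: "L = (\<lambda>w. \<Sum>i\<in>J. \<Sum>p\<in>blocks N. inner (u i p) (blk (X i w) p))"
    using assms by (auto simp: HX_def)
  let ?S = "{..<N} \<times> {..<N}"
  let ?Y = "\<lambda>i m. \<Sum>p\<in>blocks N. inner (u i p) (m p, m (snd p, fst p))"
  have m: "?Y i \<in> borel_measurable (PiM ?S (\<lambda>_. borel))" for i
  proof (rule borel_measurable_sum)
    fix p assume "p \<in> blocks N"
    then have "p \<in> ?S" "(snd p, fst p) \<in> ?S" by (auto simp: blocks_def)
    then have "(\<lambda>m. m p) \<in> borel_measurable (PiM ?S (\<lambda>_. borel :: 'a measure))"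
      "(\<lambda>m. m (snd p, fst p)) \<in> borel_measurable (PiM ?S (\<lambda>_. borel :: 'a measure))"
      by (auto intro: measurable_component_singleton)
    from borel_measurable_Pair[OF this]
    show "(\<lambda>m. inner (u i p) (m p, m (snd p, fst p))) \<in> borel_measurable (PiM ?S (\<lambda>_. borel))"
      by (intro borel_measurable_inner borel_measurable_const)
  qed
  have eq: "?Y i (\<lambda>p\<in>?S. X i w $$ p) = (\<Sum>p\<in>blocks N. inner (u i p) (blk (X i w) p))" for i w
    by (intro sum.cong refl) (auto simp: blk_def blocks_def)
  have "indep_vars (\<lambda>_. PiM ?S (\<lambda>_. borel)) (\<lambda>i w. \<lambda>p\<in>?S. X i w $$ p) J"
    using indep J(2) unfolding independent_matrices_def by (rule indep_vars_subset)
  then have "indep_vars (\<lambda>_. borel) (\<lambda>i w. ?Y i (\<lambda>p\<in>?S. X i w $$ p)) J"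
    by (rule indep_vars_compose2) (rule m)
  then have "indep_vars (\<lambda>_. borel) (\<lambda>i w. \<Sum>p\<in>blocks N. inner (u i p) (blk (X i w) p)) J"
    unfolding eq .
  then show ?thesis
    unfolding L
  proof (rule gauss_rv_sum[OF J(1)])
    fix i assume "i \<in> J"
    then have i: "i \<in> I" using J(2) by auto
    show "\<exists>v. gauss_rv M (\<lambda>w. \<Sum>p\<in>blocks N. inner (u i p) (blk (X i w) p)) v"
      by (rule gauss_rv_sum[OF finite_blocks indep_block_functionals[OF i]])
        (rule centered_gaussian_gauss_rv[OF gauss_blocks[OF i]])
  qed
qed

sublocale HX: gauss_space M HX
proof unfold_locales
  fix L L' assume L: "L \<in> HX" "L' \<in> HX"
  obtain K v where K: "finite K" "K \<subseteq> I" and L': "L' = (\<lambda>w. \<Sum>i\<in>K. \<Sum>p\<in>blocks N. inner (v i p) (blk (X i w) p))"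
    using L(2) by (auto simp: HX_def)
  obtain J u where J: "finite J" "K \<subseteq> J" "J \<subseteq> I" and Lu: "L = (\<lambda>w. \<Sum>i\<in>J. \<Sum>p\<in>blocks N. inner (u i p) (blk (X i w) p))"
    by (rule HX_rep[OF L(1) K])
  let ?v = "\<lambda>i p. if i \<in> K then v i p else 0"
  have "L' = (\<lambda>w. \<Sum>i\<in>J. \<Sum>p\<in>blocks N. inner (?v i p) (blk (X i w) p))"
    unfolding L' by (rule ext, rule sum.mono_neutral_cong_left) (use J in auto)
  then have eq: "(\<lambda>w. L w + L' w) = (\<lambda>w. \<Sum>i\<in>J. \<Sum>p\<in>blocks N. inner (u i p + ?v i p) (blk (X i w) p))"
    unfolding Lu by (simp only: sum.distrib inner_add_left)
  show "(\<lambda>w. L w + L' w) \<in> HX" unfolding eq by (rule HX_I[OF J(1,3)])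
next
  fix L c assume "L \<in> HX"
  then obtain J u where J: "finite J" "J \<subseteq> I" and L: "L = (\<lambda>w. \<Sum>i\<in>J. \<Sum>p\<in>blocks N. inner (u i p) (blk (X i w) p))"
    by (auto simp: HX_def)
  have eq: "(\<lambda>w. c * L w) = (\<lambda>w. \<Sum>i\<in>J. \<Sum>p\<in>blocks N. inner (c *\<^sub>R u i p) (blk (X i w) p))"
    unfolding L by (simp add: sum_distrib_left)
  show "(\<lambda>w. c * L w) \<in> HX" unfolding eq by (rule HX_I[OF J])
qed (rule HX_gauss)

lemma zero_HX: "(\<lambda>_. 0) \<in> HX"
proof -
  show ?thesis using HX_I[of "{}" undefined] by simp
qed

lemma entry_HX:
  assumes "i \<in> I" "j < N" "k < N"
  shows "(\<lambda>w. inner a (X i w $$ (j, k))) \<in> HX"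
proof -
  let ?q = "(min j k, max j k)"
  \<comment> \<open>A block is indexed by its position on or above the diagonal; an entry below the
    diagonal is its second component.\<close>
  let ?v = "if j \<le> k then (a, 0) else (0, a)"
  let ?u = "\<lambda>(_ :: 'i) p. if p = ?q then ?v else 0"
  have q: "?q \<in> blocks N" using assms by (auto simp: blocks_def)
  have "(\<Sum>p\<in>blocks N. inner (?u i p) (blk (X i w) p)) = inner a (X i w $$ (j, k))" for w
  proof -
    have "(\<Sum>p\<in>blocks N. inner (?u i p) (blk (X i w) p)) = (\<Sum>p\<in>blocks N. if p = ?q then inner ?v (blk (X i w) ?q) else 0)"
      by (intro sum.cong refl) auto
    also have "\<dots> = inner ?v (blk (X i w) ?q)"
      using q finite_blocks by (simp only: sum.delta if_True)
    also have "\<dots> = inner a (X i w $$ (j, k))"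
      by (auto simp: blk_def min_def max_def)
    finally show ?thesis .
  qed
  then have "(\<lambda>w. inner a (X i w $$ (j, k))) = (\<lambda>w. \<Sum>i\<in>{i}. \<Sum>p\<in>blocks N. inner (?u i p) (blk (X i w) p))"
    by (simp only: sum.insert[OF finite.emptyI] sum.empty add_0_right empty_iff not_False_eq_True)
  then show ?thesis using HX_I[of "{i}" ?u] assms(1) by (simp only: finite.intros insert_subset empty_subsetI simp_thms)
qed

lemma cgauss_integrable:
  assumes "HX.cgauss Z"
  shows "integrable M Z" "expectation Z = 0"
proof -
  note R = HX.wick_complex[OF assms, of "[]"]
  show "integrable M Z" using R(1) by simp
  have "HX.dmon c [] = (\<lambda>_. 0)" for c by (rule ext) simp
  then show "expectation Z = 0" using R(2) by simp
qed

end

text \<open>\<open>\<iota>\<close> embeds the entries into the complex numbers, with real and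
  imaginary parts represented by the vectors \<open>re\<close> and \<open>im\<close>. For
  \<open>\<theta> = 0\<close> and \<open>\<theta> = 1\<close> the covariances are those of the
  complex and the real model; in the latter \<open>cnj\<close> acts trivially, which explains the
  terms \<open>\<theta> * \<gamma> i\<close> in the conjugated covariances.\<close>

locale elliptic_embedded = elliptic_family M N I X
  for M :: "'w measure" and N and I :: "'i set" and X :: "'i \<Rightarrow> 'w \<Rightarrow> 'a::euclidean_space mat" +
  fixes \<iota> :: "'a \<Rightarrow> complex" and re im :: 'a and \<gamma> :: "'i \<Rightarrow> real" and \<theta> :: complex
  assumes N: "N > 0"
    and Re_emb: "Re (\<iota> a) = inner re a" and Im_emb: "Im (\<iota> a) = inner im a"
    and real_emb: "\<theta> \<noteq> 0 \<Longrightarrow> cnj (\<iota> a) = \<iota> a"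
    and \<theta>: "\<theta> = 0 \<or> \<theta> = 1"
    and off_diag: "i \<in> I \<Longrightarrow> j < k \<Longrightarrow> k < N \<Longrightarrow>
        expectation (\<lambda>w. (\<iota> (X i w $$ (j, k)))\<^sup>2) = \<theta> \<and>
        expectation (\<lambda>w. (\<iota> (X i w $$ (k, j)))\<^sup>2) = \<theta> \<and>
        expectation (\<lambda>w. \<iota> (X i w $$ (j, k)) * \<iota> (X i w $$ (k, j))) = \<gamma> i \<and>
        expectation (\<lambda>w. \<iota> (X i w $$ (j, k)) * cnj (\<iota> (X i w $$ (k, j)))) = \<theta> * \<gamma> i \<and>
        expectation (\<lambda>w. \<iota> (X i w $$ (j, k)) * cnj (\<iota> (X i w $$ (j, k)))) = 1 \<and>
        expectation (\<lambda>w. \<iota> (X i w $$ (k, j)) * cnj (\<iota> (X i w $$ (k, j)))) = 1"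
    and diag: "i \<in> I \<Longrightarrow> j < N \<Longrightarrow>
        expectation (\<lambda>w. (\<iota> (X i w $$ (j, j)))\<^sup>2) = \<gamma> i + \<theta> \<and>
        expectation (\<lambda>w. \<iota> (X i w $$ (j, j)) * cnj (\<iota> (X i w $$ (j, j)))) = 1 + \<theta> * \<gamma> i"
begin

lemma emb_cgauss:
  assumes "i \<in> I" "j < N" "k < N"
  shows "HX.cgauss (\<lambda>w. \<iota> (X i w $$ (j, k)))" "HX.cgauss (\<lambda>w. cnj (\<iota> (X i w $$ (j, k))))"
proof -
  show "HX.cgauss (\<lambda>w. \<iota> (X i w $$ (j, k)))"
    using entry_HX[OF assms] by (simp add: HX.cgauss_def Re_emb Im_emb)
  show "HX.cgauss (\<lambda>w. cnj (\<iota> (X i w $$ (j, k))))"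
    using entry_HX[OF assms] HX.H_scale[OF entry_HX[OF assms], of "-1"]
    by (simp add: HX.cgauss_def Re_emb Im_emb)
qed

lemma emb_measurable: "\<iota> \<in> borel_measurable borel"
proof -
  have "\<iota> = (\<lambda>a. Complex (inner re a) (inner im a))"
    by (auto simp: complex_eq_iff Re_emb Im_emb)
  also have "\<dots> = (\<lambda>a. of_real (inner re a) + \<i> * of_real (inner im a))"
    by (simp add: Complex_eq)
  also have "\<dots> \<in> borel_measurable borel" by measurable
  finally show ?thesis .
qed

text \<open>Entries of different matrices or different blocks are independent and centered;
  \<open>f\<close> covers the second entry and its conjugate.\<close>

lemma cov_diff:
  assumes ij: "i \<in> I" "i' \<in> I" "j < N" "k < N" "l < N" "m < N"
    and ne: "i \<noteq> i' \<or> (min j k, max j k) \<noteq> (min l m, max l m)"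
    and f: "f = id \<or> f = cnj"
  shows "expectation (\<lambda>w. \<iota> (X i w $$ (j, k)) * f (\<iota> (X i' w $$ (l, m)))) = 0"
proof -
  have cg: "HX.cgauss (\<lambda>w. \<iota> (X i w $$ (j, k)))" "HX.cgauss (\<lambda>w. f (\<iota> (X i' w $$ (l, m))))"
    using emb_cgauss ij f by auto
  note int = cgauss_integrable(1)[OF cg(1)] cgauss_integrable(1)[OF cg(2)]
  have fm: "f \<in> borel_measurable borel" using f by (auto intro: borel_measurable_continuous_onI continuous_intros)
  note fm' = measurable_compose[OF emb_measurable fm]
  have "expectation (\<lambda>w. \<iota> (X i w $$ (j, k)) * f (\<iota> (X i' w $$ (l, m)))) =
    expectation (\<lambda>w. \<iota> (X i w $$ (j, k))) * expectation (\<lambda>w. f (\<iota> (X i' w $$ (l, m))))"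
  proof (cases "i = i'")
    case False
    let ?S = "{..<N} \<times> {..<N}"
    have S: "(j, k) \<in> ?S" "(l, m) \<in> ?S" using ij by auto
    have ms: "(\<lambda>A. A p) \<in> borel_measurable (PiM ?S (\<lambda>_. borel :: 'a measure))" if "p \<in> ?S" for p
      using that by (rule measurable_component_singleton)
    have "expectation (\<lambda>w. \<iota> ((\<lambda>p\<in>?S. X i w $$ p) (j, k)) * f (\<iota> ((\<lambda>p\<in>?S. X i' w $$ p) (l, m)))) =
      expectation (\<lambda>w. \<iota> ((\<lambda>p\<in>?S. X i w $$ p) (j, k))) * expectation (\<lambda>w. f (\<iota> ((\<lambda>p\<in>?S. X i' w $$ p) (l, m))))"
    proof (rule expectation_mult_indep[OF indep[unfolded independent_matrices_def] ij(1,2) False,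
          of "\<lambda>A. \<iota> (A (j, k))" "\<lambda>A. f (\<iota> (A (l, m)))"])
      show "(\<lambda>A. \<iota> (A (j, k))) \<in> borel_measurable (PiM ?S (\<lambda>_. borel))"
        by (rule measurable_compose[OF ms[OF S(1)] emb_measurable])
      show "(\<lambda>A. f (\<iota> (A (l, m)))) \<in> borel_measurable (PiM ?S (\<lambda>_. borel))"
        by (rule measurable_compose[OF ms[OF S(2)] fm'])
    qed (use int S in simp_all)
    then show ?thesis using S by simp
  next
    case True
    let ?p = "(min j k, max j k)" and ?q = "(min l m, max l m)"
    let ?F = "\<lambda>B. \<iota> (if j \<le> k then fst B else snd B)" and ?G = "\<lambda>B. f (\<iota> (if l \<le> m then fst B else snd B))"
    have b: "?p \<in> blocks N" "?q \<in> blocks N" using ij by (auto simp: blocks_def)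
    have F: "?F (blk (X i w) ?p) = \<iota> (X i w $$ (j, k))" "?G (blk (X i w) ?q) = f (\<iota> (X i' w $$ (l, m)))" for w
      by (auto simp: blk_def min_def max_def True)
    have iv: "indep_vars (\<lambda>_. borel) (\<lambda>p w. blk (X i w) p) (blocks N)"
      using ell_indep[OF ij(1)] unfolding elliptic_independence_def blocks_def blk_def
      by (simp add: case_prod_unfold)
    have "expectation (\<lambda>w. ?F (blk (X i w) ?p) * ?G (blk (X i w) ?q)) =
      expectation (\<lambda>w. ?F (blk (X i w) ?p)) * expectation (\<lambda>w. ?G (blk (X i w) ?q))"
    proof (rule expectation_mult_indep[OF iv b])
      show "?p \<noteq> ?q" using ne True by simp
      have fs: "fst \<in> borel_measurable (borel :: ('a \<times> 'a) measure)" "snd \<in> borel_measurable (borel :: ('a \<times> 'a) measure)"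
        by (simp_all add: borel_prod[symmetric])
      show "?F \<in> borel_measurable borel"
        using measurable_compose[OF fs(1) emb_measurable] measurable_compose[OF fs(2) emb_measurable] by (cases "j \<le> k") simp_all
      show "?G \<in> borel_measurable borel"
        using measurable_compose[OF fs(1) fm'] measurable_compose[OF fs(2) fm'] by (cases "l \<le> m") simp_all
    qed (use int F in simp_all)
    then show ?thesis unfolding F .
  qed
  then show ?thesis using cgauss_integrable(2)[OF cg(1)] by simp
qed

lemma expectation_cnj: "expectation (\<lambda>w. cnj (f w)) = cnj (expectation f)"
  by (rule Bochner_Integration.integral_cnj)

text \<open>On the diagonal both indicators hold, and their sum is the prescribed value
  \<open>\<gamma> i + \<theta>\<close>; this choice of diagonal variances spares a correction
  term.\<close>

lemma cov_id:
  assumes ij: "i \<in> I" "i' \<in> I" "j < N" "k < N" "l < N" "m < N"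
  shows "expectation (\<lambda>w. \<iota> (X i w $$ (j, k)) * \<iota> (X i' w $$ (l, m))) =
    (if i = i' then \<gamma> i * of_bool (j = m \<and> k = l) + \<theta> * of_bool (j = l \<and> k = m) else 0)"
proof (cases "i = i' \<and> (min j k, max j k) = (min l m, max l m)")
  case False
  then have ne: "i \<noteq> i' \<or> (min j k, max j k) \<noteq> (min l m, max l m)" by blast
  have "expectation (\<lambda>w. \<iota> (X i w $$ (j, k)) * \<iota> (X i' w $$ (l, m))) = 0"
    using cov_diff[OF ij ne, of id] by simp
  moreover have "(j = m \<and> k = l) = False" "(j = l \<and> k = m) = False" if "i = i'"
    using ne that by (auto simp: min.commute max.commute)
  ultimately show ?thesis
    by (cases "i = i'") (simp_all only: of_bool_eq mult_zero_right add_0_right if_True if_False simp_thms of_real_0)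
next
  case True
  then have "i' = i" "min j k = min l m" "max j k = max l m" by auto
  then have lm: "i' = i" "l = j \<and> m = k \<or> l = k \<and> m = j" by linarith+
  have sw: "expectation (\<lambda>w. \<iota> (X i w $$ (j, k)) * \<iota> (X i w $$ (k, j))) =
    expectation (\<lambda>w. \<iota> (X i w $$ (k, j)) * \<iota> (X i w $$ (j, k)))"
    by (rule arg_cong[of _ _ "integral\<^sup>L M"]) (rule ext, rule mult.commute)
  consider "j < k" | "k < j" | "j = k" by linarith
  then show ?thesis
  proof cases
    case 1
    note o = off_diag[OF ij(1) 1 ij(4)]
    from lm(2) show ?thesis
    proof (elim disjE conjE)
      assume "l = j" "m = k"
      then show ?thesis using o 1 lm(1) by (simp add: power2_eq_square)
    next
      assume "l = k" "m = j"
      then show ?thesis using o 1 lm(1) by simp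
    qed
  next
    case 2
    note o = off_diag[OF ij(1) 2 ij(3)]
    from lm(2) show ?thesis
    proof (elim disjE conjE)
      assume "l = j" "m = k"
      then show ?thesis using o 2 lm(1) by (simp add: power2_eq_square)
    next
      assume "l = k" "m = j"
      then show ?thesis using o 2 lm(1) sw by simp
    qed
  next
    case 3
    then show ?thesis using diag[OF ij(1,3)] lm by (auto simp: power2_eq_square)
  qed
qed

lemma cov_cnj:
  assumes ij: "i \<in> I" "i' \<in> I" "j < N" "k < N" "l < N" "m < N"
  shows "expectation (\<lambda>w. \<iota> (X i w $$ (j, k)) * cnj (\<iota> (X i' w $$ (l, m)))) =
    (if i = i' then of_bool (j = l \<and> k = m) + \<theta> * \<gamma> i * of_bool (j = m \<and> k = l) else 0)"
proof (cases "i = i' \<and> (min j k, max j k) = (min l m, max l m)")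
  case False
  then have ne: "i \<noteq> i' \<or> (min j k, max j k) \<noteq> (min l m, max l m)" by blast
  have "expectation (\<lambda>w. \<iota> (X i w $$ (j, k)) * cnj (\<iota> (X i' w $$ (l, m)))) = 0"
    using cov_diff[OF ij ne, of cnj] by simp
  moreover have "(j = m \<and> k = l) = False" "(j = l \<and> k = m) = False" if "i = i'"
    using ne that by (auto simp: min.commute max.commute)
  ultimately show ?thesis
    by (cases "i = i'") (simp_all only: of_bool_eq mult_zero_right add_0_right if_True if_False simp_thms of_real_0)
next
  case True
  then have "i' = i" "min j k = min l m" "max j k = max l m" by auto
  then have lm: "i' = i" "l = j \<and> m = k \<or> l = k \<and> m = j" by linarith+
  have sw: "expectation (\<lambda>w. \<iota> (X i w $$ (j, k)) * cnj (\<iota> (X i w $$ (k, j)))) =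
    cnj (expectation (\<lambda>w. \<iota> (X i w $$ (k, j)) * cnj (\<iota> (X i w $$ (j, k)))))"
    unfolding expectation_cnj[symmetric] by (simp add: mult.commute)
  have "cnj \<theta> = \<theta>" using \<theta> by auto
  consider "j < k" | "k < j" | "j = k" by linarith
  then show ?thesis
  proof cases
    case 1
    note o = off_diag[OF ij(1) 1 ij(4)]
    from lm(2) show ?thesis
    proof (elim disjE conjE)
      assume "l = j" "m = k"
      then show ?thesis using o 1 lm(1) by (simp add: power2_eq_square)
    next
      assume "l = k" "m = j"
      then show ?thesis using o 1 lm(1) by simp
    qed
  next
    case 2
    note o = off_diag[OF ij(1) 2 ij(3)]
    from lm(2) show ?thesis
    proof (elim disjE conjE)
      assume "l = j" "m = k"
      then show ?thesis using o 2 lm(1) by (simp add: power2_eq_square)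
    next
      assume "l = k" "m = j"
      then show ?thesis using o 2 lm(1) sw \<open>cnj \<theta> = \<theta>\<close> by simp
    qed
  next
    case 3
    then show ?thesis using diag[OF ij(1,3)] lm by (auto simp: power2_eq_square)
  qed
qed

text \<open>Letters outside \<open>I\<close> get the zero matrix, in accordance with
  \<open>ell_cov\<close>, so the covariance formula holds for all letters.\<close>

definition entry :: "'i letter \<Rightarrow> nat \<Rightarrow> nat \<Rightarrow> 'w \<Rightarrow> complex" where
  "entry x j k w = (case x of
      Var i \<Rightarrow> if i \<in> I then \<iota> (X i w $$ (j, k)) / sqrt N else 0
    | VarStar i \<Rightarrow> if i \<in> I then cnj (\<iota> (X i w $$ (k, j))) / sqrt N else 0)"

text \<open>The adjoint exchanges the matrix indices, so each of the four combinations of letters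
  reduces to \<open>cov_id\<close> or \<open>cov_cnj\<close> with indices exchanged
  accordingly.\<close>

sublocale gauss_matrix M HX N entry "ell_cov I \<gamma>" flip \<theta>
proof unfold_locales
  show "N > 0" by (rule N)
  fix x y j k l m assume jk: "j < N" "k < N"
  have scale: "HX.cgauss (\<lambda>w. Z w / complex_of_real (sqrt N))" if "HX.cgauss Z" for Z
    using that HX.H_scale[of "\<lambda>w. Re (Z w)" "1 / sqrt N"] HX.H_scale[of "\<lambda>w. Im (Z w)" "1 / sqrt N"]
    by (simp add: HX.cgauss_def)
  have "HX.cgauss (\<lambda>_. 0)" using zero_HX by (simp add: HX.cgauss_def)
  then show "HX.cgauss (entry x j k)"
    using jk emb_cgauss scale by (cases x; cases "index x \<in> I") (simp_all add: entry_def[abs_def])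
  assume lm: "l < N" "m < N"
  have sq: "complex_of_real (sqrt N) * complex_of_real (sqrt N) = of_nat N"
    by (simp flip: of_real_mult)
  have div: "expectation (\<lambda>w. (f w / complex_of_real (sqrt N)) * (g w / complex_of_real (sqrt N))) =
    expectation (\<lambda>w. f w * g w) / of_nat N" for f g
    unfolding times_divide_times_eq sq by simp
  have cn: "expectation (\<lambda>w. cnj (f w) * cnj (g w)) = cnj (expectation (\<lambda>w. f w * g w))" for f g
    unfolding expectation_cnj[symmetric] by simp
  have cm: "expectation (\<lambda>w. cnj (f w) * g w) = expectation (\<lambda>w. g w * cnj (f w))" for f g
    by (simp add: mult.commute)
  have t: "cnj \<theta> = \<theta>" using \<theta> by auto
  show "expectation (\<lambda>w. entry x j k w * entry y l m w) =
    (ell_cov I \<gamma> x y * of_bool (j = m \<and> k = l) + \<theta> * ell_cov I \<gamma> x (flip y) * of_bool (j = l \<and> k = m)) / of_nat N"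
    using jk lm
  proof (cases "index x \<in> I \<and> index y \<in> I")
    case False
    then have "(\<lambda>w. entry x j k w * entry y l m w) = (\<lambda>_. 0)"
      by (cases x; cases y) (auto simp: entry_def fun_eq_iff)
    moreover have "ell_cov I \<gamma> x y = 0" "ell_cov I \<gamma> x (flip y) = 0"
      using False by (auto simp: ell_cov_def)
    ultimately show ?thesis by simp
  next
    case True
    have perm: "(l = k \<and> m = j) = (j = m \<and> k = l)" "(l = j \<and> m = k) = (j = l \<and> k = m)"
      "(k = l \<and> j = m) = (j = m \<and> k = l)" "(k = m \<and> j = l) = (j = l \<and> k = m)" by auto
    show ?thesis
    proof (cases x; cases y)
      fix i i' assume xy: "x = Var i" "y = Var i'"
      then have i: "i \<in> I" "i' \<in> I" using True by auto
      show ?thesis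
        unfolding xy entry_def letter.case if_P[OF i(1)] if_P[OF i(2)] div cov_id[OF i jk lm]
        using i by (simp add: ell_cov_def)
    next
      fix i i' assume xy: "x = Var i" "y = VarStar i'"
      then have i: "i \<in> I" "i' \<in> I" using True by auto
      show ?thesis
        unfolding xy entry_def letter.case if_P[OF i(1)] if_P[OF i(2)] div cov_cnj[OF i jk lm(2,1)]
        using i by (simp add: ell_cov_def)
    next
      fix i i' assume xy: "x = VarStar i" "y = VarStar i'"
      then have i: "i \<in> I" "i' \<in> I" using True by auto
      have E: "expectation (\<lambda>w. cnj (\<iota> (X i w $$ (k, j))) * cnj (\<iota> (X i' w $$ (m, l)))) =
        (if i = i' then \<gamma> i * of_bool (j = m \<and> k = l) + \<theta> * of_bool (j = l \<and> k = m) else 0)"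
        unfolding cn cov_id[OF i jk(2,1) lm(2,1)] perm(3,4) by (simp add: t)
      show ?thesis
        unfolding xy entry_def letter.case if_P[OF i(1)] if_P[OF i(2)] div E
        using i by (simp add: ell_cov_def)
    next
      fix i i' assume xy: "x = VarStar i" "y = Var i'"
      then have i: "i \<in> I" "i' \<in> I" using True by auto
      have E: "expectation (\<lambda>w. cnj (\<iota> (X i w $$ (k, j))) * \<iota> (X i' w $$ (l, m))) =
        (if i' = i then of_bool (j = m \<and> k = l) + \<theta> * \<gamma> i' * of_bool (j = l \<and> k = m) else 0)"
        unfolding cm[of "\<lambda>w. \<iota> (X i w $$ (k, j))"] cov_cnj[OF i(2,1) lm jk(2,1)] perm ..
      show ?thesis
        unfolding xy entry_def letter.case if_P[OF i(1)] if_P[OF i(2)] div E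
        using i by (simp add: ell_cov_def)
    qed
  qed
next
  fix x j k w assume "\<theta> \<noteq> 0"
  then show "entry (flip x) j k w = entry x k j w"
    by (cases x) (simp_all add: entry_def real_emb)
qed

end

section \<open>The limit space\<close>

lemma wrev_wrev: "wrev flip (wrev flip u) = u"
  by (simp add: wrev_def rev_map comp_def)

lemma inj_wrev: "inj (wrev flip)"
  by (rule inj_on_inverseI[of _ "wrev flip"]) (rule wrev_wrev)

definition ptr :: "'i star_poly \<Rightarrow> 'i star_poly" where
  "ptr P = Poly_Mapping.map_key (wrev flip) P"

text \<open>Transpose and star agree on words and differ in conjugating coefficients, as they do on
  complex polynomials in real matrices.\<close>

definition pstar :: "'i star_poly \<Rightarrow> 'i star_poly" where
  "pstar P = Poly_Mapping.map cnj (ptr P)"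

lemma lookup_ptr: "Poly_Mapping.lookup (ptr P) u = Poly_Mapping.lookup P (wrev flip u)"
  by (simp add: ptr_def map_key.rep_eq inj_wrev)

lemma lookup_pstar: "Poly_Mapping.lookup (pstar P) u = cnj (Poly_Mapping.lookup P (wrev flip u))"
  by (simp add: pstar_def map.rep_eq lookup_ptr when_def)

lemma ptr_ptr: "ptr (ptr P) = P"
  by (rule poly_mapping_eqI) (simp add: lookup_ptr wrev_wrev)

lemma pstar_pstar: "pstar (pstar P) = P"
  by (rule poly_mapping_eqI) (simp add: lookup_pstar wrev_wrev)

lemma ptr_add: "ptr (P + Q) = ptr P + ptr Q"
  by (rule poly_mapping_eqI) (simp add: lookup_ptr lookup_add)

lemma pstar_add: "pstar (P + Q) = pstar P + pstar Q"
  by (rule poly_mapping_eqI) (simp add: lookup_pstar lookup_add)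

lemma ptr_scale: "ptr (scalar c * P) = scalar c * ptr P"
  by (rule poly_mapping_eqI) (simp add: lookup_ptr)

lemma pstar_scale: "pstar (scalar c * P) = scalar (cnj c) * pstar P"
  by (rule poly_mapping_eqI) (simp add: lookup_pstar)

lemma ptr_mon: "ptr (mon u) = mon (wrev flip u)"
proof (rule poly_mapping_eqI)
  fix v
  have "u = wrev flip v \<longleftrightarrow> wrev flip u = v" using wrev_wrev by metis
  then show "Poly_Mapping.lookup (ptr (mon u)) v = Poly_Mapping.lookup (mon (wrev flip u)) v"
    by (simp add: lookup_ptr mon_def lookup_single when_def)
qed

lemma pstar_mon: "pstar (mon u) = mon (wrev flip u)"
proof (rule poly_mapping_eqI)
  fix v
  have "u = wrev flip v \<longleftrightarrow> wrev flip u = v" using wrev_wrev by metis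
  then show "Poly_Mapping.lookup (pstar (mon u)) v = Poly_Mapping.lookup (mon (wrev flip u)) v"
    by (simp add: lookup_pstar mon_def lookup_single when_def)
qed

lemma lin_ptr: "lin f \<Longrightarrow> lin (\<lambda>P. f (ptr P))"
  by (simp add: lin_def ptr_add ptr_scale)

lemma lin_lookup: "lin (\<lambda>P. Poly_Mapping.lookup P u)"
  by (simp add: lin_def lookup_add)

lemma ptr_mult:
  fixes P Q :: "'i star_poly"
  shows "ptr (P * Q) = ptr Q * ptr P"
proof (rule poly_mapping_eqI)
  fix u :: "'i letter list"
  let ?f = "\<lambda>P :: 'i star_poly. Poly_Mapping.lookup P u"
  show "?f (ptr (P * Q)) = ?f (ptr Q * ptr P)"
  proof (rule bilin_eqI[of "\<lambda>P Q. ?f (ptr (P * Q))" "\<lambda>P Q. ?f (ptr Q * ptr P)"])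
    show "bilin (\<lambda>P Q. ?f (ptr (P * Q)))"
      by (rule bilinI; rule lin_mult_left[OF lin_ptr[OF lin_lookup]] lin_mult_right[OF lin_ptr[OF lin_lookup]])
    show "bilin (\<lambda>P Q. ?f (ptr Q * ptr P))"
      by (rule bilinI; rule lin_ptr[OF lin_mult_left[OF lin_lookup]] lin_ptr[OF lin_mult_right[OF lin_lookup]])
    show "?f (ptr (mon v * mon w)) = ?f (ptr (mon w) * ptr (mon v))" for v w
      by (simp only: mon_append[symmetric] ptr_mon wrev_append)
  qed
qed

text \<open>Conjugating the coefficients once more makes the conjugate-linear map linear, so it
  suffices to compare monomials.\<close>

lemma conj_mult: "Poly_Mapping.map cnj (P * Q) = Poly_Mapping.map cnj P * Poly_Mapping.map cnj (Q :: 'x list \<Rightarrow>\<^sub>0 complex)"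
proof -
  let ?c = "Poly_Mapping.map cnj :: ('x list \<Rightarrow>\<^sub>0 complex) \<Rightarrow> _"
  have lk: "Poly_Mapping.lookup (?c P) u = cnj (Poly_Mapping.lookup P u)" for P u
    by (simp add: map.rep_eq when_def)
  have add: "?c (P + Q) = ?c P + ?c Q" for P Q
    by (rule poly_mapping_eqI) (simp add: lk lookup_add)
  have scale: "?c (scalar a * P) = scalar (cnj a) * ?c P" for a P
    by (rule poly_mapping_eqI) (simp add: lk)
  have mon: "?c (mon u) = mon u" for u
    by (rule poly_mapping_eqI) (simp add: lk mon_def lookup_single when_def)
  let ?f = "\<lambda>u P. cnj (Poly_Mapping.lookup P u)"
  have "cnj (Poly_Mapping.lookup (?c (P * Q)) u) = cnj (Poly_Mapping.lookup (?c P * ?c Q) u)" for u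
  proof (rule bilin_eqI[of "\<lambda>P Q. ?f u (?c (P * Q))" "\<lambda>P Q. ?f u (?c P * ?c Q)"])
    show "bilin (\<lambda>P Q. ?f u (?c (P * Q)))"
      unfolding lk complex_cnj_cnj by (rule bilinI; rule lin_mult_left[OF lin_lookup] lin_mult_right[OF lin_lookup])
    show "bilin (\<lambda>P Q. ?f u (?c P * ?c Q))"
      by (rule bilinI) (simp_all only: lin_def add scale lookup_add distrib_left distrib_right scalar_left_commute
        mult.assoc lookup_scalar_mult complex_cnj_add complex_cnj_mult complex_cnj_cnj simp_thms)
    show "?f u (?c (mon v * mon w)) = ?f u (?c (mon v) * ?c (mon w))" for v w
      by (simp only: mon mon_append[symmetric])
  qed
  then show ?thesis by (intro poly_mapping_eqI) simp
qed

lemma pstar_mult: "pstar (P * Q) = pstar Q * pstar P"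
  by (simp add: pstar_def ptr_mult conj_mult)

lemma mon_star_polys: "index ` set u \<subseteq> I \<Longrightarrow> mon u \<in> star_polys I"
  by (simp add: star_polys_def mon_def)

lemma scalar_star_polys: "scalar c \<in> star_polys I"
  by (simp add: star_polys_def scalar_def)

lemma one_star_polys: "1 \<in> star_polys I" and zero_star_polys: "0 \<in> star_polys I"
  using scalar_star_polys[of 1] scalar_star_polys[of 0] by simp_all

lemma add_star_polys: "P \<in> star_polys I \<Longrightarrow> Q \<in> star_polys I \<Longrightarrow> P + Q \<in> star_polys I"
  unfolding star_polys_def using keys_add[of P Q] by blast

lemma mult_star_polys: "P \<in> star_polys I \<Longrightarrow> Q \<in> star_polys I \<Longrightarrow> P * Q \<in> star_polys I"
  using keys_mult[of P Q] by (fastforce simp: star_polys_def plus_list_def)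

lemma uminus_star_polys: "P \<in> star_polys I \<Longrightarrow> - P \<in> star_polys I"
  by (simp add: star_polys_def in_keys_iff)

lemma index_wrev: "index ` set (wrev flip u) = index ` set u"
  by (simp add: wrev_def image_image)

lemma keys_ptr: "u \<in> Poly_Mapping.keys (ptr P) \<longleftrightarrow> wrev flip u \<in> Poly_Mapping.keys P"
  and keys_pstar: "u \<in> Poly_Mapping.keys (pstar P) \<longleftrightarrow> wrev flip u \<in> Poly_Mapping.keys P"
  by (simp_all add: in_keys_iff lookup_ptr lookup_pstar)

lemma ptr_star_polys:
  assumes "P \<in> star_polys I" shows "ptr P \<in> star_polys I"
  unfolding star_polys_def
proof (intro CollectI ballI)
  fix u assume "u \<in> Poly_Mapping.keys (ptr P)"
  then show "index ` set u \<subseteq> I"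
    using assms index_wrev[of u] unfolding keys_ptr star_polys_def by blast
qed

lemma pstar_star_polys:
  assumes "P \<in> star_polys I" shows "pstar P \<in> star_polys I"
  unfolding star_polys_def
proof (intro CollectI ballI)
  fix u assume "u \<in> Poly_Mapping.keys (pstar P)"
  then show "index ` set u \<subseteq> I"
    using assms index_wrev[of u] unfolding keys_pstar star_polys_def by blast
qed

text \<open>In the free algebra the evaluation of a polynomial at the generators is the polynomial
  itself, so all information about the limit sits in the functionals.\<close>

definition lim_space :: "'i set \<Rightarrow> ('i \<Rightarrow> real) \<Rightarrow> complex \<Rightarrow> 'i star_poly so_space" where
  "lim_space I \<gamma> \<theta> = \<lparr>carrier = star_polys I, mult = (*), one = 1, zero = 0, add = (+),
     smult = \<lambda>c P. scalar c * P, phi1 = linext (phiw (ell_cov I \<gamma>)),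
     phi2 = bilext (lim2 (ell_cov I \<gamma>) flip \<theta>), star = pstar\<rparr>"

lemma lim_space_simps [simp]:
  "carrier (lim_space I \<gamma> \<theta>) = star_polys I" "mult (lim_space I \<gamma> \<theta>) = (*)" "one (lim_space I \<gamma> \<theta>) = 1"
  "zero (lim_space I \<gamma> \<theta>) = 0" "add (lim_space I \<gamma> \<theta>) = (+)" "smult (lim_space I \<gamma> \<theta>) = (\<lambda>c P. scalar c * P)"
  "phi1 (lim_space I \<gamma> \<theta>) = linext (phiw (ell_cov I \<gamma>))"
  "phi2 (lim_space I \<gamma> \<theta>) = bilext (lim2 (ell_cov I \<gamma>) flip \<theta>)" "star (lim_space I \<gamma> \<theta>) = pstar"
  by (simp_all add: lim_space_def)

lemma abelian_group_lim_space: "abelian_group (lim_space I \<gamma> \<theta>)"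
proof (rule abelian_groupI; simp add: add_star_polys zero_star_polys add.assoc add.commute)
  fix P :: "'a star_poly" assume "P \<in> star_polys I"
  then show "\<exists>Q\<in>star_polys I. P + Q = 0"
    by (intro bexI[of _ "- P"] uminus_star_polys) simp_all
qed

lemma complex_algebra_lim_space: "complex_algebra (lim_space I \<gamma> \<theta>)"
  unfolding complex_algebra_def
proof (intro conjI allI ballI)
  show "ring (lim_space I \<gamma> \<theta>)"
    by (rule ringI[OF abelian_group_lim_space monoidI])
      (simp_all add: mult_star_polys one_star_polys mult.assoc distrib_left distrib_right)
  have "field (class_ring :: complex ring)" by (rule class_field)
  then have "cring (class_ring :: complex ring)" by (simp add: field_def domain_def)
  then show "Module.module (class_ring :: complex ring) (lim_space I \<gamma> \<theta>)"
    by (rule moduleI[OF _ abelian_group_lim_space])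
      (simp_all add: class_ring_simps mult_star_polys scalar_star_polys scalar_add scalar_mult distrib_left distrib_right mult.assoc)
qed (simp_all add: mult.assoc scalar_left_commute)

lemma linear_functional_lim_space:
  "linear_functional (lim_space I \<gamma> \<theta>) f" if "lin f"
  using that by (simp add: linear_functional_def lin_def)

lemma list_mult_lim_space: "list_mult (lim_space I \<gamma> \<theta>) Ps = prod_list Ps"
  by (induction Ps) (simp_all add: list_mult_def)

lemma finsum_lim_space:
  assumes "finite S" "\<And>u. u \<in> S \<Longrightarrow> f u \<in> star_polys I"
  shows "finsum (lim_space I \<gamma> \<theta>) f S = sum f S"
proof -
  interpret abelian_group "lim_space I \<gamma> \<theta>" by (rule abelian_group_lim_space)
  show ?thesis
    using assms
  proof (induction S rule: finite_induct)
    case empty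
    show ?case using finsum_empty by simp
  next
    case (insert u S)
    then show ?case by (subst finsum_insert) auto
  qed
qed

definition gen :: "'i \<Rightarrow> 'i star_poly" where
  "gen i = mon [Var i]"

lemma ptr_gen: "ptr (gen i) = mon [VarStar i]" "ptr (mon [VarStar i]) = gen i"
  by (simp_all add: gen_def ptr_mon wrev_def)

lemma pstar_gen: "pstar (gen i) = mon [VarStar i]"
  by (simp add: gen_def pstar_mon wrev_def)

lemma gen_star_polys: "i \<in> I \<Longrightarrow> gen i \<in> star_polys I"
  by (simp add: gen_def mon_star_polys)

lemma star_eval_lim_space:
  assumes "P \<in> star_polys I"
  shows "star_eval (lim_space I \<gamma> \<theta>) (star (lim_space I \<gamma> \<theta>)) gen P = P"
proof -
  let ?A = "lim_space I \<gamma> \<theta>"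
  have w: "list_mult ?A (map (\<lambda>l. case l of Var i \<Rightarrow> gen i | VarStar i \<Rightarrow> star ?A (gen i)) u) = mon u" for u
  proof (induction u)
    case (Cons x u)
    then show ?case
      unfolding list_mult_lim_space mon_Cons[of x u] by (cases x) (simp_all add: pstar_gen[unfolded gen_def] gen_def)
  qed (simp add: list_mult_lim_space)
  have "star_eval ?A (star ?A) gen P = (\<Sum>u\<in>Poly_Mapping.keys P. scalar (Poly_Mapping.lookup P u) * mon u)"
    unfolding star_eval_def w unfolding lim_space_simps
  proof (rule finsum_lim_space)
    fix u assume "u \<in> Poly_Mapping.keys P"
    then have "index ` set u \<subseteq> I" using assms unfolding star_polys_def by blast
    then show "scalar (Poly_Mapping.lookup P u) * mon u \<in> star_polys I"
      by (intro mult_star_polys scalar_star_polys mon_star_polys)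
  qed simp
  then show ?thesis using poly_expand[of P] by simp
qed

lemma gen_subalgebra_colp:
  "P \<in> gen_subalgebra (lim_space I \<gamma> \<theta>) {gen i, star (lim_space I \<gamma> \<theta>) (gen i)} \<Longrightarrow> P \<in> colp index i"
proof (induction rule: gen_subalgebra.induct)
  case (gen x)
  then show ?case by (auto simp: gen_def pstar_gen[unfolded gen_def] intro!: mon_colp)
next
  case one
  then show ?case using scalar_colp[of 1 index i] by simp
qed (auto intro: add_colp mult_colp scalar_colp)

section \<open>Second-order freeness of the limit space\<close>

lemma wrev_nth: "k < length u \<Longrightarrow> wrev tr u ! k = tr (u ! (length u - Suc k))"
  by (simp add: wrev_def rev_nth)

text \<open>Reversal maps non-crossing pairings to non-crossing pairings, and \<open>ell_cov\<close>
  does not change when both letters are flipped. In the recursion, reversal exchanges first-letter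
  and last-letter expansions.\<close>

lemma phiw_wrev: "phiw (ell_cov I \<gamma>) (wrev flip u) = phiw (ell_cov I \<gamma>) u"
proof (induction u rule: length_induct)
  case (1 u)
  let ?p = "phiw (ell_cov I \<gamma>)"
  show ?case
  proof (cases u)
    case (Cons x w)
    let ?n = "length w"
    have b: "ell_cov I \<gamma> (flip x) (flip y) = ell_cov I \<gamma> x y" for x y
      by (cases x; cases y) (auto simp: ell_cov_def)
    have "?p (wrev flip u) = ?p (wrev flip w @ [flip x])" by (simp add: Cons wrev_def)
    also have "\<dots> = (\<Sum>k<?n. ell_cov I \<gamma> (flip x) (wrev flip w ! k) *
        (?p (take k (wrev flip w)) * ?p (drop (Suc k) (wrev flip w))))"
      using phiw_snoc[where b = "ell_cov I \<gamma>", OF ell.b_sym, where w = "wrev flip w" and x = "flip x"] by simp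
    also have "\<dots> = (\<Sum>k<?n. ell_cov I \<gamma> x (w ! k) * (?p (take k w) * ?p (drop (Suc k) w)))"
    proof (rule sum.reindex_bij_witness[of _ "\<lambda>k. ?n - Suc k" "\<lambda>k. ?n - Suc k"])
      fix k assume "k \<in> {..<?n}"
      then have k: "k < ?n" by simp
      have "drop (Suc k) (wrev flip w) = wrev flip (take (?n - Suc k) w)"
        "take k (wrev flip w) = wrev flip (drop (Suc (?n - Suc k)) w)"
        using k by (simp_all add: wrev_def drop_rev take_rev take_map drop_map Suc_diff_Suc)
      moreover have "?p (wrev flip (take (?n - Suc k) w)) = ?p (take (?n - Suc k) w)"
        "?p (wrev flip (drop (Suc (?n - Suc k)) w)) = ?p (drop (Suc (?n - Suc k)) w)"
        using 1 k by (auto simp: Cons)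
      ultimately show "ell_cov I \<gamma> x (w ! (?n - Suc k)) * (?p (take (?n - Suc k) w) * ?p (drop (Suc (?n - Suc k)) w)) =
        ell_cov I \<gamma> (flip x) (wrev flip w ! k) * (?p (take k (wrev flip w)) * ?p (drop (Suc k) (wrev flip w)))"
        using k by (simp add: wrev_nth b)
    qed auto
    finally show ?thesis by (simp add: Cons)
  qed (simp add: wrev_def)
qed

lemma phi_ptr: "linext (phiw (ell_cov I \<gamma>)) (ptr P) = linext (phiw (ell_cov I \<gamma>)) P"
  by (rule lin_eqI[OF lin_ptr[OF lin_linext] lin_linext]) (simp add: ptr_mon phiw_wrev)

lemma ptr_colp: "P \<in> colp index c \<Longrightarrow> ptr P \<in> colp index c"
  using ptr_star_polys[of P "{c}"] by (simp add: colp_def star_polys_def)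

lemma bilext_lim2: "bilext (lim2 b flip \<theta>) P Q = bilext (gw b) P Q + \<theta> * bilext (gw b) P (ptr Q)"
proof (rule bilin_eqI[OF bilin_bilext, of "\<lambda>P Q. bilext (gw b) P Q + \<theta> * bilext (gw b) P (ptr Q)"])
  show "bilin (\<lambda>P Q. bilext (gw b) P Q + \<theta> * bilext (gw b) P (ptr Q))"
    by (intro bilinI lin_plusI lin_const_left)
      (rule bilin_left[OF bilin_bilext] bilin_right[OF bilin_bilext] lin_ptr[OF bilin_right[OF bilin_bilext]])+
qed (simp add: ptr_mon lim2_def)

lemma ptr_lprod: "ptr (lprod L) = lprod (rev (map (apsnd ptr) L))"
proof (induction L)
  case Nil
  show ?case using ptr_mon[of "[]"] by (simp add: wrev_def)
qed (simp add: ptr_mult)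

lemma alt_ptr:
  assumes "ell.alt I \<gamma> L"
  shows "ell.alt I \<gamma> (rev (map (apsnd ptr) L))"
  unfolding ell.alt_rev using assms by (auto simp: ell.alt_def comp_def ptr_colp phi_ptr)

lemma nth_rotation:
  assumes "l < length Bs" "m < length Bs - 1"
  shows "(drop (Suc l) Bs @ take l Bs) ! m = Bs ! ((Suc l + m) mod length Bs)"
proof (cases "m < length Bs - Suc l")
  case True
  then show ?thesis using assms by (simp add: nth_append)
next
  case False
  then have "length Bs \<le> Suc l + m" "Suc l + m - length Bs < length Bs" using assms by linarith+
  then have "(Suc l + m) mod length Bs = Suc l + m - length Bs"
    by (simp only: le_mod_geq mod_less)
  then show ?thesis using assms False by (simp add: nth_append add.commute)
qed

text \<open>\<open>G_alt\<close> chooses the partner of the first factor, and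
  \<open>phi_matching\<close> forces the remaining factors to meet pairwise in opposite order: these
  are the spoke diagrams, indexed by their rotation \<open>l\<close>.\<close>

lemma G_rotations:
  assumes As: "ell.alt I \<gamma> L" "L \<noteq> []" "fst (last L) \<noteq> fst (hd L)"
    and Bs: "ell.alt I \<gamma> Bs" "Bs \<noteq> []" "fst (last Bs) \<noteq> fst (hd Bs)"
  shows "bilext (gw (ell_cov I \<gamma>)) (lprod L) (lprod Bs) =
    (if length L = length Bs then \<Sum>l<length L. \<Prod>j<length L.
       linext (phiw (ell_cov I \<gamma>)) (snd (L ! j) * snd (Bs ! ((l + length L - j) mod length L))) else 0)"
proof -
  let ?\<phi> = "linext (phiw (ell_cov I \<gamma>))"
  obtain A As' where L: "L = A # As'" using As(2) by (cases L) auto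
  have ne: "As' \<noteq> []" using As(3) unfolding L by (cases As') simp_all
  then have lst: "fst (last As') \<noteq> fst A" using As(3) unfolding L by simp
  let ?E = "\<lambda>l. drop (Suc l) Bs @ take l Bs"
  have rot: "ell.alt I \<gamma> (?E l)" if l: "l < length Bs" for l
  proof -
    define X B Y where "X = take l Bs" and "B = Bs ! l" and "Y = drop (Suc l) Bs"
    have LX: "Bs = X @ B # Y"
      unfolding X_def B_def Y_def by (rule id_take_nth_drop[OF l])
    have "ell.alt I \<gamma> (Y @ X)"
    proof (cases "X = [] \<or> Y = []")
      case True
      then show ?thesis using Bs(1) unfolding LX ell.alt_append ell.alt_Cons by (elim disjE) simp_all
    next
      case False
      then have "fst (last Y) \<noteq> fst (hd X)" using Bs(3) unfolding LX by simp
      then show ?thesis using Bs(1) unfolding LX ell.alt_append ell.alt_Cons by blast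
    qed
    then show ?thesis unfolding X_def Y_def .
  qed
  have "bilext (gw (ell_cov I \<gamma>)) (lprod L) (lprod Bs) =
    (\<Sum>l<length Bs. ?\<phi> (snd A * snd (Bs ! l)) * ?\<phi> (lprod As' * lprod (?E l)))"
    unfolding L by (rule ell.G_alt[OF As(1)[unfolded L] ne lst Bs(1,3)])
  also have "\<dots> = (\<Sum>l<length Bs. if length L = length Bs then \<Prod>j<length L.
       ?\<phi> (snd (L ! j) * snd (Bs ! ((l + length L - j) mod length L))) else 0)"
  proof (rule sum.cong[OF refl])
    fix l assume "l \<in> {..<length Bs}"
    then have l: "l < length Bs" by simp
    have alt': "ell.alt I \<gamma> (rev As')" using As(1) by (simp add: L ell.alt_Cons ell.alt_rev)
    \<comment> \<open>\<open>phi_matching\<close> reverses its left list, so it is applied to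
      \<open>rev As'\<close>.\<close>
    have M: "?\<phi> (lprod As' * lprod (?E l)) = (if length As' = length (?E l) then
       \<Prod>k<length As'. ?\<phi> (snd (rev As' ! k) * snd (?E l ! k)) else 0)"
      using ell.phi_matching[OF alt' rot[OF l]] by simp
    show "?\<phi> (snd A * snd (Bs ! l)) * ?\<phi> (lprod As' * lprod (?E l)) = (if length L = length Bs then \<Prod>j<length L.
       ?\<phi> (snd (L ! j) * snd (Bs ! ((l + length L - j) mod length L))) else 0)"
    proof (cases "length L = length Bs")
      case False
      then have "length As' \<noteq> length (?E l)" using l by (simp add: L)
      then show ?thesis using False M by simp
    next
      case True
      let ?p = "length L"
      have len: "length As' = ?p - 1" "length As' = length (?E l)" using True l by (simp_all add: L)
      let ?f = "\<lambda>j. ?\<phi> (snd (L ! j) * snd (Bs ! ((l + ?p - j) mod ?p)))"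
      have P1: "(\<Prod>k<length As'. ?\<phi> (snd (rev As' ! k) * snd (?E l ! k))) = (\<Prod>j<length As'. ?f (Suc j))"
      proof (rule prod.reindex_bij_witness[of _ "\<lambda>k. length As' - Suc k" "\<lambda>k. length As' - Suc k"])
        fix k assume "k \<in> {..<length As'}"
        then have k: "k < length As'" by simp
        have "k < length Bs - 1" using k len True by linarith
        from nth_rotation[OF l this] have "?E l ! k = Bs ! ((Suc l + k) mod ?p)"
          by (simp only: True)
        moreover have "l + ?p - Suc (length As' - Suc k) = Suc l + k" using k by (simp add: L)
        moreover have "rev As' ! k = L ! Suc (length As' - Suc k)" using k by (simp add: L rev_nth)
        ultimately show "?f (Suc (length As' - Suc k)) = ?\<phi> (snd (rev As' ! k) * snd (?E l ! k))"
          by (simp only:)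
      qed auto
      have "(l + ?p - 0) mod ?p = l" using l True by simp
      moreover have "L ! 0 = A" by (simp add: L)
      ultimately have P0: "?f 0 = ?\<phi> (snd A * snd (Bs ! l))" by (simp only:)
      have P2: "(\<Prod>j<?p. ?f j) = ?f 0 * (\<Prod>j<length As'. ?f (Suc j))"
      proof -
        have "{..<?p} = {..<Suc (length As')}" by (simp add: L)
        then show ?thesis by (simp only: prod.lessThan_Suc_shift)
      qed
      show ?thesis unfolding if_P[OF True] P2 P0 M if_P[OF len(2)] P1 ..
    qed
  qed
  finally show ?thesis by simp
qed

section \<open>From positions counted from 0 to cyclic indices counted from 1\<close>

lemma prod_cyc:
  assumes "length as = p" "p > 0"
  shows "(\<Prod>i=1..int p. f (cyc as i) i) = (\<Prod>j<p. f (as ! j) (int j + 1) :: complex)"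
  by (rule prod.reindex_bij_witness[of _ "\<lambda>j. int j + 1" "\<lambda>i. nat (i - 1)"])
    (use assms in \<open>auto simp: cyc_def\<close>)

lemma cyc_sum_spoke:
  assumes len: "length as = p" "length bs = p" and p: "p > 0"
  shows "(\<Sum>k=1..int p. \<Prod>i=1..int p. f (cyc as i) (cyc bs (k - i))) =
    (\<Sum>l<p. \<Prod>j<p. f (as ! j) (bs ! ((l + p - j) mod p)) :: complex)"
\<comment> \<open>With i = j + 1, \<open>cyc bs (k - i)\<close> is position k - 2 - j modulo p,
  hence l = k - 2 modulo p.\<close>
proof (rule sum.reindex_bij_witness[of _ "\<lambda>l. (int l + 1) mod int p + 1" "\<lambda>k. nat ((k - 2) mod int p)"])
  fix k assume k: "k \<in> {1..int p}"
  have "(int (nat ((k - 2) mod int p)) + 1) mod int p = (k - 1) mod int p"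
    using p by (simp add: mod_simps)
  also have "\<dots> = k - 1" using k by simp
  finally show "(int (nat ((k - 2) mod int p)) + 1) mod int p + 1 = k" by simp
  show "nat ((k - 2) mod int p) \<in> {..<p}" using p by (simp add: nat_less_iff)
  have "cyc bs (k - (int j + 1)) = bs ! ((nat ((k - 2) mod int p) + p - j) mod p)" if j: "j < p" for j
  proof -
    have "int ((nat ((k - 2) mod int p) + p - j) mod p) = ((k - 2) mod int p + int p - int j) mod int p"
      using p j by (simp add: zmod_int of_nat_diff)
    also have "\<dots> = (k - (int j + 1) - 1) mod int p"
    proof -
      have "((k - 2) mod int p + int p - int j) mod int p = ((k - 2) mod int p + (int p - int j)) mod int p"
        by (simp add: algebra_simps)
      also have "\<dots> = (k - 2 + (int p - int j)) mod int p" by (simp add: mod_simps)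
      also have "k - 2 + (int p - int j) = (k - (int j + 1) - 1) + int p" by simp
      finally show ?thesis by simp
    qed
    finally show ?thesis unfolding cyc_def len by (metis nat_int)
  qed
  then show "(\<Prod>j<p. f (as ! j) (bs ! ((nat ((k - 2) mod int p) + p - j) mod p))) =
    (\<Prod>i=1..int p. f (cyc as i) (cyc bs (k - i)))"
    unfolding prod_cyc[OF len(1) p, of "\<lambda>x i. f x (cyc bs (k - i))"] by (intro prod.cong) auto
next
  fix l assume l: "l \<in> {..<p}"
  have "((int l + 1) mod int p + 1 - 2) mod int p = ((int l + 1) mod int p + (- 1)) mod int p" by simp
  also have "\<dots> = (int l + 1 + (- 1)) mod int p" by (simp only: mod_add_left_eq)
  also have "\<dots> = int l" using l by simp
  finally show "nat (((int l + 1) mod int p + 1 - 2) mod int p) = l" by simp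
  have "0 \<le> (int l + 1) mod int p" "(int l + 1) mod int p < int p" using p by simp_all
  then show "(int l + 1) mod int p + 1 \<in> {1..int p}"
    unfolding atLeastAtMost_iff by linarith
qed

lemma cyc_sum_transposed:
  assumes len: "length as = p" "length bs = p" and p: "p > 0"
  shows "(\<Sum>k=1..int p. \<Prod>i=1..int p. f (cyc as i) (t (cyc bs (k + i)))) =
    (\<Sum>l<p. \<Prod>j<p. f (as ! j) (rev (map t bs) ! ((l + p - j) mod p)) :: complex)"
\<comment> \<open>With i = j + 1, \<open>cyc bs (k + i)\<close> is position k + j modulo p; in the
  reversed list this is position -1 - k - j, hence l = -k - 1 modulo p.\<close>
proof (rule sum.reindex_bij_witness[of _ "\<lambda>l. (- int l - 2) mod int p + 1" "\<lambda>k. nat ((- k - 1) mod int p)"])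
  fix k assume k: "k \<in> {1..int p}"
  have "(- int (nat ((- k - 1) mod int p)) - 2) mod int p = (- ((- k - 1) mod int p) - 2) mod int p"
    using p by simp
  also have "\<dots> = (- (- k - 1) - 2) mod int p" by (metis mod_diff_left_eq mod_minus_eq)
  also have "\<dots> = k - 1" using k by simp
  finally show "(- int (nat ((- k - 1) mod int p)) - 2) mod int p + 1 = k" by simp
  show "nat ((- k - 1) mod int p) \<in> {..<p}" using p by (simp add: nat_less_iff)
  have "t (cyc bs (k + (int j + 1))) = rev (map t bs) ! ((nat ((- k - 1) mod int p) + p - j) mod p)" if j: "j < p" for j
  proof -
    define m where "m = (nat ((- k - 1) mod int p) + p - j) mod p"
    have m: "m < p" using p by (simp add: m_def)
    have "int m = ((- k - 1) mod int p + (int p - int j)) mod int p"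
      unfolding m_def using p j by (simp add: zmod_int of_nat_diff algebra_simps)
    also have "\<dots> = (- k - 1 + (int p - int j)) mod int p" by (simp only: mod_add_left_eq)
    finally have im: "int m = (- k - 1 + (int p - int j)) mod int p" .
    have "(k + (int j + 1) - 1) mod int p = int (p - Suc m)"
    proof -
      have "int (p - Suc m) = (int p - 1 - int m) mod int p" using m by (simp add: of_nat_diff)
      also have "\<dots> = (int p - 1 - (- k - 1 + (int p - int j))) mod int p"
        unfolding im by (simp only: mod_diff_right_eq)
      finally show ?thesis by (simp add: algebra_simps)
    qed
    then have "cyc bs (k + (int j + 1)) = bs ! (p - Suc m)" unfolding cyc_def len by simp
    then show ?thesis using m len unfolding m_def[symmetric] by (simp add: rev_nth)
  qed
  then show "(\<Prod>j<p. f (as ! j) (rev (map t bs) ! ((nat ((- k - 1) mod int p) + p - j) mod p))) =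
    (\<Prod>i=1..int p. f (cyc as i) (t (cyc bs (k + i))))"
    unfolding prod_cyc[OF len(1) p, of "\<lambda>x i. f x (t (cyc bs (k + i)))"] by (intro prod.cong) auto
next
  fix l assume l: "l \<in> {..<p}"
  have "(- ((- int l - 2) mod int p + 1) - 1) mod int p = (- ((- int l - 2) mod int p) - 2) mod int p"
    by (rule arg_cong[of _ _ "\<lambda>x. x mod int p"]) simp
  also have "\<dots> = (- (- int l - 2) - 2) mod int p" by (metis mod_diff_left_eq mod_minus_eq)
  also have "\<dots> = int l" using l by simp
  finally show "nat ((- ((- int l - 2) mod int p + 1) - 1) mod int p) = l" by simp
  have "0 \<le> (- int l - 2) mod int p" "(- int l - 2) mod int p < int p" using p by simp_all
  then show "(- int l - 2) mod int p + 1 \<in> {1..int p}"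
    unfolding atLeastAtMost_iff by linarith
qed

lemma alt_zip:
  assumes "centered_alternating (lim_space I \<gamma> \<theta>) I
    (\<lambda>i. gen_subalgebra (lim_space I \<gamma> \<theta>) {gen i, star (lim_space I \<gamma> \<theta>) (gen i)}) cs as"
  shows "ell.alt I \<gamma> (zip cs as)" "lprod (zip cs as) = prod_list as" "zip cs as \<noteq> []" "length cs = length as"
proof -
  have len: "length cs = length as" and ne: "as \<noteq> []" and adj: "distinct_adj cs"
    and as: "\<And>r. r < length as \<Longrightarrow> as ! r \<in> colp index (cs ! r) \<and> linext (phiw (ell_cov I \<gamma>)) (as ! r) = 0"
    using assms gen_subalgebra_colp unfolding centered_alternating_def by fastforce+
  show "length cs = length as" by (rule len)
  show "zip cs as \<noteq> []" using len ne by (cases cs; cases as) auto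
  show "lprod (zip cs as) = prod_list as" using len by (simp add: lprod_def)
  show "ell.alt I \<gamma> (zip cs as)"
    unfolding ell.alt_def using len adj as by (auto simp: set_zip)
qed

lemma free_lim_space:
  "free_family (lim_space I \<gamma> \<theta>) I (\<lambda>i. gen_subalgebra (lim_space I \<gamma> \<theta>) {gen i, star (lim_space I \<gamma> \<theta>) (gen i)})"
  unfolding free_family_def list_mult_lim_space lim_space_simps(7)
proof (intro allI impI)
  fix cs as assume "centered_alternating (lim_space I \<gamma> \<theta>) I
    (\<lambda>i. gen_subalgebra (lim_space I \<gamma> \<theta>) {gen i, star (lim_space I \<gamma> \<theta>) (gen i)}) cs as"
  note Z = alt_zip[OF this]
  show "linext (phiw (ell_cov I \<gamma>)) (prod_list as) = 0"
    using ell.phi_alt[OF Z(1,3)] unfolding Z(2) .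
qed

text \<open>\<open>lim2\<close> combines two values of \<open>gw\<close>, the second at the
  transposed argument. Transposition turns a centered cyclically alternating product into another
  one in reverse order, so \<open>G_rotations\<close> applies to both and gives the two
  sums.\<close>

lemma phi2_lim_space:
  fixes I :: "'i set" and \<gamma> :: "'i \<Rightarrow> real" and \<theta> :: complex
  defines "Sub \<equiv> \<lambda>i. gen_subalgebra (lim_space I \<gamma> \<theta>) {gen i, star (lim_space I \<gamma> \<theta>) (gen i)}"
  assumes as: "centered_cyc_alternating (lim_space I \<gamma> \<theta>) I Sub cs as"
    and bs: "centered_cyc_alternating (lim_space I \<gamma> \<theta>) I Sub ds bs"
  shows "phi2 (lim_space I \<gamma> \<theta>) (list_mult (lim_space I \<gamma> \<theta>) as) (list_mult (lim_space I \<gamma> \<theta>) bs) =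
    (if length as = length bs then
       (\<Sum>k=1..int (length as).
          (\<Prod>i=1..int (length as). linext (phiw (ell_cov I \<gamma>)) (cyc as i * cyc bs (k - i))) +
          \<theta> * (\<Prod>i=1..int (length as). linext (phiw (ell_cov I \<gamma>)) (cyc as i * ptr (cyc bs (k + i)))))
     else 0)"
proof -
  let ?\<phi> = "linext (phiw (ell_cov I \<gamma>))" and ?G = "bilext (gw (ell_cov I \<gamma>))"
  note Za = alt_zip[OF as[unfolded centered_cyc_alternating_def Sub_def, THEN conjunct1]]
  note Zb = alt_zip[OF bs[unfolded centered_cyc_alternating_def Sub_def, THEN conjunct1]]
  let ?L = "zip cs as" and ?K = "zip ds bs"
  let ?K' = "rev (map (apsnd ptr) ?K)"
  have ends: "fst (last (zip cs as)) = last cs" "fst (hd (zip cs as)) = hd cs"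
    if "length cs = length as" "zip cs as \<noteq> []" for cs :: "'i list" and as :: "'i star_poly list"
    using that by (simp_all add: last_zip hd_zip)
  have ca: "fst (last ?L) \<noteq> fst (hd ?L)" and cb: "fst (last ?K) \<noteq> fst (hd ?K)"
    using as bs ends[OF Za(4,3)] ends[OF Zb(4,3)] unfolding centered_cyc_alternating_def by simp_all
  have K': "ell.alt I \<gamma> ?K'" "?K' \<noteq> []" "fst (last ?K') \<noteq> fst (hd ?K')"
    using alt_ptr[OF Zb(1)] Zb(3) cb by (auto simp: last_rev hd_rev hd_map last_map)
  have nth: "snd (zip cs as ! j) = as ! j" if "j < length as" for j
    using that Za(4) by simp
  have G1: "?G (lprod ?L) (lprod ?K) = (if length as = length bs then
     \<Sum>k=1..int (length as). \<Prod>i=1..int (length as). ?\<phi> (cyc as i * cyc bs (k - i)) else 0)"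
  proof (cases "length as = length bs")
    case True
    have "length as > 0" using Za(3,4) by auto
    from cyc_sum_spoke[OF refl True[symmetric] this, of "\<lambda>a b. ?\<phi> (a * b)"]
    show ?thesis
      using Za(4) Zb(4) True \<open>length as > 0\<close>
      unfolding G_rotations[OF Za(1,3) ca Zb(1,3) cb] by simp
  next
    case False
    then show ?thesis using Za(4) Zb(4) unfolding G_rotations[OF Za(1,3) ca Zb(1,3) cb] by simp
  qed
  have G2: "?G (lprod ?L) (lprod ?K') = (if length as = length bs then
     \<Sum>k=1..int (length as). \<Prod>i=1..int (length as). ?\<phi> (cyc as i * ptr (cyc bs (k + i))) else 0)"
  proof (cases "length as = length bs")
    case True
    have p: "length as > 0" using Za(3,4) by auto
    have K: "snd (?K' ! m) = rev (map ptr bs) ! m" if "m < length bs" for m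
      using that Zb(4) by (simp add: rev_nth)
    have K2: "snd (?K' ! ((l + length as - j) mod length as)) = rev (map ptr bs) ! ((l + length as - j) mod length as)" for l j
      using p True by (intro K) simp
    have "length ?L = length as" "length ?K' = length bs" using Za(4) Zb(4) by simp_all
    then show ?thesis
      unfolding G_rotations[OF Za(1,3) ca K'] cyc_sum_transposed[OF refl True[symmetric] p, of "\<lambda>a b. ?\<phi> (a * b)"]
      using True K2 Za(4) by (auto intro!: sum.cong prod.cong)
  next
    case False
    then show ?thesis using Za(4) Zb(4) unfolding G_rotations[OF Za(1,3) ca K'] by simp
  qed
  show ?thesis
    unfolding list_mult_lim_space lim_space_simps bilext_lim2 Za(2)[symmetric] Zb(2)[symmetric] ptr_lprod G1 G2
    by (simp add: sum.distrib sum_distrib_left)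
qed

lemma second_order_free_lim_space:
  "second_order_free (lim_space I \<gamma> 0) I (\<lambda>i. gen_subalgebra (lim_space I \<gamma> 0) {gen i, star (lim_space I \<gamma> 0) (gen i)})"
  unfolding second_order_free_def
proof (intro conjI allI impI free_lim_space)
  fix cs as ds bs
  assume "centered_cyc_alternating (lim_space I \<gamma> 0) I (\<lambda>i. gen_subalgebra (lim_space I \<gamma> 0) {gen i, star (lim_space I \<gamma> 0) (gen i)}) cs as"
    "centered_cyc_alternating (lim_space I \<gamma> 0) I (\<lambda>i. gen_subalgebra (lim_space I \<gamma> 0) {gen i, star (lim_space I \<gamma> 0) (gen i)}) ds bs"
  from phi2_lim_space[OF this]
  show "phi2 (lim_space I \<gamma> 0) (list_mult (lim_space I \<gamma> 0) as) (list_mult (lim_space I \<gamma> 0) bs) =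
    (if length as = length bs then \<Sum>k=1..int (length as). \<Prod>i=1..int (length as).
       phi1 (lim_space I \<gamma> 0) (cyc as i \<otimes>\<^bsub>lim_space I \<gamma> 0\<^esub> cyc bs (k - i)) else 0)"
    by (simp only: lim_space_simps mult_zero_left add_0_right)
qed

lemma real_second_order_free_lim_space:
  "real_second_order_free (lim_space I \<gamma> 1) ptr I (\<lambda>i. gen_subalgebra (lim_space I \<gamma> 1) {gen i, star (lim_space I \<gamma> 1) (gen i)})"
  unfolding real_second_order_free_def
proof (intro conjI allI impI free_lim_space)
  fix cs as ds bs
  assume "centered_cyc_alternating (lim_space I \<gamma> 1) I (\<lambda>i. gen_subalgebra (lim_space I \<gamma> 1) {gen i, star (lim_space I \<gamma> 1) (gen i)}) cs as"
    "centered_cyc_alternating (lim_space I \<gamma> 1) I (\<lambda>i. gen_subalgebra (lim_space I \<gamma> 1) {gen i, star (lim_space I \<gamma> 1) (gen i)}) ds bs"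
  from phi2_lim_space[OF this]
  show "phi2 (lim_space I \<gamma> 1) (list_mult (lim_space I \<gamma> 1) as) (list_mult (lim_space I \<gamma> 1) bs) =
    (if length as = length bs then \<Sum>k=1..int (length as).
       (\<Prod>i=1..int (length as). phi1 (lim_space I \<gamma> 1) (cyc as i \<otimes>\<^bsub>lim_space I \<gamma> 1\<^esub> cyc bs (k - i))) +
       (\<Prod>i=1..int (length as). phi1 (lim_space I \<gamma> 1) (cyc as i \<otimes>\<^bsub>lim_space I \<gamma> 1\<^esub> ptr (cyc bs (k + i)))) else 0)"
    by (simp only: lim_space_simps mult_1_left)
qed

section \<open>Convergence of cumulants\<close>

lemma cumulant_mcum: "cumulant M \<xi>s = mcum (\<lambda>B. \<integral>w. (\<Prod>j\<in>B. (\<xi>s ! j) w) \<partial>M) {..<length \<xi>s}"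
  by (simp add: cumulant_def mcum_def)

lemma cumulant_cong:
  assumes "length \<xi>s = length \<zeta>s" "\<And>j w. j < length \<xi>s \<Longrightarrow> w \<in> space M \<Longrightarrow> (\<xi>s ! j) w = (\<zeta>s ! j) w"
  shows "cumulant M \<xi>s = cumulant M \<zeta>s"
  unfolding cumulant_def assms(1)
proof (intro sum.cong refl arg_cong2[of _ _ _ _ "(*)"] prod.cong Bochner_Integration.integral_cong)
  fix \<pi> B w j assume "\<pi> \<in> {\<pi>. partition_on {..<length \<zeta>s} \<pi>}" "B \<in> \<pi>" "w \<in> space M" "j \<in> B"
  then show "(\<xi>s ! j) w = (\<zeta>s ! j) w"
    using assms(1) by (intro assms(2)) (auto simp: partition_on_def)
qed

lemma lcum_map: "lcum m (map f xs) = lcum (\<lambda>ys. m (map f ys)) xs" if "m [] = 1"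
proof (cases xs)
  case (Cons x ys)
  have "lcum m (map f (x # ys)) = lcum (\<lambda>ys. m (map f ys)) (x # ys)"
  proof (rule lcum_unique[of "\<lambda>ys. m (map f ys)" ys "\<lambda>ys. m (map f (x # ys))" "\<lambda>B. lcum m (map f (x # B))" "\<lambda>B. lcum (\<lambda>ys. m (map f ys)) (x # B)"])
    show "m (map f (x # zs)) = ssum zs (\<lambda>B C. lcum m (map f (x # B)) * m (map f C))" for zs
      using lcum_eq[of m "f x" "map f zs"] that by (simp add: ssum_map)
    show "m (map f (x # zs)) = ssum zs (\<lambda>B C. lcum (\<lambda>ys. m (map f ys)) (x # B) * m (map f C))" for zs
      using lcum_eq[of "\<lambda>ys. m (map f ys)" x zs] that by simp
  qed (simp add: that)
  then show ?thesis by (simp only: Cons)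
qed (simp add: lcum.simps)

definition list_moment :: "'w measure \<Rightarrow> ('w \<Rightarrow> complex) list \<Rightarrow> complex" where
  "list_moment M \<xi>s = (\<integral>w. (\<Prod>\<xi>\<leftarrow>\<xi>s. \<xi> w) \<partial>M)"

text \<open>Entries are labelled by their positions, which are distinct even if random variables
  repeat.\<close>

lemma (in prob_space) cumulant_lcum:
  assumes "\<xi>s \<noteq> []"
  shows "cumulant M \<xi>s = lcum (list_moment M) \<xi>s"
proof -
  have "mcum (\<lambda>B. \<integral>w. (\<Prod>j\<in>B. (\<xi>s ! j) w) \<partial>M) (set [0..<length \<xi>s]) = lcum (list_moment M) (map ((!) \<xi>s) [0..<length \<xi>s])"
  proof (rule mcum_lcum)
    fix ks :: "nat list" assume "distinct ks"
    then show "(\<integral>w. (\<Prod>j\<in>set ks. (\<xi>s ! j) w) \<partial>M) = list_moment M (map ((!) \<xi>s) ks)"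
      by (simp add: list_moment_def prod.distinct_set_conv_list comp_def)
  qed (use assms in \<open>simp_all add: list_moment_def prob_space\<close>)
  then show ?thesis by (simp add: cumulant_mcum map_nth atLeast0LessThan)
qed

text \<open>In every partition exactly one block contains \<open>j\<close>, so only one factor of
  the product changes, and it does so linearly.\<close>

lemma mcum_linear:
  assumes fin: "finite S" "finite A" and j: "j \<in> S"
    and out: "\<And>B u. B \<subseteq> S \<Longrightarrow> j \<notin> B \<Longrightarrow> u \<in> A \<Longrightarrow> mu u B = m B"
    and "in": "\<And>B. B \<subseteq> S \<Longrightarrow> j \<in> B \<Longrightarrow> m B = (\<Sum>u\<in>A. p u * mu u B)"
  shows "mcum m S = (\<Sum>u\<in>A. p u * mcum (mu u) S)"
proof -
  have "(\<Prod>B\<in>\<pi>. m B) = (\<Sum>u\<in>A. p u * (\<Prod>B\<in>\<pi>. mu u B))" if \<pi>: "partition_on S \<pi>" for \<pi>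
  proof -
    have f: "finite \<pi>" using \<pi> fin(1) finite_elements by blast
    obtain B0 where B0: "B0 \<in> \<pi>" "j \<in> B0" using \<pi> j unfolding partition_on_def by auto
    have sub: "B \<subseteq> S" if "B \<in> \<pi>" for B using \<pi> that unfolding partition_on_def by auto
    have nin: "j \<notin> B" if "B \<in> \<pi> - {B0}" for B
      using \<pi> that B0 unfolding partition_on_def disjoint_def by auto
    have rest: "(\<Prod>B\<in>\<pi> - {B0}. mu u B) = (\<Prod>B\<in>\<pi> - {B0}. m B)" if "u \<in> A" for u
      using sub nin that by (intro prod.cong refl out) auto
    show ?thesis
      unfolding prod.remove[OF f B0(1)] "in"[OF sub[OF B0(1)] B0(2)] sum_distrib_right
      by (intro sum.cong refl) (simp add: rest mult.assoc)
  qed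
  then have "mcum m S = (\<Sum>\<pi> | partition_on S \<pi>. \<Sum>u\<in>A. p u * ((-1) ^ (card \<pi> - 1) * fact (card \<pi> - 1) * (\<Prod>B\<in>\<pi>. mu u B)))"
    unfolding mcum_def by (intro sum.cong refl) (simp add: sum_distrib_left mult_ac)
  also have "\<dots> = (\<Sum>u\<in>A. p u * mcum (mu u) S)"
    unfolding mcum_def sum_distrib_left by (rule sum.swap)
  finally show ?thesis .
qed

lemma cumulant_linear:
  fixes \<tau> :: "'u \<Rightarrow> 'w \<Rightarrow> complex"
  assumes fin: "finite A"
    and int: "\<And>B u. B \<subseteq> {..<length xs + length ys + 1} \<Longrightarrow> u \<in> A \<Longrightarrow>
      integrable M (\<lambda>w. \<Prod>j\<in>B. ((xs @ \<tau> u # ys) ! j) w)"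
  shows "cumulant M (xs @ (\<lambda>w. \<Sum>u\<in>A. p u * \<tau> u w) # ys) = (\<Sum>u\<in>A. p u * cumulant M (xs @ \<tau> u # ys))"
proof -
  let ?n = "length xs + length ys + 1" and ?j = "length xs"
  let ?x = "xs @ (\<lambda>w. \<Sum>u\<in>A. p u * \<tau> u w) # ys"
  have len: "length ?x = ?n" "length (xs @ \<tau> u # ys) = ?n" for u by simp_all
  have same: "(?x ! j) w = ((xs @ \<tau> u # ys) ! j) w" if "j \<noteq> ?j" for u j w
    using that by (cases "j < ?j") (simp_all add: nth_append nth_Cons')
  show ?thesis
    unfolding cumulant_mcum len
  proof (rule mcum_linear[of _ _ ?j])
    fix B u assume "?j \<notin> B"
    then have "(\<Prod>j\<in>B. ((xs @ \<tau> u # ys) ! j) w) = (\<Prod>j\<in>B. (?x ! j) w)" for w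
      by (intro prod.cong[OF refl] same[symmetric]) blast
    then show "(\<integral>w. (\<Prod>j\<in>B. ((xs @ \<tau> u # ys) ! j) w) \<partial>M) = (\<integral>w. (\<Prod>j\<in>B. (?x ! j) w) \<partial>M)"
      by (simp only:)
  next
    fix B assume B: "B \<subseteq> {..<?n}" "?j \<in> B"
    then have fB: "finite B" by (meson finite_lessThan finite_subset)
    have eq: "(\<Prod>j\<in>B. (?x ! j) w) = (\<Sum>u\<in>A. p u * (\<Prod>j\<in>B. ((xs @ \<tau> u # ys) ! j) w))" for w
    proof -
      have "(\<Prod>j\<in>B - {?j}. (?x ! j) w) = (\<Prod>j\<in>B - {?j}. ((xs @ \<tau> u # ys) ! j) w)" for u
        by (intro prod.cong[OF refl] same) blast
      then show ?thesis
        unfolding prod.remove[OF fB B(2)] by (simp add: sum_distrib_right mult.assoc)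
    qed
    show "(\<integral>w. (\<Prod>j\<in>B. (?x ! j) w) \<partial>M) = (\<Sum>u\<in>A. p u * (\<integral>w. (\<Prod>j\<in>B. ((xs @ \<tau> u # ys) ! j) w) \<partial>M))"
      unfolding eq using int[OF B(1)] by (simp add: Bochner_Integration.integral_sum)
  qed (use fin in auto)
qed

text \<open>This is all that the limit argument uses of the matrices. Nothing is asked for
  \<open>N = 0\<close>, which limits do not see.\<close>

definition trace_model ::
  "(nat \<Rightarrow> 'w measure) \<Rightarrow> (nat \<Rightarrow> 'i letter list \<Rightarrow> 'w \<Rightarrow> complex) \<Rightarrow> ('i letter \<Rightarrow> 'i letter \<Rightarrow> complex) \<Rightarrow> complex \<Rightarrow> bool" where
  "trace_model M T b \<theta> \<longleftrightarrow> (\<forall>N>0. prob_space (M N) \<and>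
     (\<forall>Us. integrable (M N) (\<lambda>w. \<Prod>u\<leftarrow>Us. T N u w)) \<and>
     loop_moments N b flip \<theta> (\<lambda>Us. \<integral>w. (\<Prod>u\<leftarrow>Us. T N u w) \<partial>M N) \<and>
     (\<forall>u v w. T N (u @ v) w = T N (v @ u) w))"

locale trace_model_loc =
  fixes M :: "nat \<Rightarrow> 'w measure" and T :: "nat \<Rightarrow> 'i letter list \<Rightarrow> 'w \<Rightarrow> complex" and b \<theta>
  assumes model: "trace_model M T b \<theta>"
begin

definition tpoly :: "nat \<Rightarrow> 'i star_poly \<Rightarrow> 'w \<Rightarrow> complex" where
  "tpoly N P w = (\<Sum>u\<in>Poly_Mapping.keys P. Poly_Mapping.lookup P u * T N u w)"

lemma tpoly_mon: "tpoly N (mon u) = T N u"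
  by (simp add: tpoly_def[abs_def] mon_def)

lemma integrable_T: "N > 0 \<Longrightarrow> integrable (M N) (\<lambda>w. \<Prod>u\<leftarrow>Us. T N u w)"
  using model unfolding trace_model_def by blast

text \<open>Polynomials are traded for words one at a time; the list \<open>Us\<close> holds the
  words already produced.\<close>

lemma integrable_tpoly_T:
  "N > 0 \<Longrightarrow> integrable (M N) (\<lambda>w. (\<Prod>P\<leftarrow>Ps. tpoly N P w) * (\<Prod>u\<leftarrow>Us. T N u w))"
proof (induction Ps arbitrary: Us)
  case (Cons P Ps)
  have "(\<Prod>P\<leftarrow>P # Ps. tpoly N P w) * (\<Prod>u\<leftarrow>Us. T N u w) =
    (\<Sum>u\<in>Poly_Mapping.keys P. Poly_Mapping.lookup P u * ((\<Prod>P\<leftarrow>Ps. tpoly N P w) * (\<Prod>u\<leftarrow>u # Us. T N u w)))" for w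
    by (simp add: tpoly_def[of N P] sum_distrib_left sum_distrib_right mult_ac)
  then show ?case
    using Cons by (simp only:) (intro Bochner_Integration.integrable_sum integrable_mult_right Cons.IH, simp)
qed (simp add: integrable_T)

lemma integrable_tpoly: "N > 0 \<Longrightarrow> integrable (M N) (\<lambda>w. \<Prod>P\<leftarrow>Ps. tpoly N P w)"
  using integrable_tpoly_T[of N Ps "[]"] by simp

lemma integrable_tpoly_subset:
  assumes "N > 0" "B \<subseteq> {..<length Ps}"
  shows "integrable (M N) (\<lambda>w. \<Prod>j\<in>B. (map (tpoly N) Ps ! j) w)"
proof -
  have "finite B" using assms(2) finite_subset by blast
  then obtain js where js: "set js = B" "distinct js" using finite_distinct_list by blast
  have "(\<Prod>j\<in>B. (map (tpoly N) Ps ! j) w) = (\<Prod>P\<leftarrow>map ((!) Ps) js. tpoly N P w)" for w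
  proof -
    have "(\<Prod>j\<in>B. (map (tpoly N) Ps ! j) w) = (\<Prod>j\<in>B. tpoly N (Ps ! j) w)"
      using assms(2) by (intro prod.cong refl) auto
    then show ?thesis
      using prod.distinct_set_conv_list[OF js(2), of "\<lambda>j. tpoly N (Ps ! j) w"] by (simp add: js(1) comp_def)
  qed
  then show ?thesis by (simp only: integrable_tpoly[OF assms(1)])
qed

lemma cumulant_expand:
  assumes "N > 0"
  shows "cumulant (M N) (map (tpoly N) (Ps @ P # Qs)) =
    (\<Sum>u\<in>Poly_Mapping.keys P. Poly_Mapping.lookup P u * cumulant (M N) (map (tpoly N) (Ps @ mon u # Qs)))"
proof -
  have "tpoly N P = (\<lambda>w. \<Sum>u\<in>Poly_Mapping.keys P. Poly_Mapping.lookup P u * tpoly N (mon u) w)"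
    by (simp add: fun_eq_iff tpoly_def[of N P] tpoly_mon)
  then have "cumulant (M N) (map (tpoly N) (Ps @ P # Qs)) = cumulant (M N) (map (tpoly N) Ps @
    (\<lambda>w. \<Sum>u\<in>Poly_Mapping.keys P. Poly_Mapping.lookup P u * tpoly N (mon u) w) # map (tpoly N) Qs)"
    by (simp only: map_append list.map)
  also have "\<dots> = (\<Sum>u\<in>Poly_Mapping.keys P. Poly_Mapping.lookup P u * cumulant (M N) (map (tpoly N) Ps @ tpoly N (mon u) # map (tpoly N) Qs))"
  proof (rule cumulant_linear)
    fix B u assume "B \<subseteq> {..<length (map (tpoly N) Ps) + length (map (tpoly N) Qs) + 1}"
    then have "B \<subseteq> {..<length (Ps @ mon u # Qs)}" by simp
    from integrable_tpoly_subset[OF assms this]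
    show "integrable (M N) (\<lambda>w. \<Prod>j\<in>B. ((map (tpoly N) Ps @ tpoly N (mon u) # map (tpoly N) Qs) ! j) w)" by simp
  qed simp
  finally show ?thesis by simp
qed

definition mo :: "nat \<Rightarrow> 'i letter list list \<Rightarrow> complex" where
  "mo N Us = (\<integral>w. (\<Prod>u\<leftarrow>Us. T N u w) \<partial>M N)"

lemma loop: "N > 0 \<Longrightarrow> loop_moments N b flip \<theta> (mo N)"
  using model unfolding trace_model_def mo_def[abs_def] by blast

lemma cumulant_words:
  assumes "N > 0" "Us \<noteq> []"
  shows "cumulant (M N) (map (tpoly N) (map mon Us)) = lcum (mo N) Us"
proof -
  interpret prob_space "M N" using model assms(1) unfolding trace_model_def by blast
  have "cumulant (M N) (map (tpoly N) (map mon Us)) = cumulant (M N) (map (T N) Us)"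
    by (simp add: tpoly_mon comp_def)
  also have "\<dots> = lcum (list_moment (M N)) (map (T N) Us)"
    by (rule cumulant_lcum) (use assms in simp)
  also have "\<dots> = lcum (\<lambda>Us. list_moment (M N) (map (T N) Us)) Us"
    by (rule lcum_map) (simp add: list_moment_def prob_space)
  also have "(\<lambda>Us. list_moment (M N) (map (T N) Us)) = mo N"
    by (rule ext) (simp add: list_moment_def mo_def comp_def)
  finally show ?thesis .
qed

lemma cumulant_words_limit:
  assumes "length Us \<ge> 2"
  shows "(\<lambda>N. cumulant (M N) (map (tpoly N) (map mon Us))) \<longlonglongrightarrow> cum_limit b flip \<theta> Us"
proof -
  have ne: "Us \<noteq> []" "length Us \<noteq> 1" using assms by auto
  have "(\<lambda>N. lcum (mo N) Us) \<longlonglongrightarrow> cum_limit b flip \<theta> Us"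
    using cumulant_limits[of b flip \<theta> mo Us, OF loop ne(1)] ne(2) by simp
  moreover have "\<forall>\<^sub>F N in sequentially. lcum (mo N) Us = cumulant (M N) (map (tpoly N) (map mon Us))"
    using eventually_gt_at_top[of 0] by eventually_elim (rule cumulant_words[OF _ ne(1), symmetric])
  ultimately show ?thesis by (rule Lim_transform_eventually)
qed

lemma cumulant_expand_limit:
  assumes "\<And>u. u \<in> Poly_Mapping.keys P \<Longrightarrow>
    (\<lambda>N. cumulant (M N) (map (tpoly N) (Ps @ mon u # Qs))) \<longlonglongrightarrow> l u"
  shows "(\<lambda>N. cumulant (M N) (map (tpoly N) (Ps @ P # Qs))) \<longlonglongrightarrow> linext l P"
proof -
  have "(\<lambda>N. \<Sum>u\<in>Poly_Mapping.keys P. Poly_Mapping.lookup P u * cumulant (M N) (map (tpoly N) (Ps @ mon u # Qs))) \<longlonglongrightarrow>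
    linext l P"
    unfolding linext_def by (intro tendsto_sum tendsto_mult tendsto_const assms)
  moreover have "\<forall>\<^sub>F N in sequentially. (\<Sum>u\<in>Poly_Mapping.keys P. Poly_Mapping.lookup P u *
    cumulant (M N) (map (tpoly N) (Ps @ mon u # Qs))) = cumulant (M N) (map (tpoly N) (Ps @ P # Qs))"
    using eventually_gt_at_top[of 0] by eventually_elim (rule cumulant_expand[symmetric])
  ultimately show ?thesis by (rule Lim_transform_eventually)
qed

lemma covariance_limit:
  "(\<lambda>N. cumulant (M N) [tpoly N P, tpoly N Q]) \<longlonglongrightarrow> bilext (lim2 b flip \<theta>) P Q"
proof -
  have "(\<lambda>N. cumulant (M N) (map (tpoly N) ([] @ P # [Q]))) \<longlonglongrightarrow> linext (\<lambda>u. linext (lim2 b flip \<theta> u) Q) P"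
  proof (rule cumulant_expand_limit)
    fix u
    have "(\<lambda>N. cumulant (M N) (map (tpoly N) ([mon u] @ Q # []))) \<longlonglongrightarrow> linext (lim2 b flip \<theta> u) Q"
    proof (rule cumulant_expand_limit)
      fix v
      show "(\<lambda>N. cumulant (M N) (map (tpoly N) ([mon u] @ mon v # []))) \<longlonglongrightarrow> lim2 b flip \<theta> u v"
        using cumulant_words_limit[of "[u, v]"] by (simp add: cum_limit_def)
    qed
    then show "(\<lambda>N. cumulant (M N) (map (tpoly N) ([] @ mon u # [Q]))) \<longlonglongrightarrow> linext (lim2 b flip \<theta> u) Q" by simp
  qed
  then show ?thesis by (simp add: bilext_def)
qed

lemma higher_cumulant_limit:
  assumes "length Ps \<ge> 3"
  shows "(\<lambda>N. cumulant (M N) (map (tpoly N) Ps)) \<longlonglongrightarrow> 0"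
proof -
  \<comment> \<open>Polynomials are expanded from the right end; those not yet expanded form the
    prefix \<open>Ps\<close>.\<close>
  have "(\<lambda>N. cumulant (M N) (map (tpoly N) (Ps @ map mon Us))) \<longlonglongrightarrow> 0" if "length Ps + length Us \<ge> 3" for Us
    using that
  proof (induction Ps arbitrary: Us rule: rev_induct)
    case Nil
    then have "cum_limit b flip \<theta> Us = 0" by (auto simp: cum_limit_def split: list.split)
    then show ?case using cumulant_words_limit[of Us] Nil by simp
  next
    case (snoc P Ps)
    have "(\<lambda>N. cumulant (M N) (map (tpoly N) (Ps @ P # map mon Us))) \<longlonglongrightarrow> linext (\<lambda>_. 0) P"
      by (rule cumulant_expand_limit) (use snoc.IH[of "_ # Us"] snoc.prems in simp)
    then show ?case by (simp add: linext_def)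
  qed
  from this[of "[]"] assms show ?thesis by simp
qed

lemma expectation_limit:
  "(\<lambda>N. \<integral>w. tpoly N P w / of_nat N \<partial>M N) \<longlonglongrightarrow> linext (phiw b) P"
proof -
  have "(\<lambda>N. mo N [u] / of_nat N) \<longlonglongrightarrow> phiw b u" for u
  proof -
    have "lcum (mo N) [u] = mo N [u]" for N by (simp add: lcum.simps)
    then show ?thesis
      using cumulant_limits[of b flip \<theta> mo "[u]", OF loop] by (simp add: cum_limit_def)
  qed
  then have "(\<lambda>N. \<Sum>u\<in>Poly_Mapping.keys P. Poly_Mapping.lookup P u * (mo N [u] / of_nat N)) \<longlonglongrightarrow> linext (phiw b) P"
    unfolding linext_def by (intro tendsto_sum tendsto_mult tendsto_const)
  moreover have "\<forall>\<^sub>F N in sequentially. (\<Sum>u\<in>Poly_Mapping.keys P. Poly_Mapping.lookup P u * (mo N [u] / of_nat N)) =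
    (\<integral>w. tpoly N P w / of_nat N \<partial>M N)"
    using eventually_gt_at_top[of 0]
  proof eventually_elim
    case (elim N)
    have "integrable (M N) (T N u)" for u using integrable_T[OF elim, of "[u]"] by simp
    then have "(\<integral>w. (\<Sum>u\<in>Poly_Mapping.keys P. Poly_Mapping.lookup P u * T N u w) \<partial>M N) =
      (\<Sum>u\<in>Poly_Mapping.keys P. \<integral>w. Poly_Mapping.lookup P u * T N u w \<partial>M N)"
      by (intro Bochner_Integration.integral_sum integrable_mult_right)
    moreover have "mo N [u] = (\<integral>w. T N u w \<partial>M N)" for u by (simp add: mo_def)
    ultimately show ?case
      unfolding tpoly_def integral_divide_zero integral_mult_right_zero by (simp only: sum_divide_distrib times_divide_eq_right)
  qed
  ultimately show ?thesis by (rule Lim_transform_eventually)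
qed

lemma lim2_limit: "(\<lambda>N. mo N [u, v] - mo N [u] * mo N [v]) \<longlonglongrightarrow> lim2 b flip \<theta> u v"
proof -
  have ev: "\<forall>\<^sub>F N in sequentially. cumulant (M N) (map (tpoly N) (map mon [u, v])) = mo N [u, v] - mo N [u] * mo N [v]"
    using eventually_gt_at_top[of 0]
  proof eventually_elim
    case (elim N)
    have "cumulant (M N) (map (tpoly N) (map mon [u, v])) = lcum (mo N) [u, v]"
      by (rule cumulant_words[OF elim]) simp
    also have "\<dots> = mo N [u, v] - mo N [u] * mo N [v]" by (simp add: lcum.simps)
    finally show ?case .
  qed
  have "(\<lambda>N. cumulant (M N) (map (tpoly N) (map mon [u, v]))) \<longlonglongrightarrow> lim2 b flip \<theta> u v"
    using cumulant_words_limit[of "[u, v]"] by (simp add: cum_limit_def)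
  from this ev show ?thesis by (rule Lim_transform_eventually)
qed

text \<open>The recursion for \<open>gw\<close> treats its two arguments differently; the symmetry
  is visible on the covariances of traces, of which \<open>lim2\<close> is the limit.\<close>

lemma lim2_sym: "lim2 b flip \<theta> u v = lim2 b flip \<theta> v u"
proof -
  have "mo N [u, v] = mo N [v, u]" for N by (simp add: mo_def mult.commute)
  then have "(\<lambda>N. mo N [u, v] - mo N [u] * mo N [v]) = (\<lambda>N. mo N [v, u] - mo N [v] * mo N [u])"
    by (intro ext) (simp only: mult.commute)
  with lim2_limit[of u v] have "(\<lambda>N. mo N [v, u] - mo N [v] * mo N [u]) \<longlonglongrightarrow> lim2 b flip \<theta> u v"
    by (simp only:)
  then show ?thesis using lim2_limit[of v u] by (rule LIMSEQ_unique)
qed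

lemma lim2_trace: "lim2 b flip \<theta> (u @ u') v = lim2 b flip \<theta> (u' @ u) v"
proof -
  have "\<forall>\<^sub>F N in sequentially. mo N [u @ u', v] - mo N [u @ u'] * mo N [v] = mo N [u' @ u, v] - mo N [u' @ u] * mo N [v]"
    using eventually_gt_at_top[of 0]
  proof eventually_elim
    case (elim N)
    then have "T N (u @ u') = T N (u' @ u)" using model unfolding trace_model_def by blast
    then show ?case by (simp add: mo_def)
  qed
  from Lim_transform_eventually[OF lim2_limit this] lim2_limit[of "u' @ u" v]
  show ?thesis by (rule LIMSEQ_unique)
qed

end

section \<open>The limit theorem\<close>

text \<open>Symmetry and traciality of the second functional come from the matrices, whence the
  assumption of a model; the other axioms hold by computation in the free algebra.\<close>

lemma second_order_star_space_lim_space: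
  assumes "trace_model M T (ell_cov I \<gamma>) \<theta>"
  shows "second_order_star_space (lim_space I \<gamma> \<theta>)"
proof -
  interpret trace_model_loc M T "ell_cov I \<gamma>" \<theta> by unfold_locales (rule assms)
  let ?\<phi>2 = "bilext (lim2 (ell_cov I \<gamma>) flip \<theta>)"
  have l: "lin (?\<phi>2 P)" "lin (\<lambda>P. ?\<phi>2 P Q)" for P Q
    by (rule bilin_right[OF bilin_bilext], rule bilin_left[OF bilin_bilext])
  have sym: "?\<phi>2 P Q = ?\<phi>2 Q P" for P Q
  proof (rule bilin_eqI[OF bilin_bilext, of "\<lambda>P Q. ?\<phi>2 Q P"])
    show "bilin (\<lambda>P Q. ?\<phi>2 Q P)" by (rule bilinI; rule l)
    show "?\<phi>2 (mon u) (mon v) = ?\<phi>2 (mon v) (mon u)" for u v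
      unfolding bilext_mono by (rule lim2_sym)
  qed
  have trace: "?\<phi>2 (P * Q) R = ?\<phi>2 (Q * P) R" for P Q R
  proof (rule bilin_eqI[of "\<lambda>P Q. ?\<phi>2 (P * Q) R" "\<lambda>P Q. ?\<phi>2 (Q * P) R"])
    show "bilin (\<lambda>P Q. ?\<phi>2 (P * Q) R)" "bilin (\<lambda>P Q. ?\<phi>2 (Q * P) R)"
      by (rule bilinI; rule lin_mult_left[OF l(2)] lin_mult_right[OF l(2)])+
    fix u v
    show "?\<phi>2 (mon u * mon v) R = ?\<phi>2 (mon v * mon u) R"
      unfolding mon_append[symmetric]
    proof (rule lin_eqI[OF l(1) l(1)])
      show "?\<phi>2 (mon (u @ v)) (mon w) = ?\<phi>2 (mon (v @ u)) (mon w)" for w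
        unfolding bilext_mono by (rule lim2_trace)
    qed
  qed
  have one: "?\<phi>2 1 P = 0" for P
  proof -
    have "?\<phi>2 (mon []) P = 0"
      by (subst lin_eqI[OF l(1), of "\<lambda>_. 0"]) (simp_all only: lin_def bilext_mono lim2_def gw.simps mult_zero_right add_0_right simp_thms)
    then show ?thesis by simp
  qed
  have pst: "anti_involution (lim_space I \<gamma> \<theta>) cnj pstar"
    unfolding anti_involution_def lim_space_simps
    by (intro conjI ballI allI funcsetI pstar_pstar pstar_add pstar_scale pstar_mult) (rule pstar_star_polys)
  have phi1: "linext (phiw (ell_cov I \<gamma>)) 1 = 1"
    by (rule ell.phi_1)
  show ?thesis
    unfolding second_order_star_space_def
  proof (intro conjI ballI complex_algebra_lim_space)
    show "linear_functional (lim_space I \<gamma> \<theta>) (phi1 (lim_space I \<gamma> \<theta>))"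
      unfolding lim_space_simps by (rule linear_functional_lim_space[OF lin_linext])
    show "linear_functional (lim_space I \<gamma> \<theta>) (phi2 (lim_space I \<gamma> \<theta>) x)" for x
      unfolding lim_space_simps by (rule linear_functional_lim_space[OF l(1)])
    show "linear_functional (lim_space I \<gamma> \<theta>) (\<lambda>x. phi2 (lim_space I \<gamma> \<theta>) x y)" for y
      unfolding lim_space_simps by (rule linear_functional_lim_space[OF l(2)])
    show "anti_involution (lim_space I \<gamma> \<theta>) cnj (star (lim_space I \<gamma> \<theta>))"
      unfolding lim_space_simps by (rule pst)
  qed (simp_all only: lim_space_simps phi1 trace sym[of _ "_ * _"] one sym[of _ 1], (rule sym)?)
qed

lemma anti_involution_ptr: "anti_involution (lim_space I \<gamma> \<theta>) id ptr"
  unfolding anti_involution_def lim_space_simps id_apply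
  by (intro conjI ballI allI funcsetI ptr_ptr ptr_add ptr_scale ptr_mult) (rule ptr_star_polys)

section \<open>Matrix products and traces in terms of entry functions\<close>

lemma mat_adjoint_index:
  assumes "A \<in> carrier_mat N N" "j < N" "k < N"
  shows "mat_adjoint A $$ (j, k) = cnj (A $$ (k, j) :: complex)"
  using assms by (simp add: mat_adjoint_def mat_of_rows_index)

lemma mat_adjoint_carrier: "A \<in> carrier_mat N N \<Longrightarrow> mat_adjoint (A :: complex mat) \<in> carrier_mat N N"
  unfolding mat_adjoint_def by (intro carrier_matI) (auto dest: carrier_matD)

lemma module_mat_simps:
  "carrier (module_mat TYPE(complex) N N) = carrier_mat N N" "mult (module_mat TYPE(complex) N N) = (*)"
  "one (module_mat TYPE(complex) N N) = 1\<^sub>m N" "add (module_mat TYPE(complex) N N) = (+)"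
  "smult (module_mat TYPE(complex) N N) = (\<cdot>\<^sub>m)" "zero (module_mat TYPE(complex) N N) = 0\<^sub>m N N"
  by (simp_all add: module_mat_def)

lemma list_mult_mat:
  assumes "\<And>x. x \<in> set u \<Longrightarrow> A x \<in> carrier_mat N N"
    and "\<And>x j k. x \<in> set u \<Longrightarrow> j < N \<Longrightarrow> k < N \<Longrightarrow> A x $$ (j, k) = e x j k"
  shows "list_mult (module_mat TYPE(complex) N N) (map A u) = Matrix.mat N N (\<lambda>(i, j). ent e N u i j)"
  using assms
proof (induction u)
  case Nil
  show ?case by (rule eq_matI) (simp_all add: list_mult_def module_mat_simps)
next
  case (Cons x u)
  have A: "A x \<in> carrier_mat N N" using Cons.prems by simp
  have "list_mult (module_mat TYPE(complex) N N) (map A (x # u)) =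
    A x * list_mult (module_mat TYPE(complex) N N) (map A u)"
    by (simp add: list_mult_def module_mat_simps)
  also have "list_mult (module_mat TYPE(complex) N N) (map A u) = Matrix.mat N N (\<lambda>(i, j). ent e N u i j)"
    by (rule Cons.IH) (use Cons.prems in auto)
  also have "A x * \<dots> = Matrix.mat N N (\<lambda>(i, j). ent e N (x # u) i j)"
  proof (rule eq_matI)
    fix i j assume "i < dim_row (Matrix.mat N N (\<lambda>(i, j). ent e N (x # u) i j))" "j < dim_col (Matrix.mat N N (\<lambda>(i, j). ent e N (x # u) i j))"
    then have ij: "i < N" "j < N" by simp_all
    have "(A x * Matrix.mat N N (\<lambda>(i, j). ent e N u i j)) $$ (i, j) = (\<Sum>k<N. A x $$ (i, k) * ent e N u k j)"
      using A ij by (simp add: scalar_prod_def atLeast0LessThan)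
    also have "\<dots> = (\<Sum>k<N. e x i k * ent e N u k j)"
      using Cons.prems(2)[of x i] ij by (intro sum.cong refl) simp
    finally show "(A x * Matrix.mat N N (\<lambda>(i, j). ent e N u i j)) $$ (i, j) = Matrix.mat N N (\<lambda>(i, j). ent e N (x # u) i j) $$ (i, j)"
      using ij by simp
  qed (use A in simp_all)
  finally show ?case .
qed

lemma mat_trace_finsum:
  assumes "finite S" "\<And>u. u \<in> S \<Longrightarrow> f u \<in> carrier_mat N N"
  shows "finsum (module_mat TYPE(complex) N N) f S \<in> carrier_mat N N \<and>
    mat_trace (finsum (module_mat TYPE(complex) N N) f S) = (\<Sum>u\<in>S. mat_trace (f u))"
proof -
  interpret abelian_group "module_mat TYPE(complex) N N" by (rule abelian_group_mat)
  show ?thesis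
    using assms
  proof (induction S rule: finite_induct)
    case empty
    show ?case using finsum_empty[of f] by (simp add: module_mat_simps mat_trace_def)
  next
    case (insert u S)
    let ?R = "finsum (module_mat TYPE(complex) N N) f S"
    have R: "?R \<in> carrier_mat N N" "f u \<in> carrier_mat N N" and IH: "mat_trace ?R = (\<Sum>u\<in>S. mat_trace (f u))"
      using insert by auto
    have eq: "finsum (module_mat TYPE(complex) N N) f (insert u S) = f u + ?R"
      using finsum_insert[OF insert(1,2), of f] insert by (auto simp: module_mat_simps)
    have "mat_trace (f u + ?R) = mat_trace (f u) + mat_trace ?R"
      using R by (auto simp: mat_trace_def sum.distrib)
    then show ?case using insert(1,2) R IH unfolding eq by simp
  qed
qed

lemma trace_poly_eq:
  assumes P: "P \<in> star_polys I"
    and A: "\<And>i. i \<in> I \<Longrightarrow> X i w \<in> carrier_mat N N"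
    and e: "\<And>i j k. i \<in> I \<Longrightarrow> j < N \<Longrightarrow> k < N \<Longrightarrow> X i w $$ (j, k) = e (Var i) j k"
    and e': "\<And>i j k. i \<in> I \<Longrightarrow> j < N \<Longrightarrow> k < N \<Longrightarrow> cnj (X i w $$ (k, j)) = e (VarStar i) j k"
  shows "trace_poly N X P w = (\<Sum>u\<in>Poly_Mapping.keys P. Poly_Mapping.lookup P u * word_trace e N u)"
proof -
  let ?R = "module_mat TYPE(complex) N N"
  let ?A = "\<lambda>l. case l of Var i \<Rightarrow> X i w | VarStar i \<Rightarrow> mat_adjoint (X i w)"
  have lm: "list_mult ?R (map ?A u) = Matrix.mat N N (\<lambda>(i, j). ent e N u i j)" if "u \<in> Poly_Mapping.keys P" for u
  proof (rule list_mult_mat)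
    fix x assume "x \<in> set u"
    then have x: "index x \<in> I" using that P unfolding star_polys_def by blast
    show "?A x \<in> carrier_mat N N" using x A mat_adjoint_carrier by (cases x) auto
    show "?A x $$ (j, k) = e x j k" if "j < N" "k < N" for j k
      using x that e e' mat_adjoint_index[OF A that] by (cases x) auto
  qed
  have "trace_poly N X P w = (\<Sum>u\<in>Poly_Mapping.keys P. mat_trace (Poly_Mapping.lookup P u \<cdot>\<^sub>m list_mult ?R (map ?A u)))"
    unfolding trace_poly_def star_eval_def module_mat_simps
    by (rule mat_trace_finsum[THEN conjunct2]) (simp_all add: lm)
  also have "\<dots> = (\<Sum>u\<in>Poly_Mapping.keys P. Poly_Mapping.lookup P u * word_trace e N u)"
    by (intro sum.cong refl) (simp add: lm mat_trace_def word_trace_def sum_distrib_left)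
  finally show ?thesis .
qed

text \<open>\<open>X\<close> holds the raw entries, real or complex, and \<open>Y\<close> the
  normalised complex matrices. On the probability space the trace of an evaluated polynomial equals
  \<open>tpoly\<close>, so all limits carry over.\<close>

lemma second_order_limit_elliptic:
  fixes X :: "nat \<Rightarrow> 'i \<Rightarrow> 'w \<Rightarrow> 'a::euclidean_space mat" and Y :: "nat \<Rightarrow> 'i \<Rightarrow> 'w \<Rightarrow> complex mat"
  assumes E: "\<And>N. N > 0 \<Longrightarrow> elliptic_embedded (M N) N I (X N) \<iota> re im \<gamma> \<theta>"
    and Y: "\<And>N i w. N > 0 \<Longrightarrow> i \<in> I \<Longrightarrow> w \<in> space (M N) \<Longrightarrow> Y N i w \<in> carrier_mat N N"
      "\<And>N i w j k. N > 0 \<Longrightarrow> i \<in> I \<Longrightarrow> w \<in> space (M N) \<Longrightarrow> j < N \<Longrightarrow> k < N \<Longrightarrow>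
         Y N i w $$ (j, k) = \<iota> (X N i w $$ (j, k)) / sqrt N"
  shows "second_order_limit I M Y (lim_space I \<gamma> \<theta>) gen"
proof -
  define e where "e N w = (\<lambda>x j k. elliptic_embedded.entry N I (X N) \<iota> x j k w)" for N w
  define T where "T N u w = word_trace (e N w) N u" for N u w
  have model: "trace_model M T (ell_cov I \<gamma>) \<theta>"
    unfolding trace_model_def
  proof (intro allI impI conjI)
    fix N :: nat assume "N > 0"
    then interpret E: elliptic_embedded "M N" N I "X N" \<iota> re im \<gamma> \<theta> by (rule E)
    have T: "T N u w = word_trace (\<lambda>x i j. E.entry x i j w) N u" for u w
      by (simp add: T_def e_def)
    show "prob_space (M N)" by (rule E.prob_space_axioms)
    show "integrable (M N) (\<lambda>w. \<Prod>u\<leftarrow>Us. T N u w)" for Us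
      using E.integrable_tprod[of Us] by (simp add: T E.tprod_def[abs_def])
    show "loop_moments N (ell_cov I \<gamma>) flip \<theta> (\<lambda>Us. \<integral>w. (\<Prod>u\<leftarrow>Us. T N u w) \<partial>M N)"
      using E.loop_moments by (simp add: T E.tprod_def[abs_def] E.mom_def[abs_def])
    show "T N (u @ v) w = T N (v @ u) w" for u v w
      unfolding T by (rule word_trace_commute)
  qed
  interpret trace_model_loc M T "ell_cov I \<gamma>" \<theta> by unfold_locales (rule model)
  have tp: "trace_poly N (Y N) P w = tpoly N P w" if "N > 0" "P \<in> star_polys I" "w \<in> space (M N)" for N P w
    unfolding tpoly_def T_def
  proof (rule trace_poly_eq[OF that(2)])
    interpret E: elliptic_embedded "M N" N I "X N" \<iota> re im \<gamma> \<theta> using that by (intro E)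
    fix i assume i: "i \<in> I"
    show "Y N i w \<in> carrier_mat N N" using Y that i by blast
    fix j k assume jk: "j < N" "k < N"
    show "Y N i w $$ (j, k) = e N w (Var i) j k"
      using Y(2)[OF that(1) i that(3) jk] i by (simp add: e_def E.entry_def)
    show "cnj (Y N i w $$ (k, j)) = e N w (VarStar i) j k"
      using Y(2)[OF that(1) i that(3) jk(2,1)] i by (simp add: e_def E.entry_def)
  qed
  have cum: "cumulant (M N) (map (trace_poly N (Y N)) Ps) = cumulant (M N) (map (tpoly N) Ps)"
    if "N > 0" "set Ps \<subseteq> star_polys I" for N Ps
    by (rule cumulant_cong) (use tp[OF that(1)] that(2) in \<open>auto dest: nth_mem\<close>)
  have lim: "(\<lambda>N. cumulant (M N) (map (trace_poly N (Y N)) Ps)) \<longlonglongrightarrow> l"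
    if "(\<lambda>N. cumulant (M N) (map (tpoly N) Ps)) \<longlonglongrightarrow> l" "set Ps \<subseteq> star_polys I" for Ps l
  proof (rule Lim_transform_eventually[OF that(1)])
    show "\<forall>\<^sub>F N in sequentially. cumulant (M N) (map (tpoly N) Ps) = cumulant (M N) (map (trace_poly N (Y N)) Ps)"
      using eventually_gt_at_top[of 0] by eventually_elim (simp only: cum[OF _ that(2)])
  qed
  show ?thesis
    unfolding second_order_limit_def
  proof (intro conjI allI ballI impI second_order_star_space_lim_space[OF model])
    show "gen \<in> I \<rightarrow> carrier (lim_space I \<gamma> \<theta>)" by (auto simp: gen_star_polys)
    show "integrable (M N) (\<lambda>w. \<Prod>P\<leftarrow>Ps. trace_poly N (Y N) P w)" if "N > 0" "set Ps \<subseteq> star_polys I" for N Ps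
    proof -
      have "(\<Prod>P\<leftarrow>Ps. trace_poly N (Y N) P w) = (\<Prod>P\<leftarrow>Ps. tpoly N P w)" if w: "w \<in> space (M N)" for w
        using tp[OF \<open>N > 0\<close> _ w] \<open>set Ps \<subseteq> _\<close> by (intro arg_cong[of _ _ prod_list] map_cong) auto
      then show ?thesis using integrable_tpoly[OF that(1), of Ps] by (subst Bochner_Integration.integrable_cong) auto
    qed
    fix P assume P: "P \<in> star_polys I"
    have "(\<lambda>N. \<integral>w. trace_poly N (Y N) P w / of_nat N \<partial>M N) \<longlonglongrightarrow> linext (phiw (ell_cov I \<gamma>)) P"
    proof (rule Lim_transform_eventually[OF expectation_limit])
      show "\<forall>\<^sub>F N in sequentially. (\<integral>w. tpoly N P w / of_nat N \<partial>M N) = (\<integral>w. trace_poly N (Y N) P w / of_nat N \<partial>M N)"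
        using eventually_gt_at_top[of 0]
        by eventually_elim (rule Bochner_Integration.integral_cong, simp_all add: tp[OF _ P])
    qed
    then show "(\<lambda>N. \<integral>w. trace_poly N (Y N) P w / of_nat N \<partial>M N)
      \<longlonglongrightarrow> phi1 (lim_space I \<gamma> \<theta>) (star_eval (lim_space I \<gamma> \<theta>) (star (lim_space I \<gamma> \<theta>)) gen P)"
      unfolding star_eval_lim_space[OF P] unfolding lim_space_simps .
    fix Q assume Q: "Q \<in> star_polys I"
    show "(\<lambda>N. cumulant (M N) [trace_poly N (Y N) P, trace_poly N (Y N) Q])
      \<longlonglongrightarrow> phi2 (lim_space I \<gamma> \<theta>) (star_eval (lim_space I \<gamma> \<theta>) (star (lim_space I \<gamma> \<theta>)) gen P)
         (star_eval (lim_space I \<gamma> \<theta>) (star (lim_space I \<gamma> \<theta>)) gen Q)"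
      unfolding star_eval_lim_space[OF P] star_eval_lim_space[OF Q]
      using lim[of "[P, Q]"] covariance_limit[of P Q] P Q by simp
  next
    fix Ps assume Ps: "set Ps \<subseteq> star_polys I" "3 \<le> length Ps"
    show "(\<lambda>N. cumulant (M N) (map (trace_poly N (Y N)) Ps)) \<longlonglongrightarrow> 0"
      by (rule lim[OF higher_cumulant_limit[OF Ps(2)] Ps(1)])
  qed
qed

text \<open>A diagonal block repeats one entry, and a functional \<open>u\<close> acts on it as
  \<open>fst u + snd u\<close> acts on the entry.\<close>

lemma centered_gaussian_diagonal:
  assumes "centered_gaussian M x"
  shows "centered_gaussian M (\<lambda>w. (x w, x w))"
  using assms unfolding centered_gaussian_def
proof (intro conjI allI)
  assume "x \<in> borel_measurable M \<and> (\<forall>u. \<exists>\<sigma>\<ge>0. distr M borel (\<lambda>w. inner u (x w)) =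
        (if \<sigma> = 0 then return borel 0 else density lborel (normal_density 0 \<sigma>)))"
  then have x: "x \<in> borel_measurable M" and d: "\<And>u. \<exists>\<sigma>\<ge>0. distr M borel (\<lambda>w. inner u (x w)) =
        (if \<sigma> = 0 then return borel 0 else density lborel (normal_density 0 \<sigma>))" by blast+
  show "(\<lambda>w. (x w, x w)) \<in> borel_measurable M" by (rule borel_measurable_Pair[OF x x])
  fix u
  have "inner u (x w, x w) = inner (fst u + snd u) (x w)" for w
    by (simp add: inner_prod_def inner_add_left)
  then show "\<exists>\<sigma>\<ge>0. distr M borel (\<lambda>w. inner u (x w, x w)) =
        (if \<sigma> = 0 then return borel 0 else density lborel (normal_density 0 \<sigma>))"
    using d[of "fst u + snd u"] by (simp only:)
qed

lemma elliptic_familyI: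
  assumes "prob_space M" "independent_matrices M N I X" "\<And>i. i \<in> I \<Longrightarrow> elliptic_independence M N (X i)"
    and off: "\<And>i j k. i \<in> I \<Longrightarrow> j < k \<Longrightarrow> k < N \<Longrightarrow> centered_gaussian M (\<lambda>w. (X i w $$ (j, k), X i w $$ (k, j)))"
    and diag: "\<And>i j. i \<in> I \<Longrightarrow> j < N \<Longrightarrow> centered_gaussian M (\<lambda>w. X i w $$ (j, j))"
  shows "elliptic_family M N I X"
proof -
  interpret prob_space M by (rule assms(1))
  show ?thesis
  proof unfold_locales
    fix i p assume i: "i \<in> I" and p: "p \<in> blocks N"
    obtain j k where jk: "p = (j, k)" "j \<le> k" "k < N" using p by (auto simp: blocks_def)
    show "centered_gaussian M (\<lambda>w. blk (X i w) p)"
    proof (cases "j = k")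
      case True
      then show ?thesis using centered_gaussian_diagonal[OF diag[OF i jk(3)]] by (simp add: blk_def jk(1))
    next
      case False
      then show ?thesis using off[OF i, of j k] jk by (simp add: blk_def)
    qed
  qed (fact assms)+
qed

text \<open>The vectors 1 and \<i> represent the real and the imaginary part;
  \<open>\<theta> = 0\<close> removes the reversing contractions.\<close>

lemma complex_elliptic_embedded:
  assumes "N > 0" "prob_space M" "independent_matrices M N I X" and X: "\<forall>i\<in>I. complex_elliptic M N (\<gamma> i) (X i)"
  shows "elliptic_embedded M N I X id 1 \<i> \<gamma> 0"
proof -
  have ce: "complex_elliptic M N (\<gamma> i) (X i)" if "i \<in> I" for i using X that by blast
  interpret elliptic_family M N I X
    by (rule elliptic_familyI[OF assms(2,3)]) (use ce in \<open>simp_all add: complex_elliptic_def\<close>)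
  have sq: "(\<integral>w. f w * cnj (f w) \<partial>M) = complex_of_real (\<integral>w. (cmod (f w))\<^sup>2 \<partial>M)" for f
    unfolding complex_norm_square[symmetric] by (rule integral_complex_of_real)
  show ?thesis
  proof unfold_locales
    fix i j k assume i: "i \<in> I" and jk: "j < k" "k < N"
    show "expectation (\<lambda>w. (id (X i w $$ (j, k)))\<^sup>2) = 0 \<and>
        expectation (\<lambda>w. (id (X i w $$ (k, j)))\<^sup>2) = 0 \<and>
        expectation (\<lambda>w. id (X i w $$ (j, k)) * id (X i w $$ (k, j))) = \<gamma> i \<and>
        expectation (\<lambda>w. id (X i w $$ (j, k)) * cnj (id (X i w $$ (k, j)))) = 0 * complex_of_real (\<gamma> i) \<and>
        expectation (\<lambda>w. id (X i w $$ (j, k)) * cnj (id (X i w $$ (j, k)))) = 1 \<and>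
        expectation (\<lambda>w. id (X i w $$ (k, j)) * cnj (id (X i w $$ (k, j)))) = 1"
      unfolding id_apply sq using ce[OF i] jk by (simp add: complex_elliptic_def)
  next
    fix i j assume i: "i \<in> I" and j: "j < N"
    show "expectation (\<lambda>w. (id (X i w $$ (j, j)))\<^sup>2) = complex_of_real (\<gamma> i) + 0 \<and>
        expectation (\<lambda>w. id (X i w $$ (j, j)) * cnj (id (X i w $$ (j, j)))) = 1 + 0 * complex_of_real (\<gamma> i)"
      unfolding id_apply sq using ce[OF i] j by (simp add: complex_elliptic_def)
  qed (simp_all add: assms(1) inner_complex_def)
qed

text \<open>The imaginary part is represented by the vector 0. With \<open>\<theta> = 1\<close> the
  conjugated and the plain diagonal covariance are both 1 plus the parameter.\<close>

lemma real_elliptic_embedded: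
  assumes "N > 0" "prob_space M" "independent_matrices M N I X" and X: "\<forall>i\<in>I. real_elliptic M N (\<gamma> i) (X i)"
  shows "elliptic_embedded M N I X complex_of_real 1 0 \<gamma> 1"
proof -
  have ce: "real_elliptic M N (\<gamma> i) (X i)" if "i \<in> I" for i using X that by blast
  interpret elliptic_family M N I X
    by (rule elliptic_familyI[OF assms(2,3)]) (use ce in \<open>simp_all add: real_elliptic_def\<close>)
  have sq: "(\<integral>w. complex_of_real (f w) * complex_of_real (g w) \<partial>M) = complex_of_real (\<integral>w. f w * g w \<partial>M)" for f g
    unfolding of_real_mult[symmetric] by (rule integral_complex_of_real)
  show ?thesis
  proof unfold_locales
    fix i j k assume i: "i \<in> I" and jk: "j < k" "k < N"
    show "expectation (\<lambda>w. (complex_of_real (X i w $$ (j, k)))\<^sup>2) = 1 \<and>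
        expectation (\<lambda>w. (complex_of_real (X i w $$ (k, j)))\<^sup>2) = 1 \<and>
        expectation (\<lambda>w. complex_of_real (X i w $$ (j, k)) * complex_of_real (X i w $$ (k, j))) = \<gamma> i \<and>
        expectation (\<lambda>w. complex_of_real (X i w $$ (j, k)) * cnj (complex_of_real (X i w $$ (k, j)))) = 1 * complex_of_real (\<gamma> i) \<and>
        expectation (\<lambda>w. complex_of_real (X i w $$ (j, k)) * cnj (complex_of_real (X i w $$ (j, k)))) = 1 \<and>
        expectation (\<lambda>w. complex_of_real (X i w $$ (k, j)) * cnj (complex_of_real (X i w $$ (k, j)))) = 1"
      unfolding complex_cnj_complex_of_real power2_eq_square sq
      using ce[OF i] jk by (simp add: real_elliptic_def power2_eq_square)
  next
    fix i j assume i: "i \<in> I" and j: "j < N"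
    show "expectation (\<lambda>w. (complex_of_real (X i w $$ (j, j)))\<^sup>2) = complex_of_real (\<gamma> i) + 1 \<and>
        expectation (\<lambda>w. complex_of_real (X i w $$ (j, j)) * cnj (complex_of_real (X i w $$ (j, j)))) = 1 + 1 * complex_of_real (\<gamma> i)"
      unfolding complex_cnj_complex_of_real power2_eq_square sq
      using ce[OF i] j by (simp add: real_elliptic_def power2_eq_square)
  qed (simp_all add: assms(1))
qed

theorem theorem1p8:
  fixes I :: "'i set" and \<gamma> :: "'i \<Rightarrow> real"
  assumes "\<And>i. i \<in> I \<Longrightarrow> \<gamma> i \<in> {-1..1}"
  shows
    "(\<forall>(M :: nat \<Rightarrow> 'v measure) (X :: nat \<Rightarrow> 'i \<Rightarrow> 'v \<Rightarrow> complex mat).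
        (\<forall>N>0. prob_space (M N) \<and> independent_matrices (M N) N I (X N) \<and>
               (\<forall>i\<in>I. complex_elliptic (M N) N (\<gamma> i) (X N i))) \<longrightarrow>
        asymptotically_second_order_free I M (\<lambda>N i w. normalized N (X N i w))) \<and>
     (\<forall>(M :: nat \<Rightarrow> 'w measure) (X :: nat \<Rightarrow> 'i \<Rightarrow> 'w \<Rightarrow> real mat).
        (\<forall>N>0. prob_space (M N) \<and> independent_matrices (M N) N I (X N) \<and>
               (\<forall>i\<in>I. real_elliptic (M N) N (\<gamma> i) (X N i))) \<longrightarrow>
        asymptotically_real_second_order_free I M (\<lambda>N i w. normalized N (X N i w)))"
proof (intro conjI allI impI)
  fix M :: "nat \<Rightarrow> 'v measure" and X :: "nat \<Rightarrow> 'i \<Rightarrow> 'v \<Rightarrow> complex mat"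
  assume H: "\<forall>N>0. prob_space (M N) \<and> independent_matrices (M N) N I (X N) \<and>
    (\<forall>i\<in>I. complex_elliptic (M N) N (\<gamma> i) (X N i))"
  have E: "elliptic_embedded (M N) N I (X N) id 1 \<i> \<gamma> 0" if "N > 0" for N
    using H that by (intro complex_elliptic_embedded) blast+
  have X: "X N i w \<in> carrier_mat N N" if "N > 0" "i \<in> I" "w \<in> space (M N)" for N i w
  proof -
    have "complex_elliptic (M N) N (\<gamma> i) (X N i)" using H that by blast
    then show ?thesis using that(3) unfolding complex_elliptic_def elliptic_independence_def by blast
  qed
  have "second_order_limit I M (\<lambda>N i w. normalized N (X N i w)) (lim_space I \<gamma> 0) gen"
  proof (rule second_order_limit_elliptic[OF E])
    fix N i w assume N: "N > 0" "i \<in> I" "w \<in> space (M N)"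
    note c = X[OF N]
    show "normalized N (X N i w) \<in> carrier_mat N N" using c by (simp add: normalized_def)
    show "normalized N (X N i w) $$ (j, k) = id (X N i w $$ (j, k)) / complex_of_real (sqrt N)" if "j < N" "k < N" for j k
      using c that by (simp add: normalized_def)
  qed
  then show "asymptotically_second_order_free I M (\<lambda>N i w. normalized N (X N i w))"
    unfolding asymptotically_second_order_free_def using second_order_free_lim_space by blast
next
  fix M :: "nat \<Rightarrow> 'w measure" and X :: "nat \<Rightarrow> 'i \<Rightarrow> 'w \<Rightarrow> real mat"
  assume H: "\<forall>N>0. prob_space (M N) \<and> independent_matrices (M N) N I (X N) \<and>
    (\<forall>i\<in>I. real_elliptic (M N) N (\<gamma> i) (X N i))"
  have E: "elliptic_embedded (M N) N I (X N) complex_of_real 1 0 \<gamma> 1" if "N > 0" for N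
    using H that by (intro real_elliptic_embedded) blast+
  have X: "X N i w \<in> carrier_mat N N" if "N > 0" "i \<in> I" "w \<in> space (M N)" for N i w
  proof -
    have "real_elliptic (M N) N (\<gamma> i) (X N i)" using H that by blast
    then show ?thesis using that(3) unfolding real_elliptic_def elliptic_independence_def by blast
  qed
  have L: "second_order_limit I M (\<lambda>N i w. map_mat complex_of_real (normalized N (X N i w))) (lim_space I \<gamma> 1) gen"
  proof (rule second_order_limit_elliptic[OF E])
    fix N i w assume N: "N > 0" "i \<in> I" "w \<in> space (M N)"
    note c = X[OF N]
    show "map_mat complex_of_real (normalized N (X N i w)) \<in> carrier_mat N N" using c by (simp add: normalized_def)
    show "map_mat complex_of_real (normalized N (X N i w)) $$ (j, k) = complex_of_real (X N i w $$ (j, k)) / complex_of_real (sqrt N)"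
      if "j < N" "k < N" for j k
      using c that by (simp add: normalized_def)
  qed
  have "\<forall>i\<in>I. ptr (gen i) = star (lim_space I \<gamma> 1) (gen i) \<and> ptr (star (lim_space I \<gamma> 1) (gen i)) = gen i"
    by (simp add: pstar_gen ptr_gen)
  then show "asymptotically_real_second_order_free I M (\<lambda>N i w. normalized N (X N i w))"
    unfolding asymptotically_real_second_order_free_def
    using L anti_involution_ptr real_second_order_free_lim_space by blast
qed

end
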